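(* Assume the Weak Schanuel Conjecture. Let $K_1/\mathbb{Q}$ and $K_2/\mathbb{Q}$ be real Galois number fields, with $n_i=[K_i:\mathbb{Q}]$ for $i=1,2$. If $n_1,n_2>3$, then $[\Lambda_{K_1}]=[\Lambda_{K_2}]$ if and only if $K_1\cong K_2$.
   Context: Weak Schanuel Conjecture: if $\ell_1,\dots,\ell_m\in\mathbb{C}$ are $\mathbb{Q}$-linearly independent logarithms of algebraic numbers, then they are algebraically independent. For a totally real field $K$ of degree $n$ with embeddings $\sigma_1,\dots,\sigma_n$, the log unit lattice is $\Lambda_K=\{(\log|\sigma_1(u)|,\dots,\log|\sigma_n(u)|):u\in\mathcal{O}_K^\times\}\subset\mathbb{R}^n$ with the standard inner product. $[\Lambda]$ denotes the similarity class: $[\Lambda_1]=[\Lambda_2]$ iff there are bases $B_1,B_2$ with Gram matrices satisfying $\mathrm{Gr}_{B_1}=\lambda\,\mathrm{Gr}_{B_2}$ for some $\lambda\in\mathbb{R}$, where $\mathrm{Gr}_B=(\langle v_i,v_j\rangle)_{i,j}$. *)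

theory Defs
  imports
    "HOL-Analysis.Analysis"
    "HOL-Computational_Algebra.Polynomial"
    "HOL-Library.Poly_Mapping"
begin

(* Number fields are modelled as types of class field_char_0 that are finite-dimensional over the
   rationals. *)

definition rat_scale :: "rat \<Rightarrow> 'k::field_char_0 \<Rightarrow> 'k"
  where "rat_scale q x = of_rat q * x"

lemma vector_space_rat_scale: "vector_space (rat_scale :: rat \<Rightarrow> 'k::field_char_0 \<Rightarrow> 'k)"
  by unfold_locales (simp_all add: rat_scale_def algebra_simps of_rat_add of_rat_mult)

definition number_field :: "'k::field_char_0 itself \<Rightarrow> bool"
  where "number_field _ \<longleftrightarrow>
    (\<exists>B::'k set. finite B \<and> module.span rat_scale B = UNIV)"

definition field_degree :: "'k::field_char_0 itself \<Rightarrow> nat"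
  where "field_degree _ = vector_space.dim rat_scale (UNIV :: 'k set)"

definition is_field_hom :: "('k::field \<Rightarrow> 'l::field) \<Rightarrow> bool"
  where "is_field_hom f \<longleftrightarrow> f 1 = 1 \<and> (\<forall>x y. f (x + y) = f x + f y) \<and> (\<forall>x y. f (x * y) = f x * f y)"

definition is_field_iso :: "('k::field \<Rightarrow> 'l::field) \<Rightarrow> bool"
  where "is_field_iso f \<longleftrightarrow> is_field_hom f \<and> bij f"

definition fields_isomorphic :: "'k::field itself \<Rightarrow> 'l::field itself \<Rightarrow> bool"
  where "fields_isomorphic _ _ \<longleftrightarrow> (\<exists>f :: 'k \<Rightarrow> 'l. is_field_iso f)"

(* A finite extension K/F is Galois iff |Aut(K/F)| = [K:F].  Over the rationals, every field
   automorphism fixes the base field. *)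
definition galois_number_field :: "'k::field_char_0 itself \<Rightarrow> bool"
  where "galois_number_field T \<longleftrightarrow>
    number_field T \<and> card {f :: 'k \<Rightarrow> 'k. is_field_iso f} = field_degree T"

definition embeddings :: "('k::field_char_0 \<Rightarrow> complex) set"
  where "embeddings = {\<sigma>. is_field_hom \<sigma>}"

definition totally_real :: "'k::field_char_0 itself \<Rightarrow> bool"
  where "totally_real _ \<longleftrightarrow> (\<forall>\<sigma> \<in> (embeddings :: ('k \<Rightarrow> complex) set). range \<sigma> \<subseteq> \<real>)"

definition integer_units :: "'k::field_char_0 set"
  where "integer_units = {u. algebraic_int u \<and> (\<exists>v. algebraic_int v \<and> u * v = 1)}"

(* The index type 'n plays the role of {1..n}: the family \<sigma> is meant to enumerate the embeddings
   of 'k without repetition. *)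
definition log_unit_lattice :: "('n::finite \<Rightarrow> 'k::field_char_0 \<Rightarrow> complex) \<Rightarrow> (real ^ 'n) set"
  where "log_unit_lattice \<sigma> = {(\<chi> i. ln (cmod (\<sigma> i u))) | u. u \<in> integer_units}"

definition lattice_basis :: "'v::real_vector list \<Rightarrow> 'v set \<Rightarrow> bool"
  where "lattice_basis B L \<longleftrightarrow>
    distinct B \<and> independent (set B) \<and>
    L = {(\<Sum>i<length B. real_of_int (c i) *\<^sub>R B ! i) | c :: nat \<Rightarrow> int. True}"

definition gram :: "'v::real_inner list \<Rightarrow> nat \<Rightarrow> nat \<Rightarrow> real"
  where "gram B i j = inner (B ! i) (B ! j)"

definition lattice_similar :: "'v::real_inner set \<Rightarrow> 'w::real_inner set \<Rightarrow> bool"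
  where "lattice_similar L1 L2 \<longleftrightarrow>
    (\<exists>B1 B2 (r::real). lattice_basis B1 L1 \<and> lattice_basis B2 L2 \<and> length B1 = length B2 \<and>
      (\<forall>i<length B1. \<forall>j<length B1. gram B1 i j = r * gram B2 i j))"

(* Polynomials over the rationals in the variables X_0, X_1, ... are finitely supported maps from
   exponent vectors (themselves finitely supported) to coefficients. *)
type_synonym rat_mpoly = "(nat \<Rightarrow>\<^sub>0 nat) \<Rightarrow>\<^sub>0 rat"

definition mpoly_vars :: "rat_mpoly \<Rightarrow> nat set"
  where "mpoly_vars p = (\<Union>\<alpha> \<in> Poly_Mapping.keys p. Poly_Mapping.keys \<alpha>)"

definition mpoly_eval :: "rat_mpoly \<Rightarrow> (nat \<Rightarrow> complex) \<Rightarrow> complex"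
  where "mpoly_eval p x =
    (\<Sum>\<alpha> \<in> Poly_Mapping.keys p. of_rat (Poly_Mapping.lookup p \<alpha>) *
      (\<Prod>i \<in> Poly_Mapping.keys \<alpha>. x i ^ Poly_Mapping.lookup \<alpha> i))"

definition algebraically_independent :: "nat \<Rightarrow> (nat \<Rightarrow> complex) \<Rightarrow> bool"
  where "algebraically_independent m x \<longleftrightarrow>
    (\<forall>p. mpoly_vars p \<subseteq> {..<m} \<longrightarrow> mpoly_eval p x = 0 \<longrightarrow> p = 0)"

definition rat_linearly_independent :: "nat \<Rightarrow> (nat \<Rightarrow> complex) \<Rightarrow> bool"
  where "rat_linearly_independent m x \<longleftrightarrow>
    (\<forall>c :: nat \<Rightarrow> rat. (\<Sum>i<m. of_rat (c i) * x i) = 0 \<longrightarrow> (\<forall>i<m. c i = 0))"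

definition weak_schanuel_conjecture :: bool
  where "weak_schanuel_conjecture \<longleftrightarrow>
    (\<forall>m (l :: nat \<Rightarrow> complex).
      (\<forall>i<m. algebraic (exp (l i))) \<longrightarrow> rat_linearly_independent m l \<longrightarrow>
      algebraically_independent m l)"

end

theory Submission
  imports Defs "Jordan_Normal_Form.Char_Poly"
begin

text \<open>
  Fix a real embedding of \<open>K\<close> with Galois group \<open>G\<close>. The rational span \<open>V\<close> of the logarithms of the
  absolute values of units carries an action of \<open>G\<close>, and the inner product on the log unit lattice is
  \<open>b(x, y) = \<Sum>g. g x \<cdot> g y\<close>. Eliminating the similarity factor turns a similarity \<open>\<phi>\<close> into
  the quartic relations \<open>b\<^sub>1(x, y) b\<^sub>2(\<phi> z, \<phi> w) = b\<^sub>1(z, w) b\<^sub>2(\<phi> x, \<phi> y)\<close> between logarithms of algebraic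
  numbers, which under the conjecture survive every rational linear substitution of \<open>V\<^sub>1 + V\<^sub>2\<close>.

  Suppose \<open>V\<^sub>1\<close> is not contained in \<open>V\<^sub>2\<close>, and consider substitutions that are the identity on \<open>V\<^sub>2\<close>. If
  \<open>V\<^sub>1 \<inter> V\<^sub>2\<close> contains some \<open>x \<noteq> 0\<close>, then it contains all conjugates of \<open>x\<close>, and sending an element
  \<open>z\<close> of \<open>V\<^sub>1\<close> outside \<open>V\<^sub>2\<close> to a large number violates the relation for \<open>x, x, z, z\<close>. If \<open>V\<^sub>1 \<inter> V\<^sub>2 = 0\<close>,
  then the conjugates of a Minkowski unit can be sent to arbitrary numbers \<open>\<xi> g\<close> of sum zero, so that
  the forms \<open>\<Sum>g. \<xi> g \<cdot> \<xi> (g h)\<close> would all be proportional, which fails as soon as \<open>|G| > 3\<close>. Hence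
  \<open>V\<^sub>1 \<subseteq> V\<^sub>2\<close>, so a power of a Minkowski unit, which generates \<open>K\<^sub>1\<close>, lies in \<open>K\<^sub>2\<close>; by symmetry the two
  fields have the same image in the reals. The converse only needs the log unit lattice to be discrete.
\<close>

text \<open>The similarity factor is an unknown real number, out of reach of the conjecture;
  cross-multiplying leaves polynomial identities with rational coefficients. The map
  \<open>\<phi>\<close> enters only through logarithms of its values, so it need not be additive.
  That G acts on V rests on realness: a real unit of absolute value 1 is 1 or -1, so the single
  number l(u) determines u up to sign, and rational relations between logarithms can be conjugated.
  A substitution that is the identity on V_2 freezes every factor b_2, and positivity of the pairing
  does the rest. The Minkowski unit is built to have all conjugates but the identity of absolute
  value below 1. A maximum argument then shows that the conjugate logarithms satisfy no rational
  relation beyond having sum zero; the rank of the unit group is never computed. The bound 3 is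
  sharp. For |G| = 3 and sum zero, the sum of \<xi> g times \<xi> (g h) is -1/2 times the sum of
  squares for each h other than 1, and all cyclic cubic fields have hexagonal log unit
  lattices.\<close>

unbundle no m_inv_syntax

section \<open>Algebraic integers\<close>

text \<open>The assumption makes \<open>w\<close> an eigenvector of the integer matrix
  \<open>a\<close>, so \<open>x\<close> is a root of its characteristic polynomial, which is monic
  over the integers. Closure under ring operations and clearing of denominators both reduce to this
  criterion.\<close>

lemma eigenvalue_of_int_matrix_algebraic_int:
  fixes w :: "nat \<Rightarrow> 'a::field_char_0" and a :: "nat \<Rightarrow> nat \<Rightarrow> int"
  assumes nz: "i0 < n" "w i0 \<noteq> 0"
    and eq: "\<And>i. i < n \<Longrightarrow> x * w i = (\<Sum>j<n. of_int (a i j) * w j)"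
  shows "algebraic_int x"
proof -
  define A where "A = mat n n (\<lambda>(i, j). a i j)"
  define v where "v = vec n w"
  have A: "A \<in> carrier_mat n n" by (simp add: A_def)
  have "map_mat of_int A *\<^sub>v v = x \<cdot>\<^sub>v v"
    by (rule eq_vecI)
      (auto simp: A_def v_def scalar_prod_def eq lessThan_atLeast0 intro!: sum.cong)
  moreover have "v \<noteq> 0\<^sub>v n"
  proof
    assume "v = 0\<^sub>v n"
    then have "vec_index v i0 = vec_index (0\<^sub>v n) i0" by simp
    then show False using nz by (simp add: v_def)
  qed
  ultimately have "eigenvalue (map_mat of_int A) x"
    unfolding eigenvalue_def eigenvector_def using A by (intro exI[of _ v]) (auto simp: v_def)
  then have "poly (char_poly (map_mat of_int A)) x = 0"
    using eigenvalue_root_char_poly[of "map_mat of_int A" n x] A by simp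
  moreover have "char_poly (map_mat of_int A) = map_poly (of_int :: int \<Rightarrow> 'a) (char_poly A)"
    using of_int_hom.char_poly_hom[OF A] .
  moreover have "lead_coeff (char_poly A) = 1"
    using degree_monic_char_poly[OF A] by simp
  ultimately show ?thesis
    unfolding algebraic_int_altdef_ipoly by metis
qed

lemma eigenvalue_of_int_family_algebraic_int:
  fixes w :: "'i \<Rightarrow> 'a::field_char_0"
  assumes fin: "finite I" and nz: "i0 \<in> I" "w i0 \<noteq> 0"
    and eq: "\<And>i. i \<in> I \<Longrightarrow> \<exists>a :: 'i \<Rightarrow> int. x * w i = (\<Sum>j\<in>I. of_int (a j) * w j)"
  shows "algebraic_int x"
proof -
  from fin obtain e where e: "bij_betw e {..<card I} I"
    using ex_bij_betw_nat_finite[OF fin] by (auto simp: lessThan_atLeast0)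
  from eq obtain a :: "'i \<Rightarrow> 'i \<Rightarrow> int"
    where a: "\<And>i. i \<in> I \<Longrightarrow> x * w i = (\<Sum>j\<in>I. of_int (a i j) * w j)"
    by metis
  have "i0 \<in> e ` {..<card I}" using e nz by (simp add: bij_betw_def)
  then obtain k where k: "k < card I" "e k = i0" by blast
  show ?thesis
  proof (rule eigenvalue_of_int_matrix_algebraic_int[of k "card I" "w \<circ> e" x "\<lambda>i j. a (e i) (e j)"])
    show "k < card I" "(w \<circ> e) k \<noteq> 0" using k nz by auto
    fix i assume "i < card I"
    then have "e i \<in> I" using e by (auto simp: bij_betw_def)
    then show "x * (w \<circ> e) i = (\<Sum>j<card I. of_int (a (e i) (e j)) * (w \<circ> e) j)"
      using sum.reindex_bij_betw[OF e, of "\<lambda>j. of_int (a (e i) j) * w j"] by (simp add: a)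
  qed
qed

text \<open>Both numbers satisfy monic relations, so the finitely many monomials x^i y^j below the
  two degrees generate an additive group \<open>M\<close> that multiplication by \<open>x\<close>
  and by \<open>y\<close> preserves. Then x + y and x y preserve it too, and the monomials form the
  eigenvector.\<close>

lemma algebraic_int_add_mult:
  fixes x y :: "'a::field_char_0"
  assumes "algebraic_int x" "algebraic_int y"
  shows "algebraic_int (x + y)" and "algebraic_int (x * y)"
proof -
  have power: "\<exists>n>0. \<exists>c :: nat \<Rightarrow> int. z ^ n = (\<Sum>i<n. of_int (c i) * z ^ i)"
    if z: "algebraic_int z" for z :: 'a
  proof -
    from z obtain p where p: "poly (map_poly of_int p) z = 0" "lead_coeff p = 1"
      unfolding algebraic_int_altdef_ipoly by blast
    define n where "n = degree p"
    \<comment> \<open>A monic constant is 1 and has no root. Positive degrees put the nonzero entry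
      w (0, 0) = 1 into the family below.\<close>
    have n: "n > 0"
    proof (rule ccontr)
      assume "\<not> n > 0"
      then obtain c where "p = [:c:]" by (auto simp: n_def elim: degree_eq_zeroE)
      with p show False by simp
    qed
    have "0 = (\<Sum>i\<le>n. of_int (coeff p i) * z ^ i)"
      using p(1) by (simp add: poly_altdef n_def degree_map_poly coeff_map_poly)
    also have "{..n} = insert n {..<n}" by auto
    also have "(\<Sum>i\<in>insert n {..<n}. of_int (coeff p i) * z ^ i) = z ^ n + (\<Sum>i<n. of_int (coeff p i) * z ^ i)"
      using p(2) by (simp add: n_def)
    finally have "z ^ n = - (\<Sum>i<n. of_int (coeff p i) * z ^ i)"
      by (metis eq_neg_iff_add_eq_0)
    then have "z ^ n = (\<Sum>i<n. of_int (- coeff p i) * z ^ i)"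
      by (simp add: sum_negf)
    with n show ?thesis by (intro exI[of _ n] conjI exI[of _ "\<lambda>i. - coeff p i"])
  qed
  obtain m c where m: "m > 0" "x ^ m = (\<Sum>i<m. of_int (c i :: int) * x ^ i)"
    using power[OF assms(1)] by metis
  obtain n d where n: "n > 0" "y ^ n = (\<Sum>i<n. of_int (d i :: int) * y ^ i)"
    using power[OF assms(2)] by metis
  define I where "I = {..<m} \<times> {..<n}"
  define w where "w = (\<lambda>(i, j). x ^ i * y ^ j)"
  define M where "M = {\<Sum>k\<in>I. of_int (a k) * w k | a :: nat \<times> nat \<Rightarrow> int. True}"
  have fin: "finite I" by (simp add: I_def)
  have M_I: "(\<Sum>k\<in>I. of_int (a k) * w k) \<in> M" for a :: "nat \<times> nat \<Rightarrow> int"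
    unfolding M_def by (rule CollectI, rule exI[of _ a]) simp
  have M_add: "u + v \<in> M" if uv: "u \<in> M" "v \<in> M" for u v
  proof -
    from uv obtain a b :: "nat \<times> nat \<Rightarrow> int"
      where "u = (\<Sum>k\<in>I. of_int (a k) * w k)" "v = (\<Sum>k\<in>I. of_int (b k) * w k)"
      by (auto simp: M_def)
    then have "u + v = (\<Sum>k\<in>I. of_int (a k + b k) * w k)"
      by (simp add: sum.distrib algebra_simps)
    then show ?thesis by (simp only: M_I)
  qed
  have M_scale: "of_int c * u \<in> M" if u: "u \<in> M" for c :: int and u
  proof -
    from u obtain a :: "nat \<times> nat \<Rightarrow> int" where "u = (\<Sum>k\<in>I. of_int (a k) * w k)"
      by (auto simp: M_def)
    then have "of_int c * u = (\<Sum>k\<in>I. of_int (c * a k) * w k)"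
      by (simp add: sum_distrib_left mult.assoc)
    then show ?thesis by (simp only: M_I)
  qed
  have M_w: "w k \<in> M" if "k \<in> I" for k
  proof -
    have "(\<Sum>k'\<in>I. of_int (if k' = k then 1 else 0) * w k') = (\<Sum>k'\<in>I. if k' = k then w k' else 0)"
      by (rule sum.cong) auto
    also have "\<dots> = w k" using that fin by simp
    finally show ?thesis using M_I by metis
  qed
  have M_0: "0 \<in> M" using M_I[of "\<lambda>_. 0"] by simp
  have M_sum: "(\<Sum>k\<in>J. f k) \<in> M" if "\<And>k. k \<in> J \<Longrightarrow> f k \<in> M" for J :: "'b set" and f
    using that by (induction J rule: infinite_finite_induct) (auto intro: M_0 M_add)
  have x_stable: "x * w k \<in> M" if k: "k \<in> I" for k
  proof -
    obtain i j where ij: "k = (i, j)" "i < m" "j < n" using k by (auto simp: I_def)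
    show ?thesis
    proof (cases "Suc i < m")
      case True
      then have "x * w k = w (Suc i, j)" "(Suc i, j) \<in> I" using ij by (auto simp: w_def I_def)
      then show ?thesis using M_w by simp
    next
      case False
      then have "Suc i = m" using ij by simp
      then have "x * w k = x ^ m * y ^ j" using ij by (auto simp: w_def)
      also have "\<dots> = (\<Sum>i<m. of_int (c i) * w (i, j))"
        by (simp add: m(2) w_def sum_distrib_right mult.assoc)
      also have "\<dots> \<in> M" using ij by (intro M_sum M_scale M_w) (auto simp: I_def)
      finally show ?thesis .
    qed
  qed
  have y_stable: "y * w k \<in> M" if k: "k \<in> I" for k
  proof -
    obtain i j where ij: "k = (i, j)" "i < m" "j < n" using k by (auto simp: I_def)
    show ?thesis
    proof (cases "Suc j < n")
      case True
      then have "y * w k = w (i, Suc j)" "(i, Suc j) \<in> I" using ij by (auto simp: w_def I_def)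
      then show ?thesis using M_w by simp
    next
      case False
      then have "Suc j = n" using ij by simp
      then have "y * w k = x ^ i * y ^ n" using ij by (auto simp: w_def)
      also have "\<dots> = (\<Sum>j<n. of_int (d j) * w (i, j))"
        by (simp add: n(2) w_def sum_distrib_left mult_ac)
      also have "\<dots> \<in> M" using ij by (intro M_sum M_scale M_w) (auto simp: I_def)
      finally show ?thesis .
    qed
  qed
  have M_stable: "z * u \<in> M" if z: "\<And>k. k \<in> I \<Longrightarrow> z * w k \<in> M" and u: "u \<in> M" for z u
  proof -
    from u obtain a :: "nat \<times> nat \<Rightarrow> int" where "u = (\<Sum>k\<in>I. of_int (a k) * w k)"
      by (auto simp: M_def)
    then have "z * u = (\<Sum>k\<in>I. of_int (a k) * (z * w k))"
      by (simp add: sum_distrib_left mult_ac)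
    also have "\<dots> \<in> M" by (intro M_sum M_scale z)
    finally show ?thesis .
  qed
  have integral: "algebraic_int z" if z: "\<And>k. k \<in> I \<Longrightarrow> z * w k \<in> M" for z
  proof (rule eigenvalue_of_int_family_algebraic_int[OF fin, of "(0, 0)" w])
    show "(0, 0) \<in> I" using m n by (simp add: I_def)
    show "w (0, 0) \<noteq> 0" by (simp add: w_def)
    show "\<exists>a :: nat \<times> nat \<Rightarrow> int. z * w k = (\<Sum>j\<in>I. of_int (a j) * w j)" if "k \<in> I" for k
      using z[OF that] by (auto simp: M_def)
  qed
  show "algebraic_int (x + y)"
    by (rule integral) (simp add: distrib_right M_add x_stable y_stable)
  show "algebraic_int (x * y)"
    by (rule integral) (simp add: mult.assoc M_stable x_stable y_stable)
qed

section \<open>Field homomorphisms and the fixed field\<close>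

context
  fixes f :: "'k::field_char_0 \<Rightarrow> 'l::field_char_0"
  assumes f: "is_field_hom f"
begin

lemma field_hom_1: "f 1 = 1" and field_hom_add: "f (x + y) = f x + f y"
  and field_hom_mult: "f (x * y) = f x * f y"
  using f by (auto simp: is_field_hom_def)

lemma field_hom_0: "f 0 = 0"
  using field_hom_add[of 0 0] by simp

lemma field_hom_minus: "f (- x) = - f x"
  using field_hom_add[of x "- x"] by (simp add: field_hom_0 eq_neg_iff_add_eq_0 add.commute)

lemma field_hom_diff: "f (x - y) = f x - f y"
  using field_hom_add[of x "- y"] by (simp add: field_hom_minus)

lemma field_hom_eq_0_iff: "f x = 0 \<longleftrightarrow> x = 0"
proof
  assume "f x = 0"
  show "x = 0"
  proof (rule ccontr)
    assume "x \<noteq> 0"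
    then have "f x * f (inverse x) = 1" by (simp add: field_hom_1 flip: field_hom_mult)
    with \<open>f x = 0\<close> show False by simp
  qed
qed (simp add: field_hom_0)

lemma field_hom_inj: "inj f"
  by (rule injI) (metis eq_iff_diff_eq_0 field_hom_diff field_hom_eq_0_iff)

lemma field_hom_inverse: "f (inverse x) = inverse (f x)"
proof (cases "x = 0")
  case False
  then have "f x * f (inverse x) = 1" by (simp add: field_hom_1 flip: field_hom_mult)
  then show ?thesis by (metis inverse_unique)
qed (simp add: field_hom_0)

lemma field_hom_divide: "f (x / y) = f x / f y"
  by (simp add: divide_inverse field_hom_mult field_hom_inverse)

lemma field_hom_power: "f (x ^ n) = f x ^ n"
  by (induction n) (simp_all add: field_hom_1 field_hom_mult)

lemma field_hom_sum: "f (\<Sum>i\<in>I. h i) = (\<Sum>i\<in>I. f (h i))"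
  by (induction I rule: infinite_finite_induct) (simp_all add: field_hom_0 field_hom_add)

lemma field_hom_prod: "f (\<Prod>i\<in>I. h i) = (\<Prod>i\<in>I. f (h i))"
  by (induction I rule: infinite_finite_induct) (simp_all add: field_hom_1 field_hom_mult)

lemma field_hom_of_nat: "f (of_nat n) = of_nat n"
  by (induction n) (simp_all add: field_hom_0 field_hom_1 field_hom_add)

lemma field_hom_of_int: "f (of_int n) = of_int n"
  by (cases n rule: int_cases2) (simp_all add: field_hom_of_nat field_hom_minus)

lemma field_hom_of_rat: "f (of_rat q) = of_rat q"
  by (cases q) (simp add: of_rat_rat field_hom_divide field_hom_of_int)

lemma field_hom_poly_of_rat: "f (poly (map_poly of_rat p) x) = poly (map_poly of_rat p) (f x)"
  by (simp add: poly_altdef field_hom_sum field_hom_mult field_hom_power coeff_map_poly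
      field_hom_of_rat degree_map_poly)

lemma field_hom_poly_of_int: "f (poly (map_poly of_int p) x) = poly (map_poly of_int p) (f x)"
  by (simp add: poly_altdef field_hom_sum field_hom_mult field_hom_power coeff_map_poly
      field_hom_of_int degree_map_poly)

lemma field_hom_algebraic_int: "algebraic_int x \<Longrightarrow> algebraic_int (f x)"
  unfolding algebraic_int_altdef_ipoly by (metis field_hom_poly_of_int field_hom_0)

lemma field_hom_map_poly_mult: "map_poly f (p * q) = map_poly f p * map_poly f q"
  by (rule poly_eqI) (simp add: coeff_map_poly coeff_mult field_hom_0 field_hom_sum field_hom_mult)

lemma field_hom_map_poly_linear: "map_poly f [:- a, 1:] = [:- f a, 1:]"
  by (simp add: map_poly_pCons field_hom_0 field_hom_1 field_hom_minus)

lemma field_hom_map_poly_prod: "map_poly f (\<Prod>i\<in>I. p i) = (\<Prod>i\<in>I. map_poly f (p i))"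
  by (induction I rule: infinite_finite_induct) (simp_all add: field_hom_map_poly_mult field_hom_1)

end

lemma field_hom_comp: "is_field_hom f \<Longrightarrow> is_field_hom g \<Longrightarrow> is_field_hom (g \<circ> f)"
  by (simp add: is_field_hom_def)

section \<open>Independence of field homomorphisms and bounds on their number\<close>

text \<open>Elimination: a nonzero coefficient a e t lets the equation e be solved for the unknown t
  and removed together with it, which preserves the surplus of unknowns.\<close>

lemma homogeneous_system_nontrivial:
  fixes a :: "'e \<Rightarrow> 's \<Rightarrow> 'l::field"
  assumes "finite E" "finite S" "card E < card S"
  shows "\<exists>c. (\<exists>s\<in>S. c s \<noteq> 0) \<and> (\<forall>e\<in>E. (\<Sum>s\<in>S. a e s * c s) = 0)"
  using assms
proof (induction E arbitrary: S a rule: finite_induct)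
  case empty
  then show ?case by (intro exI[of _ "\<lambda>_. 1"]) (auto simp: card_gt_0_iff)
next
  case (insert e E)
  show ?case
  proof (cases "\<forall>s\<in>S. a e s = 0")
    case True
    have "card E < card S" using insert by simp
    then obtain c where "\<exists>s\<in>S. c s \<noteq> 0" "\<forall>e\<in>E. (\<Sum>s\<in>S. a e s * c s) = 0"
      using insert.IH[OF insert.prems(1), of a] by blast
    with True show ?thesis by (intro exI[of _ c]) auto
  next
    case False
    then obtain t where t: "t \<in> S" "a e t \<noteq> 0" by auto
    define S' where "S' = S - {t}"
    have S': "finite S'" "S = insert t S'" "t \<notin> S'" "card E < card S'"
      using insert t by (auto simp: S'_def card_Diff_singleton)
    from insert.IH[OF S'(1,4), of "\<lambda>e' s. a e' s - a e' t * a e s / a e t"]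
    obtain c where c: "\<exists>s\<in>S'. c s \<noteq> 0"
      "\<And>e'. e' \<in> E \<Longrightarrow> (\<Sum>s\<in>S'. (a e' s - a e' t * a e s / a e t) * c s) = 0" by blast
    define d where "d = - (\<Sum>s\<in>S'. a e s * c s) / a e t"
    define c' where "c' = c(t := d)"
    have expand: "(\<Sum>s\<in>S. a e' s * c' s) = a e' t * d + (\<Sum>s\<in>S'. a e' s * c s)" for e'
      unfolding S'(2) using S' by (simp add: c'_def cong: sum.cong) (intro sum.cong, auto)
    have "(\<Sum>s\<in>S. a e s * c' s) = 0"
      using t by (simp add: expand d_def)
    moreover have "(\<Sum>s\<in>S. a e' s * c' s) = 0" if "e' \<in> E" for e'
    proof -
      have "0 = (\<Sum>s\<in>S'. a e' s * c s) - (\<Sum>s\<in>S'. a e' t / a e t * (a e s * c s))"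
        using c(2)[OF that] by (simp add: algebra_simps sum_subtractf)
      also have "\<dots> = a e' t * d + (\<Sum>s\<in>S'. a e' s * c s)"
        by (simp add: d_def sum_distrib_left sum_divide_distrib)
      finally show ?thesis by (simp add: expand)
    qed
    moreover have "\<exists>s\<in>S. c' s \<noteq> 0"
      using c(1) S' by (auto simp: c'_def)
    ultimately show ?thesis by blast
  qed
qed

text \<open>Dedekind's argument: the relation at x y minus t y times the relation at x cancels the
  term of \<open>t\<close>, while a \<open>y\<close> with s y different from t y keeps the term of
  \<open>s\<close> alive for the induction.\<close>

lemma field_homs_independent:
  fixes c :: "('k::field_char_0 \<Rightarrow> 'l::field_char_0) \<Rightarrow> 'l"
  assumes "finite S" "\<And>s. s \<in> S \<Longrightarrow> is_field_hom s" "\<And>x. (\<Sum>s\<in>S. c s * s x) = 0" "s \<in> S"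
  shows "c s = 0"
  using assms
proof (induction S arbitrary: c s rule: finite_induct)
  case (insert t S)
  have zero: "c s = 0" if s: "s \<in> S" for s
  proof -
    have "s \<noteq> t" using insert s by auto
    then obtain y where y: "s y \<noteq> t y" by auto
    have "(\<Sum>s\<in>S. c s * (s y - t y) * s x) = 0" for x
    proof -
      have "(\<Sum>s\<in>insert t S. c s * s (x * y)) - t y * (\<Sum>s\<in>insert t S. c s * s x) = 0"
        using insert.prems(2) by simp
      moreover have "(\<Sum>s\<in>insert t S. c s * s (x * y)) = (\<Sum>s\<in>insert t S. c s * s x * s y)"
        using insert.prems(1) by (intro sum.cong) (simp_all add: field_hom_mult mult.assoc)
      ultimately have "(\<Sum>s\<in>insert t S. c s * (s y - t y) * s x) = 0"
        by (simp add: sum_distrib_left algebra_simps sum_subtractf del: sum.insert)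
      then show ?thesis using insert.hyps by simp
    qed
    then have "c s * (s y - t y) = 0"
      using insert.IH[of "\<lambda>s. c s * (s y - t y)" s] insert.prems(1) s by blast
    with y show ?thesis by simp
  qed
  have "(\<Sum>s\<in>insert t S. c s * s 1) = 0" by (rule insert.prems)
  then have "c t * t 1 = 0" using insert.hyps zero by simp
  then have "c t = 0" using field_hom_1[of t] insert.prems(1) by simp
  with zero insert.prems(3) show ?case by auto
qed simp

text \<open>With more homomorphisms than elements of \<open>E\<close> the linear system would have a
  nontrivial solution, against independence. The assumption asks that relations on \<open>E\<close>
  propagate, not that \<open>E\<close> spans, because \<open>fixed_imp_Rats\<close> uses a basis
  with one element removed.\<close>

lemma card_field_homs_le:
  fixes S :: "('k::field_char_0 \<Rightarrow> 'l::field_char_0) set"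
  assumes S: "finite S" "\<And>s. s \<in> S \<Longrightarrow> is_field_hom s"
    and E: "finite E" "\<And>c x. (\<And>e. e \<in> E \<Longrightarrow> (\<Sum>s\<in>S. c s * s e) = 0) \<Longrightarrow> (\<Sum>s\<in>S. c s * s x) = 0"
  shows "card S \<le> card E"
proof (rule ccontr)
  assume "\<not> card S \<le> card E"
  then obtain c where c: "\<exists>s\<in>S. c s \<noteq> 0" "\<And>e. e \<in> E \<Longrightarrow> (\<Sum>s\<in>S. s e * c s) = 0"
    using homogeneous_system_nontrivial[OF E(1) S(1), of "\<lambda>e s. s e"] by auto
  have "(\<Sum>s\<in>S. c s * s x) = 0" for x
    by (rule E(2)) (use c(2) in \<open>simp add: mult.commute\<close>)
  then have "c s = 0" if "s \<in> S" for s
    using field_homs_independent[OF S] that by blast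
  with c(1) show False by blast
qed

interpretation rat_vs: vector_space "rat_scale :: rat \<Rightarrow> 'k::field_char_0 \<Rightarrow> 'k"
  by (rule vector_space_rat_scale)

lemma number_field_basis:
  assumes "number_field TYPE('k::field_char_0)"
  obtains B :: "'k::field_char_0 set" where "finite B" "rat_vs.independent B" "rat_vs.span B = UNIV"
    "card B = field_degree TYPE('k)"
proof -
  obtain B0 :: "'k set" where B0: "finite B0" "rat_vs.span B0 = UNIV"
    using assms by (auto simp: number_field_def)
  obtain B :: "'k set" where B: "B \<subseteq> UNIV" "rat_vs.independent B" "UNIV \<subseteq> rat_vs.span B"
    "card B = rat_vs.dim (UNIV :: 'k set)"
    by (rule rat_vs.basis_exists[of "UNIV :: 'k set"])
  have "finite B" using rat_vs.independent_span_bound[OF B0(1) B(2)] B0 by simp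
  with B that show ?thesis by (auto simp: field_degree_def)
qed

lemma hom_combination_eq_0_on_span:
  fixes c :: "('k::field_char_0 \<Rightarrow> 'l::field_char_0) \<Rightarrow> 'l"
  assumes S: "\<And>s. s \<in> S \<Longrightarrow> is_field_hom s"
    and E: "\<And>e. e \<in> E \<Longrightarrow> (\<Sum>s\<in>S. c s * s e) = 0" and x: "x \<in> rat_vs.span E"
  shows "(\<Sum>s\<in>S. c s * s x) = 0"
  using x
proof (induction rule: rat_vs.span_induct_alt)
  case base
  then show ?case using S by (simp add: field_hom_0)
next
  case (step q e y)
  have "(\<Sum>s\<in>S. c s * s (rat_scale q e + y)) = of_rat q * (\<Sum>s\<in>S. c s * s e) + (\<Sum>s\<in>S. c s * s y)"
    unfolding sum_distrib_left sum.distrib[symmetric]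
    by (rule sum.cong) (auto simp: rat_scale_def S field_hom_add field_hom_mult field_hom_of_rat
        algebra_simps)
  then show ?case using step E by simp
qed

lemma card_field_homs_le_degree:
  fixes S :: "('k::field_char_0 \<Rightarrow> 'l::field_char_0) set"
  assumes "number_field TYPE('k)" "finite S" "\<And>s. s \<in> S \<Longrightarrow> is_field_hom s"
  shows "card S \<le> field_degree TYPE('k)"
proof -
  obtain B :: "'k set" where B: "finite B" "rat_vs.independent B" "rat_vs.span B = UNIV"
    "card B = field_degree TYPE('k)"
    by (rule number_field_basis[OF assms(1)])
  have "card S \<le> card B"
  proof (rule card_field_homs_le[OF assms(2,3) B(1)])
    fix c x assume "\<And>e. e \<in> B \<Longrightarrow> (\<Sum>s\<in>S. c s * s e) = 0"
    then show "(\<Sum>s\<in>S. c s * s x) = 0"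
      using hom_combination_eq_0_on_span[OF assms(3), of S B c x] B(3) by simp
  qed
  with B show ?thesis by simp
qed

text \<open>If the fixed element \<open>x\<close> were irrational, then \<open>1\<close> and \<open>x\<close> would give proportional equations
  in the linear system, leaving fewer equations than automorphisms.\<close>

lemma fixed_imp_Rats:
  fixes x :: "'k::field_char_0"
  assumes gal: "galois_number_field TYPE('k)" and fix_x: "\<And>g. is_field_iso g \<Longrightarrow> g x = x"
  shows "x \<in> \<rat>"
proof (rule ccontr)
  assume x: "x \<notin> \<rat>"
  define S where "S = {g :: 'k \<Rightarrow> 'k. is_field_iso g}"
  have nf: "number_field TYPE('k)" and card: "card S = field_degree TYPE('k)"
    using gal by (auto simp: galois_number_field_def S_def)
  obtain B :: "'k set" where B: "finite B" "rat_vs.independent B" "rat_vs.span B = UNIV"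
    "card B = field_degree TYPE('k)"
    by (rule number_field_basis[OF nf])
  have "x \<notin> rat_vs.span {1}"
  proof
    assume "x \<in> rat_vs.span {1}"
    then obtain q where "x = of_rat q" by (auto simp: rat_vs.span_singleton rat_scale_def)
    with x show False by simp
  qed
  then have "rat_vs.independent {x, 1}"
    by (intro rat_vs.independent_insertI) (auto simp: rat_vs.independent_empty)
  then obtain C where "{x, 1} \<subseteq> C" "C \<subseteq> UNIV" "rat_vs.independent C" "UNIV \<subseteq> rat_vs.span C"
    by (rule rat_vs.maximal_independent_subset_extend[OF subset_UNIV])
  then have C: "{x, 1} \<subseteq> C" "rat_vs.independent C" "rat_vs.span C = UNIV" by auto
  have finC: "finite C" using rat_vs.independent_span_bound[OF B(1) C(2)] B by simp
  have cardC: "card C = field_degree TYPE('k)"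
    unfolding field_degree_def using C by (intro rat_vs.basis_card_eq_dim) auto
  have homs: "is_field_hom s" if "s \<in> S" for s using that by (simp add: S_def is_field_iso_def)
  have pos: "card C > 0" using finC C(1) by (auto simp: card_gt_0_iff)
  then have finS: "finite S" using card cardC by (intro card_ge_0_finite) simp
  have "card S \<le> card (C - {x})"
  proof (rule card_field_homs_le[OF finS homs])
    show "finite (C - {x})" using finC by simp
    fix c :: "('k \<Rightarrow> 'k) \<Rightarrow> 'k" and z
    assume c: "\<And>e. e \<in> C - {x} \<Longrightarrow> (\<Sum>s\<in>S. c s * s e) = 0"
    have "x \<noteq> 1" using x by auto
    then have "(\<Sum>s\<in>S. c s * s 1) = 0" using C(1) by (intro c) auto
    then have "(\<Sum>s\<in>S. c s) = 0" using homs by (simp add: field_hom_1)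
    moreover have "(\<Sum>s\<in>S. c s * s x) = (\<Sum>s\<in>S. c s) * x"
      unfolding sum_distrib_right by (rule sum.cong) (simp_all add: S_def fix_x)
    ultimately have "(\<Sum>s\<in>S. c s * s e) = 0" if "e \<in> C" for e
      using c[of e] that by (cases "e = x") auto
    then show "(\<Sum>s\<in>S. c s * s z) = 0"
      using hom_combination_eq_0_on_span[OF homs, of S C c z] C(3) by auto
  qed
  also have "\<dots> < card C" using finC C(1) by (intro psubset_card_mono) auto
  finally show False using card cardC by simp
qed

section \<open>Conjugates and norms\<close>

lemma algebraic_int_1: "algebraic_int (1 :: 'a::field_char_0)"
  by (simp add: int_imp_algebraic_int)

lemma algebraic_int_sum:
  fixes f :: "'i \<Rightarrow> 'a::field_char_0"
  shows "(\<And>i. i \<in> I \<Longrightarrow> algebraic_int (f i)) \<Longrightarrow> algebraic_int (\<Sum>i\<in>I. f i)"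
  by (induction I rule: infinite_finite_induct) (auto intro: algebraic_int_add_mult)

lemma algebraic_int_prod:
  fixes f :: "'i \<Rightarrow> 'a::field_char_0"
  shows "(\<And>i. i \<in> I \<Longrightarrow> algebraic_int (f i)) \<Longrightarrow> algebraic_int (\<Prod>i\<in>I. f i)"
  by (induction I rule: infinite_finite_induct) (auto intro: algebraic_int_add_mult algebraic_int_1)

lemma algebraic_int_coeff_prod:
  fixes p :: "'i \<Rightarrow> 'a::field_char_0 poly"
  assumes "\<And>i k. i \<in> I \<Longrightarrow> algebraic_int (coeff (p i) k)"
  shows "algebraic_int (coeff (\<Prod>i\<in>I. p i) k)"
  using assms
proof (induction I arbitrary: k rule: infinite_finite_induct)
  case (insert i I)
  then show ?case
    by (auto simp: coeff_mult intro!: algebraic_int_sum algebraic_int_add_mult)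
qed (auto simp: coeff_1 intro: algebraic_int_1)

text \<open>The multiplier is the leading coefficient of an integer polynomial that kills
  \<open>x\<close>; times \<open>x\<close> it acts integrally on the span of 1, x, ...,
  x^(d-1).\<close>

lemma algebraic_int_multiple:
  fixes x :: "'a::field_char_0"
  assumes "algebraic x"
  obtains m :: int where "m \<noteq> 0" "algebraic_int (of_int m * x)"
proof -
  obtain p where p: "p \<noteq> 0" "poly (map_poly of_int p) x = 0"
    using assms by (rule algebraicE')
  define d where "d = degree p"
  have d: "d > 0"
  proof (rule ccontr)
    assume "\<not> d > 0"
    then obtain c where "p = [:c:]" by (auto simp: d_def elim: degree_eq_zeroE)
    with p show False by (simp add: map_poly_pCons)
  qed
  have "0 = (\<Sum>i\<le>d. of_int (coeff p i) * x ^ i)"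
    using p(2) by (simp add: poly_altdef d_def degree_map_poly coeff_map_poly)
  also have "{..d} = insert d {..<d}" by auto
  also have "(\<Sum>i\<in>insert d {..<d}. of_int (coeff p i) * x ^ i) =
    of_int (lead_coeff p) * x ^ d + (\<Sum>i<d. of_int (coeff p i) * x ^ i)"
    by (simp add: d_def)
  finally have top: "of_int (lead_coeff p) * x ^ d = - (\<Sum>i<d. of_int (coeff p i) * x ^ i)"
    by (metis eq_neg_iff_add_eq_0)
  \<comment> \<open>The companion matrix of \<open>p\<close> times its leading coefficient: all rows
    but the last shift, and the last one is the relation \<open>top\<close>.\<close>
  define a :: "nat \<Rightarrow> nat \<Rightarrow> int" where
    "a i j = (if Suc i < d then if j = Suc i then lead_coeff p else 0 else - coeff p j)" for i j
  have "algebraic_int (of_int (lead_coeff p) * x)"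
  proof (rule eigenvalue_of_int_matrix_algebraic_int[of 0 d "\<lambda>i. x ^ i" _ a])
    fix i assume "i < d"
    show "of_int (lead_coeff p) * x * x ^ i = (\<Sum>j<d. of_int (a i j) * x ^ j)"
    proof (cases "Suc i < d")
      case True
      have "(\<Sum>j<d. of_int (a i j) * x ^ j) =
        (\<Sum>j<d. if j = Suc i then of_int (lead_coeff p) * x ^ j else 0)"
        using True by (intro sum.cong) (auto simp: a_def)
      then show ?thesis using True by (simp add: mult_ac)
    next
      case False
      then have "d = Suc i" using \<open>i < d\<close> by simp
      then have "of_int (lead_coeff p) * x * x ^ i = of_int (lead_coeff p) * x ^ d" by simp
      then show ?thesis using False by (simp add: top a_def sum_negf)
    qed
  qed (use d in auto)
  then show thesis using p(1) by (intro that[of "lead_coeff p"]) auto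
qed

lemma Rats_poly_obtain:
  fixes p :: "'a::field_char_0 poly"
  assumes "\<And>i. coeff p i \<in> \<rat>"
  obtains q where "p = map_poly of_rat q"
proof -
  have inj: "inj (of_rat :: rat \<Rightarrow> 'a)" by (simp add: inj_on_def)
  define q where "q = map_poly (inv (of_rat :: rat \<Rightarrow> 'a)) p"
  have [simp]: "inv (of_rat :: rat \<Rightarrow> 'a) 0 = 0"
    using inv_f_f[OF inj, of 0] by simp
  have "p = map_poly of_rat q"
  proof (rule poly_eqI)
    fix i
    obtain r where "coeff p i = of_rat r" using assms[of i] by (auto elim: Rats_cases)
    then show "coeff p i = coeff (map_poly of_rat q) i"
      by (simp add: q_def coeff_map_poly inv_f_f[OF inj])
  qed
  then show thesis by (rule that)
qed

section \<open>The Galois group of a field with a real embedding\<close>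

definition field_auts :: "('k::field_char_0 \<Rightarrow> 'k) set"
  where "field_auts = {g. is_field_iso g}"

text \<open>The argument takes place inside the reals: one embedding \<open>s\<close> replaces the
  family of complex embeddings, which are exactly the composites of \<open>s\<close> with
  automorphisms (\<open>ex_enumerated_embeddings\<close>).\<close>

locale real_galois =
  fixes s :: "'k::field_char_0 \<Rightarrow> real"
  assumes gal: "galois_number_field TYPE('k)" and hom_s: "is_field_hom s"
begin

abbreviation G :: "('k \<Rightarrow> 'k) set" where "G \<equiv> field_auts"

lemma nf: "number_field TYPE('k)" and card_G: "card G = field_degree TYPE('k)"
  using gal by (auto simp: galois_number_field_def field_auts_def)

lemma G_hom: "g \<in> G \<Longrightarrow> is_field_hom g" and G_bij: "g \<in> G \<Longrightarrow> bij g"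
  by (auto simp: field_auts_def is_field_iso_def)

lemma finite_G: "finite G"
proof -
  obtain B :: "'k set" where B: "finite B" "rat_vs.independent B" "rat_vs.span B = UNIV"
    "card B = field_degree TYPE('k)"
    by (rule number_field_basis[OF nf])
  have "B \<noteq> {}"
  proof
    assume "B = {}"
    then have "(UNIV :: 'k set) = {0}" using B(3) by simp
    then have "(1 :: 'k) \<in> {0}" by blast
    then show False by simp
  qed
  then have "card B > 0" using B(1) by (simp add: card_gt_0_iff)
  then show ?thesis using B(4) card_G by (intro card_ge_0_finite) simp
qed

lemma id_G: "id \<in> G"
  by (auto simp: field_auts_def is_field_iso_def is_field_hom_def)

lemma comp_G: "g \<in> G \<Longrightarrow> h \<in> G \<Longrightarrow> g \<circ> h \<in> G"
  by (auto simp: field_auts_def is_field_iso_def is_field_hom_def bij_comp)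

lemma inv_G: assumes "g \<in> G" shows "inv g \<in> G"
proof -
  note g = G_hom[OF assms] G_bij[OF assms]
  have inj: "inj g" and eq: "\<And>x. g (inv g x) = x" 
    using g(2) by (auto simp: bij_is_inj surj_f_inv_f[OF bij_is_surj])
  have "is_field_hom (inv g)" unfolding is_field_hom_def
  proof (intro conjI allI)
    show "inv g 1 = 1" using inj by (metis eq field_hom_1[OF g(1)] injD)
    show "inv g (x + y) = inv g x + inv g y" for x y
      by (rule injD[OF inj]) (simp add: eq field_hom_add[OF g(1)])
    show "inv g (x * y) = inv g x * inv g y" for x y
      by (rule injD[OF inj]) (simp add: eq field_hom_mult[OF g(1)])
  qed
  then show ?thesis using g by (simp add: field_auts_def is_field_iso_def bij_imp_bij_inv)
qed

lemma inv_comp_G: "g \<in> G \<Longrightarrow> inv g \<circ> g = id" "g \<in> G \<Longrightarrow> g \<circ> inv g = id"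
  using G_bij[of g] by (simp add: bij_is_inj, metis bij_is_surj surj_iff)

lemma bij_comp_left: assumes "h \<in> G" shows "bij_betw (\<lambda>g. h \<circ> g) G G"
  by (rule bij_betw_byWitness[where f' = "\<lambda>g. inv h \<circ> g"])
    (use assms comp_G inv_G in \<open>auto simp: comp_assoc[symmetric] inv_comp_G\<close>)

lemma fixed_Rats: "(\<And>g. g \<in> G \<Longrightarrow> g x = x) \<Longrightarrow> x \<in> \<rat>"
  by (rule fixed_imp_Rats[OF gal]) (simp add: field_auts_def)

text \<open>The characteristic polynomial of \<open>u\<close> over the rationals, hence a power of
  its minimal polynomial, of degree |G| for every \<open>u\<close>.\<close>

definition conj_poly :: "'k \<Rightarrow> 'k poly"
  where "conj_poly u = (\<Prod>g\<in>G. [:- g u, 1:])"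

lemma poly_conj_poly: "poly (conj_poly u) x = (\<Prod>g\<in>G. x - g u)"
  by (simp add: conj_poly_def poly_prod)

lemma poly_conj_poly_self: "poly (conj_poly u) u = 0"
  unfolding poly_conj_poly using id_G finite_G by (intro prod_zero) (auto intro!: bexI[of _ id])

lemma conj_poly_fixed: assumes "h \<in> G" shows "map_poly h (conj_poly u) = conj_poly u"
proof -
  have "map_poly h (conj_poly u) = (\<Prod>g\<in>G. [:- (h \<circ> g) u, 1:])"
    using G_hom[OF assms]
    by (simp add: conj_poly_def field_hom_map_poly_prod field_hom_map_poly_linear
        field_hom_minus field_hom_1)
  also have "\<dots> = conj_poly u"
    unfolding conj_poly_def
    by (rule prod.reindex_bij_betw[OF bij_comp_left[OF assms], of "\<lambda>g. [:- g u, 1:]"])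
  finally show ?thesis .
qed

lemma coeff_conj_poly_Rats: "coeff (conj_poly u) i \<in> \<rat>"
proof (rule fixed_Rats)
  fix h assume h: "h \<in> G"
  show "h (coeff (conj_poly u) i) = coeff (conj_poly u) i"
    using conj_poly_fixed[OF h, of u] coeff_map_poly[of h "conj_poly u" i] field_hom_0[OF G_hom[OF h]]
    by simp
qed

lemma coeff_conj_poly_Ints: "algebraic_int u \<Longrightarrow> coeff (conj_poly u) i \<in> \<int>"
proof (rule rational_algebraic_int_is_int)
  assume u: "algebraic_int u"
  show "algebraic_int (coeff (conj_poly u) i)" unfolding conj_poly_def
  proof (rule algebraic_int_coeff_prod)
    fix g k assume "g \<in> G"
    then show "algebraic_int (coeff [:- g u, 1:] k)"
      using field_hom_algebraic_int[OF G_hom u]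
      by (auto simp: coeff_pCons algebraic_int_1 split: nat.split)
  qed
qed (rule coeff_conj_poly_Rats)

lemma conj_poly_neq_0: "conj_poly u \<noteq> 0"
  unfolding conj_poly_def using finite_G by (simp add: prod_zero_iff)

lemma algebraic: "algebraic (x :: 'k)"
  unfolding algebraic_altdef using coeff_conj_poly_Rats conj_poly_neq_0 poly_conj_poly_self by blast

text \<open>A rational basis of the field, scaled to consist of algebraic integers. Its integer span
  may be smaller than the ring of integers, but full rank is enough for the pigeonhole
  argument.\<close>

lemma integral_basis:
  obtains B :: "'k set" and \<omega> :: "'k \<Rightarrow> 'k"
  where "finite B" "card B = card G" "\<And>b. algebraic_int (\<omega> b)"
    "\<And>c :: 'k \<Rightarrow> int. (\<Sum>b\<in>B. of_int (c b) * \<omega> b) = 0 \<Longrightarrow> \<forall>b\<in>B. c b = 0"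
proof -
  obtain B :: "'k set" where B: "finite B" "rat_vs.independent B" "rat_vs.span B = UNIV"
    "card B = field_degree TYPE('k)"
    by (rule number_field_basis[OF nf])
  have "\<forall>b :: 'k. \<exists>m :: int. m \<noteq> 0 \<and> algebraic_int (of_int m * b)"
    using algebraic_int_multiple[OF algebraic] by metis
  then obtain m :: "'k \<Rightarrow> int" where m: "\<And>b. m b \<noteq> 0" "\<And>b. algebraic_int (of_int (m b) * b)"
    by metis
  show thesis
  proof (rule that[of B "\<lambda>b. of_int (m b) * b"])
    fix c :: "'k \<Rightarrow> int"
    assume "(\<Sum>b\<in>B. of_int (c b) * (of_int (m b) * b)) = 0"
    then have "(\<Sum>b\<in>B. rat_scale (of_int (c b * m b)) b) = 0"
      by (simp add: rat_scale_def of_rat_mult mult.assoc)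
    then have "(of_int (c b * m b) :: rat) = 0" if "b \<in> B" for b
      using rat_vs.independentD[OF B(2,1) subset_refl _ that, of "\<lambda>b. of_int (c b * m b)"] by simp
    then show "\<forall>b\<in>B. c b = 0" using m(1) by simp
  qed (use B m card_G in auto)
qed

lemma conj_algebraic_int: "algebraic_int x \<Longrightarrow> g \<in> G \<Longrightarrow> algebraic_int (g x)"
  by (rule field_hom_algebraic_int[OF G_hom])

definition nrm :: "'k \<Rightarrow> 'k" where "nrm x = (\<Prod>g\<in>G. g x)"

lemma nrm_fixed: assumes "h \<in> G" shows "h (nrm x) = nrm x"
  unfolding nrm_def field_hom_prod[OF G_hom[OF assms]]
  using prod.reindex_bij_betw[OF bij_comp_left[OF assms], of "\<lambda>g. g x"] by simp

lemma nrm_Ints: assumes "algebraic_int x" shows "nrm x \<in> \<int>"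
proof (rule rational_algebraic_int_is_int)
  show "algebraic_int (nrm x)"
    unfolding nrm_def by (rule algebraic_int_prod) (rule conj_algebraic_int[OF assms])
  show "nrm x \<in> \<rat>" by (rule fixed_Rats) (rule nrm_fixed)
qed

lemma nrm_eq_0_iff: "nrm x = 0 \<longleftrightarrow> x = 0"
  unfolding nrm_def prod_zero_iff[OF finite_G] using id_G field_hom_eq_0_iff[OF G_hom] by blast

lemma nrm_mult: "nrm (x * y) = nrm x * nrm y"
  by (simp add: nrm_def field_hom_mult[OF G_hom] flip: prod.distrib)

text \<open>The quotient is the product of the other conjugates. So \<open>x\<close> divides its
  norm, and a congruence modulo the norm of \<open>x\<close> becomes one modulo
  \<open>x\<close>.\<close>

lemma nrm_div_algebraic_int:
  assumes "algebraic_int x" "x \<noteq> 0"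
  shows "algebraic_int (nrm x / x)"
proof -
  have "nrm x = x * (\<Prod>g\<in>G - {id}. g x)"
    unfolding nrm_def using finite_G id_G by (simp add: prod.remove[of G id])
  then have "nrm x / x = (\<Prod>g\<in>G - {id}. g x)" using assms by simp
  moreover have "algebraic_int (\<Prod>g\<in>G - {id}. g x)"
    by (rule algebraic_int_prod) (simp add: conj_algebraic_int assms)
  ultimately show ?thesis by simp
qed

end

section \<open>A Minkowski unit\<close>

context real_galois
begin

lemma hom_sg: "g \<in> G \<Longrightarrow> is_field_hom (\<lambda>x. s (g x))"
  using field_hom_comp[OF G_hom hom_s] by (simp add: o_def)

lemma abs_s_nrm: "\<bar>s (nrm x)\<bar> = (\<Prod>g\<in>G. \<bar>s (g x)\<bar>)"
  by (simp add: nrm_def field_hom_prod[OF hom_s] abs_prod)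

text \<open>Pigeonhole: the lattice generated by an integral basis has a point in every box that is
  thin in all directions but one and has volume bounded below.\<close>

lemma exists_small_conjugates:
  fixes \<omega> :: "'k \<Rightarrow> 'k"
  assumes B: "finite B" "card B = card G"
    and indep: "\<And>c :: 'k \<Rightarrow> int. (\<Sum>b\<in>B. of_int (c b) * \<omega> b) = 0 \<Longrightarrow> \<forall>b\<in>B. c b = 0"
  obtains D :: real where "D > 0" "\<And>t. t \<ge> (1::nat) \<Longrightarrow> \<exists>c :: 'k \<Rightarrow> int. (\<Sum>b\<in>B. of_int (c b) * \<omega> b) \<noteq> 0 \<and>
    (\<forall>g\<in>G - {id}. \<bar>s (g (\<Sum>b\<in>B. of_int (c b) * \<omega> b))\<bar> \<le> 2 * D / t) \<and>
    \<bar>s (\<Sum>b\<in>B. of_int (c b) * \<omega> b)\<bar> \<le> D * real t ^ (card G - 1)"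
proof -
  define n where "n = card G"
  define el where "el c = (\<Sum>b\<in>B. of_int (c b) * \<omega> b)" for c :: "'k \<Rightarrow> int"
  \<comment> \<open>Coefficients bounded by Q give conjugates bounded by D Q; the summand 1 makes D
    positive and the bound strict.\<close>
  define D where "D = 1 + (\<Sum>g\<in>G. \<Sum>b\<in>B. \<bar>s (g (\<omega> b))\<bar>)"
  have n: "n \<ge> 1" using finite_G id_G by (auto simp: n_def Suc_le_eq card_gt_0_iff)
  have D: "D > 0" unfolding D_def by (intro add_pos_nonneg sum_nonneg) auto
  have el_diff: "el c - el d = el (\<lambda>b. c b - d b)" for c d
    by (simp add: el_def algebra_simps sum_subtractf)
  have s_el: "s (g (el c)) = (\<Sum>b\<in>B. of_int (c b) * s (g (\<omega> b)))" if "g \<in> G" for g c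
    by (simp add: el_def field_hom_sum[OF hom_sg[OF that]] field_hom_mult[OF hom_sg[OF that]]
        field_hom_of_int[OF hom_sg[OF that]])
  have bound: "\<bar>s (g (el c))\<bar> < D * Q"
    if g: "g \<in> G" and Q: "Q > 0" and c: "\<And>b. b \<in> B \<Longrightarrow> \<bar>real_of_int (c b)\<bar> \<le> Q" for g c and Q :: real
  proof -
    have "\<bar>s (g (el c))\<bar> \<le> (\<Sum>b\<in>B. \<bar>of_int (c b) * s (g (\<omega> b))\<bar>)"
      unfolding s_el[OF g] by (rule sum_abs)
    also have "\<dots> \<le> (\<Sum>b\<in>B. Q * \<bar>s (g (\<omega> b))\<bar>)"
      unfolding abs_mult using c by (intro sum_mono mult_right_mono) auto
    also have "\<dots> = Q * (\<Sum>b\<in>B. \<bar>s (g (\<omega> b))\<bar>)" by (simp add: sum_distrib_left)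
    also have "(\<Sum>b\<in>B. \<bar>s (g (\<omega> b))\<bar>) \<le> (\<Sum>g\<in>G. \<Sum>b\<in>B. \<bar>s (g (\<omega> b))\<bar>)"
      by (rule member_le_sum[OF g, of "\<lambda>g. \<Sum>b\<in>B. \<bar>s (g (\<omega> b))\<bar>"]) (auto intro: sum_nonneg finite_G)
    also have "\<dots> < D" by (simp add: D_def)
    finally show ?thesis using Q by (simp add: mult_ac)
  qed
  have small: "\<exists>c. el c \<noteq> 0 \<and> (\<forall>g\<in>G - {id}. \<bar>s (g (el c))\<bar> \<le> 2 * D / t) \<and> \<bar>s (el c)\<bar> \<le> D * real t ^ (n - 1)"
    if t: "t \<ge> (1::nat)" for t
  proof -
    \<comment> \<open>The exponents balance the count: (Q + 1)^n coefficient vectors against m^(n-1)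
      = Q^n boxes, while the ratio m / Q = t controls the width of a box.\<close>
    define Q where "Q = t ^ (n - 1)"
    define m where "m = t ^ n"
    have Q: "Q > 0" and m: "m > 0" and mQ: "m = t * Q"
      using t n by (auto simp: Q_def m_def simp flip: power_Suc)
    define P where "P = (B \<rightarrow>\<^sub>E {0..int Q})"
    define k where "k = m / (2 * D * Q)"
    have k: "k > 0" "2 * D * Q * k = m" "k = t / (2 * D)" using D Q m by (auto simp: k_def mQ)
    \<comment> \<open>\<open>y\<close> rescales the conjugates from (-D Q, D Q) to (0, m). The boxes
      leave out the coordinate of the identity, the one direction that is allowed to stay
      long.\<close>
    define y where "y c g = (s (g (el c)) + D * Q) * k" for c g
    define box where "box c = restrict (\<lambda>g. nat \<lfloor>y c g\<rfloor>) (G - {id})" for c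
    have y: "y c g > 0" "y c g < m" if "c \<in> P" "g \<in> G" for c g
    proof -
      have "\<bar>s (g (el c))\<bar> < D * Q"
        using that Q by (intro bound) (auto simp: P_def PiE_def Pi_def)
      then have "s (g (el c)) + D * Q > 0" "s (g (el c)) + D * Q < 2 * D * Q" by linarith+
      then show "y c g > 0" "y c g < m"
        unfolding y_def k(2)[symmetric] using k(1) by (auto intro: mult_strict_right_mono)
    qed
    have "box ` P \<subseteq> (G - {id} \<rightarrow>\<^sub>E {..<m})"
    proof (clarify)
      fix c assume c: "c \<in> P"
      have "nat \<lfloor>y c g\<rfloor> < m" if "g \<in> G" for g
        using y[OF c that] by (simp add: nat_less_iff floor_less_iff)
      then show "box c \<in> (G - {id} \<rightarrow>\<^sub>E {..<m})" by (auto simp: box_def)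
    qed
    then have "card (box ` P) \<le> card (G - {id} \<rightarrow>\<^sub>E {..<m})"
      using finite_G by (intro card_mono finite_PiE) auto
    also have "\<dots> = m ^ (n - 1)"
      using finite_G id_G by (simp add: card_PiE card_Diff_singleton n_def)
    also have "\<dots> = Q ^ n" by (simp add: m_def Q_def mult.commute flip: power_mult)
    also have "\<dots> < (Q + 1) ^ n" using n by (intro power_strict_mono) auto
    also have "\<dots> = card P"
    proof -
      have "nat (int Q + 1) = Q + 1" by (simp add: nat_add_distrib)
      then show ?thesis using B by (simp add: P_def card_PiE n_def)
    qed
    finally have "\<not> inj_on box P" by (rule pigeonhole)
    then obtain c d where cd: "c \<in> P" "d \<in> P" "c \<noteq> d" "box c = box d" by (auto simp: inj_on_def)
    define e where "e b = c b - d b" for b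
    have e: "el e = el c - el d" by (simp add: el_diff e_def[abs_def])
    have "el e \<noteq> 0"
    proof
      assume "el e = 0"
      then have "\<forall>b\<in>B. c b = d b" using indep[of e] by (simp add: el_def e_def)
      then have "c = d" using cd by (auto simp: P_def intro: PiE_ext)
      with cd show False by simp
    qed
    moreover have "\<bar>s (g (el e))\<bar> \<le> 2 * D / t" if g: "g \<in> G - {id}" for g
    proof -
      have "nat \<lfloor>y c g\<rfloor> = nat \<lfloor>y d g\<rfloor>" using fun_cong[OF cd(4), of g] g by (simp add: box_def)
      then have "\<lfloor>y c g\<rfloor> = \<lfloor>y d g\<rfloor>" using y(1)[OF cd(1), of g] y(1)[OF cd(2), of g] g
        by (simp add: eq_nat_nat_iff)
      then have "\<bar>y c g - y d g\<bar> < 1" by linarith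
      moreover have "y c g - y d g = s (g (el e)) * k"
        using g by (simp add: y_def e field_hom_diff[OF hom_sg] algebra_simps)
      ultimately have "\<bar>s (g (el e))\<bar> * k < 1" using k(1) by (simp add: abs_mult)
      then show ?thesis unfolding k(3) using D t by (simp add: field_simps)
    qed
    \<comment> \<open>No box controls this coordinate, but the difference of two coefficients from
      0..Q is again at most Q in absolute value.\<close>
    moreover have "\<bar>s (el e)\<bar> \<le> D * real t ^ (n - 1)"
    proof -
      have "\<bar>s (id (el e))\<bar> < D * Q"
      proof (rule bound[OF id_G])
        fix b assume "b \<in> B"
        then have "c b \<in> {0..int Q}" "d b \<in> {0..int Q}" using cd by (auto simp: P_def PiE_def Pi_def)
        then have "\<bar>e b\<bar> \<le> int Q" by (auto simp: e_def)
        then show "\<bar>real_of_int (e b)\<bar> \<le> Q" by linarith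
      qed (use Q in simp)
      then show ?thesis by (simp add: Q_def)
    qed
    ultimately show ?thesis by blast
  qed
  show thesis by (rule that[OF D]) (use small in \<open>simp add: el_def n_def\<close>)
qed

text \<open>The elements \<alpha> t have bounded norm, while their conjugates away from the identity
  shrink like 1 / t. Two of them with the same norm N and coefficients congruent modulo N divide
  each other, so their quotient is a unit. Taking the numerator late enough in the sequence makes
  its other conjugates smaller than those of the denominator.\<close>

lemma minkowski_unit:
  obtains \<epsilon> where "\<epsilon> \<in> integer_units" "\<And>g. g \<in> G \<Longrightarrow> g \<noteq> id \<Longrightarrow> \<bar>s (g \<epsilon>)\<bar> < 1"
proof -
  obtain B :: "'k set" and \<omega> :: "'k \<Rightarrow> 'k" where B: "finite B" "card B = card G"
    and \<omega>: "\<And>b. algebraic_int (\<omega> b)"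
    and indep: "\<And>c :: 'k \<Rightarrow> int. (\<Sum>b\<in>B. of_int (c b) * \<omega> b) = 0 \<Longrightarrow> \<forall>b\<in>B. c b = 0"
    by (rule integral_basis) blast
  define el where "el c = (\<Sum>b\<in>B. of_int (c b) * \<omega> b)" for c :: "'k \<Rightarrow> int"
  have el_int: "algebraic_int (el c)" for c
    unfolding el_def by (intro algebraic_int_sum algebraic_int_add_mult \<omega> int_imp_algebraic_int) auto
  obtain D :: real where D: "D > 0" and small: "\<And>t. t \<ge> (1::nat) \<Longrightarrow> \<exists>c. el c \<noteq> 0 \<and>
    (\<forall>g\<in>G - {id}. \<bar>s (g (el c))\<bar> \<le> 2 * D / t) \<and> \<bar>s (el c)\<bar> \<le> D * real t ^ (card G - 1)"
    unfolding el_def by (rule exists_small_conjugates[OF B, of \<omega>]) (use indep in blast)+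
  from small have "\<forall>t. \<exists>c. t \<ge> (1::nat) \<longrightarrow> el c \<noteq> 0 \<and>
    (\<forall>g\<in>G - {id}. \<bar>s (g (el c))\<bar> \<le> 2 * D / t) \<and> \<bar>s (el c)\<bar> \<le> D * real t ^ (card G - 1)" by blast
  then obtain c :: "nat \<Rightarrow> 'k \<Rightarrow> int" where c: "\<And>t. t \<ge> 1 \<Longrightarrow> el (c t) \<noteq> 0"
    "\<And>t g. t \<ge> 1 \<Longrightarrow> g \<in> G - {id} \<Longrightarrow> \<bar>s (g (el (c t)))\<bar> \<le> 2 * D / t"
    "\<And>t. t \<ge> 1 \<Longrightarrow> \<bar>s (el (c t))\<bar> \<le> D * real t ^ (card G - 1)"
    by metis
  define \<alpha> where "\<alpha> t = el (c t)" for t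
  have "\<exists>N :: int. nrm (\<alpha> t) = of_int N" for t
    using nrm_Ints[OF el_int] by (auto simp: \<alpha>_def elim: Ints_cases)
  then obtain N :: "nat \<Rightarrow> int" where N: "\<And>t. nrm (\<alpha> t) = of_int (N t)" by metis
  have N0: "N t \<noteq> 0" if "t \<ge> 1" for t
  proof -
    have "nrm (\<alpha> t) \<noteq> 0" using c(1)[OF that] by (simp add: \<alpha>_def nrm_eq_0_iff)
    then show ?thesis using N[of t] by auto
  qed
  \<comment> \<open>The powers of t cancel in the product of the bounds, so the norms stay bounded
    as t grows.\<close>
  define R where "R = \<lfloor>D * (2 * D) ^ (card G - 1)\<rfloor>"
  have NR: "\<bar>N t\<bar> \<le> R" if t: "t \<ge> 1" for t
  proof -
    have "\<bar>real_of_int (N t)\<bar> = (\<Prod>g\<in>G. \<bar>s (g (\<alpha> t))\<bar>)"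
      using abs_s_nrm[of "\<alpha> t"] by (simp add: N field_hom_of_int[OF hom_s])
    also have "\<dots> = \<bar>s (\<alpha> t)\<bar> * (\<Prod>g\<in>G - {id}. \<bar>s (g (\<alpha> t))\<bar>)"
      using finite_G id_G by (simp add: prod.remove[of G id])
    also have "\<dots> \<le> (D * real t ^ (card G - 1)) * (\<Prod>g\<in>G - {id}. 2 * D / t)"
      using c(2,3)[OF t] D unfolding \<alpha>_def by (intro mult_mono prod_mono) (auto intro: prod_nonneg)
    also have "\<dots> = D * (2 * D) ^ (card G - 1)"
      using t finite_G id_G by (simp add: card_Diff_singleton power_divide)
    finally show ?thesis unfolding R_def by (simp add: le_floor_iff)
  qed
  \<comment> \<open>A finite colouring by norm and coefficient residues; an infinite colour class
    lets \<open>t1\<close> be taken arbitrarily large.\<close>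
  define \<kappa> where "\<kappa> t = (N t, restrict (\<lambda>b. c t b mod \<bar>N t\<bar>) B)" for t
  have "\<kappa> ` {1..} \<subseteq> {-R..R} \<times> (B \<rightarrow>\<^sub>E {0..R})"
  proof (rule image_subsetI)
    fix t :: nat assume "t \<in> {1..}"
    then have t: "t \<ge> 1" by simp
    have "c t b mod \<bar>N t\<bar> \<in> {0..R}" for b
    proof -
      have "c t b mod \<bar>N t\<bar> < \<bar>N t\<bar>" "0 \<le> c t b mod \<bar>N t\<bar>" using N0[OF t] by simp_all
      then show ?thesis using NR[OF t] by simp
    qed
    then have "restrict (\<lambda>b. c t b mod \<bar>N t\<bar>) B \<in> (B \<rightarrow>\<^sub>E {0..R})" by simp
    moreover have "N t \<in> {-R..R}" using NR[OF t] by auto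
    ultimately show "\<kappa> t \<in> {-R..R} \<times> (B \<rightarrow>\<^sub>E {0..R})" by (simp add: \<kappa>_def)
  qed
  then have "finite (\<kappa> ` {1..})"
    by (rule finite_subset) (use B(1) in \<open>auto intro: finite_PiE\<close>)
  then obtain t0 where t0: "t0 \<ge> 1" and inf: "infinite {t \<in> {1..}. \<kappa> t = \<kappa> t0}"
    using pigeonhole_infinite[of "{1..} :: nat set" \<kappa>] infinite_Ici by auto
  \<comment> \<open>The inserted 1 keeps the set nonempty for trivial G. Once t exceeds 2 D /
    \<delta>, the bound 2 D / t lies below every conjugate of \<alpha> t0 in question.\<close>
  define \<delta> where "\<delta> = Min (insert 1 ((\<lambda>g. \<bar>s (g (\<alpha> t0))\<bar>) ` (G - {id})))"
  have sg_nz: "s (g (\<alpha> t)) \<noteq> 0" if "g \<in> G" "t \<ge> 1" for g t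
    using c(1)[OF that(2)] field_hom_eq_0_iff[OF hom_sg[OF that(1)]] by (simp add: \<alpha>_def)
  have \<delta>: "\<delta> > 0" "\<And>g. g \<in> G - {id} \<Longrightarrow> \<delta> \<le> \<bar>s (g (\<alpha> t0))\<bar>"
    using finite_G sg_nz[OF _ t0] by (auto simp: \<delta>_def)
  obtain T :: nat where T: "real T > 2 * D / \<delta>" using reals_Archimedean2 by blast
  obtain t1 where t1: "t1 \<ge> 1" "\<kappa> t1 = \<kappa> t0" "t1 > T"
    using inf infinite_nat_iff_unbounded[of "{t \<in> {1..}. \<kappa> t = \<kappa> t0}"] by blast
  have NN: "N t1 = N t0" using t1 by (simp add: \<kappa>_def)
  have congr: "\<bar>N t0\<bar> dvd c t1 b - c t0 b" if "b \<in> B" for b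
  proof -
    have "snd (\<kappa> t1) b = snd (\<kappa> t0) b" by (simp only: t1(2))
    then show ?thesis using that by (simp add: \<kappa>_def NN mod_eq_dvd_iff)
  qed
  \<comment> \<open>The difference is a multiple of the norm of \<alpha> t', hence of \<alpha> t'
    itself. It is applied in both orders, giving the unit and its inverse.\<close>
  have quotient_int: "algebraic_int (\<alpha> t / \<alpha> t')"
    if t: "t' \<ge> 1" "N t' = N t0" and dvd: "\<And>b. b \<in> B \<Longrightarrow> N t0 dvd c t b - c t' b" for t t'
  proof -
    have nz: "\<alpha> t' \<noteq> 0" using c(1)[OF t(1)] by (simp add: \<alpha>_def)
    define e where "e b = (c t b - c t' b) div N t0" for b
    have "\<alpha> t - \<alpha> t' = (\<Sum>b\<in>B. of_int (c t b - c t' b) * \<omega> b)"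
      by (simp add: \<alpha>_def el_def algebra_simps sum_subtractf)
    also have "\<dots> = (\<Sum>b\<in>B. of_int (N t0) * (of_int (e b) * \<omega> b))"
      using dvd by (intro sum.cong) (auto simp: e_def simp flip: of_int_mult mult.assoc)
    also have "\<dots> = nrm (\<alpha> t') * el e"
      by (simp add: el_def sum_distrib_left N t)
    finally have "\<alpha> t / \<alpha> t' = 1 + nrm (\<alpha> t') / \<alpha> t' * el e"
      using nz by (simp add: field_simps)
    moreover have "algebraic_int (1 + nrm (\<alpha> t') / \<alpha> t' * el e)"
      by (intro algebraic_int_add_mult algebraic_int_1 nrm_div_algebraic_int nz)
        (simp_all add: \<alpha>_def el_int)
    ultimately show ?thesis by simp
  qed
  define \<epsilon> where "\<epsilon> = \<alpha> t1 / \<alpha> t0"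
  have "algebraic_int \<epsilon>" unfolding \<epsilon>_def
    by (rule quotient_int[OF t0 refl]) (use congr in simp)
  moreover have "algebraic_int (\<alpha> t0 / \<alpha> t1)"
    by (rule quotient_int[OF t1(1) NN]) (use congr dvd_diff_commute in \<open>simp, blast\<close>)
  moreover have "\<epsilon> * (\<alpha> t0 / \<alpha> t1) = 1"
    using c(1)[OF t0] c(1)[OF t1(1)] by (simp add: \<epsilon>_def \<alpha>_def)
  ultimately have "\<epsilon> \<in> integer_units" unfolding integer_units_def by blast
  moreover have "\<bar>s (g \<epsilon>)\<bar> < 1" if g: "g \<in> G" "g \<noteq> id" for g
  proof -
    have "\<bar>s (g (\<alpha> t1))\<bar> \<le> 2 * D / t1" using c(2)[OF t1(1)] g by (simp add: \<alpha>_def)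
    also have "\<dots> < \<delta>"
    proof -
      have "2 * D / \<delta> < real t1" using T t1(3) by linarith
      then show ?thesis using \<delta>(1) t1(1) by (simp add: field_simps)
    qed
    also have "\<dots> \<le> \<bar>s (g (\<alpha> t0))\<bar>" using \<delta>(2) g by simp
    finally have "\<bar>s (g (\<alpha> t1))\<bar> < \<bar>s (g (\<alpha> t0))\<bar>" .
    then show ?thesis using sg_nz[OF g(1) t0]
      by (simp add: \<epsilon>_def field_hom_divide[OF hom_sg[OF g(1)]])
  qed
  ultimately show thesis by (rule that)
qed

end

section \<open>Logarithms of units\<close>

lemma integer_units_nonzero: "u \<in> integer_units \<Longrightarrow> u \<noteq> 0"
  by (auto simp: integer_units_def)

lemma integer_units_1: "1 \<in> integer_units"
  by (auto simp: integer_units_def intro!: exI[of _ 1] algebraic_int_1)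

lemma integer_units_minus: "u \<in> integer_units \<Longrightarrow> - u \<in> integer_units"
proof -
  assume "u \<in> integer_units"
  then obtain v where "algebraic_int u" "algebraic_int v" "u * v = 1"
    by (auto simp: integer_units_def)
  then show ?thesis unfolding integer_units_def by (intro CollectI conjI exI[of _ "- v"]) auto
qed

lemma integer_units_mult:
  assumes "u \<in> integer_units" "v \<in> integer_units" shows "u * v \<in> integer_units"
proof -
  obtain u' v' where uv: "algebraic_int u" "algebraic_int u'" "u * u' = 1"
    "algebraic_int v" "algebraic_int v'" "v * v' = 1"
    using assms by (auto simp: integer_units_def)
  have "(u * v) * (u' * v') = (u * u') * (v * v')" by (simp add: mult_ac)
  then have "(u * v) * (u' * v') = 1" using uv by simp
  then show ?thesis using uv unfolding integer_units_def
    by (intro CollectI conjI exI[of _ "u' * v'"] algebraic_int_add_mult)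
qed

lemma integer_units_inverse:
  assumes "u \<in> integer_units" shows "inverse u \<in> integer_units"
proof -
  obtain v where v: "algebraic_int u" "algebraic_int v" "u * v = 1"
    using assms by (auto simp: integer_units_def)
  then have "inverse u = v" by (simp add: inverse_unique)
  then show ?thesis using v unfolding integer_units_def by (auto simp: mult.commute)
qed

lemma integer_units_power: "u \<in> integer_units \<Longrightarrow> u ^ n \<in> integer_units"
  by (induction n) (auto intro: integer_units_1 integer_units_mult)

lemma integer_units_hom:
  assumes f: "is_field_hom f" and u: "u \<in> integer_units" shows "f u \<in> integer_units"
proof -
  obtain v where v: "algebraic_int u" "algebraic_int v" "u * v = 1"
    using u by (auto simp: integer_units_def)
  then have "f u * f v = 1" by (simp add: field_hom_1[OF f] flip: field_hom_mult[OF f])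
  then show ?thesis using v field_hom_algebraic_int[OF f] unfolding integer_units_def by blast
qed

context real_galois
begin

definition l :: "'k \<Rightarrow> real" where "l u = ln \<bar>s u\<bar>"

abbreviation U :: "'k set" where "U \<equiv> integer_units"

lemma U_G: "u \<in> U \<Longrightarrow> g \<in> G \<Longrightarrow> g u \<in> U"
  by (rule integer_units_hom[OF G_hom])

lemma s_nonzero: "u \<in> U \<Longrightarrow> s u \<noteq> 0"
  using integer_units_nonzero field_hom_eq_0_iff[OF hom_s] by blast

lemma l_mult: "u \<in> U \<Longrightarrow> v \<in> U \<Longrightarrow> l (u * v) = l u + l v"
  using s_nonzero[of u] s_nonzero[of v]
  by (simp add: l_def field_hom_mult[OF hom_s] abs_mult ln_mult)

lemma l_1: "l 1 = 0"
  by (simp add: l_def field_hom_1[OF hom_s])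

lemma l_inverse: "u \<in> U \<Longrightarrow> l (inverse u) = - l u"
  using l_mult[of u "inverse u"] integer_units_inverse[of u] integer_units_nonzero[of u] l_1 by simp

lemma l_power: "u \<in> U \<Longrightarrow> l (u ^ n) = real n * l u"
  by (induction n) (auto simp: l_1 l_mult integer_units_power algebra_simps)

lemma int_multiple_unit:
  assumes "u \<in> U" obtains w where "w \<in> U" "\<And>g. g \<in> G \<Longrightarrow> l (g w) = of_int a * l (g u)"
proof (cases "a \<ge> 0")
  case True
  have "l (g (u ^ nat a)) = of_int a * l (g u)" if "g \<in> G" for g
    using True assms that by (simp add: field_hom_power[OF G_hom] l_power U_G)
  then show thesis using assms by (intro that[of "u ^ nat a"] integer_units_power) auto
next
  case False
  have "l (g (inverse (u ^ nat (- a)))) = of_int a * l (g u)" if "g \<in> G" for g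
    using False assms that
    by (simp add: field_hom_power[OF G_hom] field_hom_inverse[OF G_hom] l_power l_inverse
        integer_units_power U_G)
  then show thesis
    using assms by (intro that[of "inverse (u ^ nat (- a))"] integer_units_power integer_units_inverse) auto
qed

lemma int_combination_unit:
  assumes "u \<in> U" "v \<in> U"
  obtains w where "w \<in> U" "\<And>g. g \<in> G \<Longrightarrow> l (g w) = of_int a * l (g u) + of_int b * l (g v)"
proof -
  obtain x where x: "x \<in> U" "\<And>g. g \<in> G \<Longrightarrow> l (g x) = of_int a * l (g u)"
    using int_multiple_unit[OF assms(1)] by metis
  obtain y where y: "y \<in> U" "\<And>g. g \<in> G \<Longrightarrow> l (g y) = of_int b * l (g v)"
    using int_multiple_unit[OF assms(2)] by metis
  show thesis
    by (rule that[of "x * y"])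
      (auto simp: x y integer_units_mult field_hom_mult[OF G_hom] l_mult U_G)
qed

text \<open>Clears denominators. The same \<open>m\<close> and \<open>w\<close> serve every g, so a
  rational relation between logarithms can be carried to all conjugates through the unit
  \<open>w\<close>.\<close>

lemma rat_combination_unit:
  fixes c :: "'i \<Rightarrow> rat"
  assumes "finite I" "\<And>i. i \<in> I \<Longrightarrow> u i \<in> U"
  obtains m :: nat and w where "m > 0" "w \<in> U"
    "\<And>g. g \<in> G \<Longrightarrow> l (g w) = real m * (\<Sum>i\<in>I. of_rat (c i) * l (g (u i)))"
proof -
  have "\<exists>m>0. \<exists>w\<in>U. \<forall>g\<in>G. l (g w) = real m * (\<Sum>i\<in>I. of_rat (c i) * l (g (u i)))"
    using assms
  proof (induction I rule: finite_induct)
    case empty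
    then show ?case
      by (intro exI[of _ 1] conjI bexI[of _ 1])
        (auto simp: integer_units_1 field_hom_1[OF G_hom] l_1)
  next
    case (insert i I)
    then obtain m w where mw: "m > 0" "w \<in> U"
      "\<And>g. g \<in> G \<Longrightarrow> l (g w) = real m * (\<Sum>i\<in>I. of_rat (c i) * l (g (u i)))" by auto
    obtain a b where ab: "quotient_of (c i) = (a, b)" by fastforce
    have b: "b > 0" using quotient_of_denom_pos[OF ab] .
    have ci: "of_rat (c i) = (real_of_int a / real_of_int b)"
      using quotient_of_div[OF ab] by (simp add: of_rat_divide)
    have "u i \<in> U" using insert by simp
    then obtain x where x: "x \<in> U" "\<And>g. g \<in> G \<Longrightarrow> l (g x) = of_int b * l (g w) + of_int (int m * a) * l (g (u i))"
      using int_combination_unit[OF mw(2)] by metis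
    have "l (g x) = real (m * nat b) * (\<Sum>i\<in>insert i I. of_rat (c i) * l (g (u i)))" if g: "g \<in> G" for g
    proof -
      have "real (m * nat b) * (\<Sum>i\<in>insert i I. of_rat (c i) * l (g (u i))) =
        real m * (real_of_int b * of_rat (c i)) * l (g (u i)) +
        real_of_int b * (real m * (\<Sum>i\<in>I. of_rat (c i) * l (g (u i))))"
        using insert.hyps b by (simp add: algebra_simps)
      also have "real_of_int b * of_rat (c i) = real_of_int a" using b by (simp add: ci)
      finally show ?thesis using x(2)[OF g] mw(3)[OF g] by simp
    qed
    then show ?case using x(1) mw(1) b by (intro exI[of _ "m * nat b"]) auto
  qed
  then show thesis using that by blast
qed

text \<open>Since \<open>s\<close> is real, l u = 0 leaves only u = 1 and u = -1, and both are fixed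
  by every automorphism.\<close>

lemma l_eq_0_conj:
  assumes "u \<in> U" "l u = 0" "g \<in> G"
  shows "l (g u) = 0"
proof -
  have "\<bar>s u\<bar> = 1" using assms s_nonzero[OF assms(1)] by (simp add: l_def)
  then have "s u = s 1 \<or> s u = s (- 1)"
    by (auto simp: field_hom_1[OF hom_s] field_hom_minus[OF hom_s] abs_if split: if_splits)
  then have "u = 1 \<or> u = - 1" using field_hom_inj[OF hom_s] by (auto dest: injD)
  then show ?thesis
    using G_hom[OF assms(3)]
    by (auto simp: l_def field_hom_1 field_hom_minus field_hom_1[OF hom_s] field_hom_minus[OF hom_s])
qed

text \<open>The norm of a unit is an integer dividing 1.\<close>

lemma sum_l_eq_0: assumes "u \<in> U" shows "(\<Sum>g\<in>G. l (g u)) = 0"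
proof -
  obtain v where v: "algebraic_int u" "algebraic_int v" "u * v = 1"
    using assms by (auto simp: integer_units_def)
  obtain a b :: int where ab: "nrm u = of_int a" "nrm v = of_int b"
    using nrm_Ints[OF v(1)] nrm_Ints[OF v(2)] by (auto elim!: Ints_cases)
  have "nrm u * nrm v = nrm 1" by (simp add: v flip: nrm_mult)
  also have "nrm 1 = 1" by (simp add: nrm_def field_hom_1[OF G_hom])
  finally have "of_int (a * b) = (of_int 1 :: 'k)" by (simp add: ab)
  then have "a * b = 1" by (simp only: of_int_eq_iff)
  then have "\<bar>a\<bar> = 1" by (metis abs_mult abs_one abs_zmult_eq_1)
  then have "\<bar>s (nrm u)\<bar> = 1"
    by (simp add: ab field_hom_of_int[OF hom_s] flip: of_int_abs)
  then have "ln (\<Prod>g\<in>G. \<bar>s (g u)\<bar>) = 0" by (simp flip: abs_s_nrm)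
  moreover have "ln (\<Prod>g\<in>G. \<bar>s (g u)\<bar>) = (\<Sum>g\<in>G. l (g u))"
    unfolding l_def by (rule ln_prod) (use assms finite_G U_G s_nonzero in auto)
  ultimately show ?thesis by simp
qed

section \<open>Relations between the conjugates of a Minkowski unit\<close>

text \<open>Usually a Minkowski unit is one whose conjugates generate a subgroup of finite index;
  this size condition is a concrete way to ensure that. The identity conjugate has to compensate the
  others, as the product of all is 1 or -1.\<close>

definition is_minkowski_unit :: "'k \<Rightarrow> bool"
  where "is_minkowski_unit \<epsilon> \<longleftrightarrow> \<epsilon> \<in> U \<and> (\<forall>g\<in>G. g \<noteq> id \<longrightarrow> \<bar>s (g \<epsilon>)\<bar> < 1)"

lemma ex_minkowski_unit: obtains \<epsilon> where "is_minkowski_unit \<epsilon>"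
  unfolding is_minkowski_unit_def by (rule minkowski_unit) blast

lemma is_minkowski_unit_U: "is_minkowski_unit \<epsilon> \<Longrightarrow> \<epsilon> \<in> U"
  by (simp add: is_minkowski_unit_def)

text \<open>Maximum principle: conjugate the relation by the inverse of an index \<open>k\<close>
  with c k maximal and combine it with c k times the relation of sum zero. Every term is then
  nonnegative and the total is zero; for g other than \<open>k\<close> the logarithm is strictly
  negative, so c g = c k.\<close>

lemma minkowski_unit_independent:
  fixes c :: "('k \<Rightarrow> 'k) \<Rightarrow> rat"
  assumes mink: "is_minkowski_unit \<epsilon>"
    and c: "(\<Sum>g\<in>G. of_rat (c g) * l (g \<epsilon>)) = 0" and h: "h \<in> G" "h' \<in> G"
  shows "c h = c h'"
proof -
  have \<epsilon>: "\<epsilon> \<in> U" "\<And>g. g \<in> G \<Longrightarrow> g \<noteq> id \<Longrightarrow> \<bar>s (g \<epsilon>)\<bar> < 1"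
    using mink by (auto simp: is_minkowski_unit_def)
  obtain m :: nat and w where w: "m > 0" "w \<in> U"
    "\<And>h. h \<in> G \<Longrightarrow> l (h w) = real m * (\<Sum>g\<in>G. of_rat (c g) * l (h (g \<epsilon>)))"
    by (rule rat_combination_unit[of G "\<lambda>g. g \<epsilon>" c]) (use finite_G U_G[OF \<epsilon>(1)] in blast)+
  \<comment> \<open>The relation has become the vanishing of \<open>l\<close> at a unit, which
    passes to all conjugates.\<close>
  have "l w = 0" using w(3)[OF id_G] c by simp
  then have zero: "(\<Sum>g\<in>G. of_rat (c g) * l (h (g \<epsilon>))) = 0" if "h \<in> G" for h
    using w(3)[OF that] l_eq_0_conj[OF w(2) _ that] w(1) by simp
  obtain k where k: "k \<in> G" "\<And>g. g \<in> G \<Longrightarrow> c g \<le> c k"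
  proof -
    have "Max (c ` G) \<in> c ` G" using finite_G id_G by (intro Max_in) auto
    then obtain k where "k \<in> G" "c k = Max (c ` G)" by auto
    then show thesis using finite_G by (intro that[of k]) auto
  qed
  have neg: "l (inv k (g \<epsilon>)) < 0" if "g \<in> G" "g \<noteq> k" for g
  proof -
    have "inv k \<circ> g \<noteq> id"
    proof
      assume "inv k \<circ> g = id"
      then have "k \<circ> (inv k \<circ> g) = k" by simp
      then show False using that inv_comp_G(2)[OF k(1)] by (simp flip: comp_assoc)
    qed
    then have "\<bar>s ((inv k \<circ> g) \<epsilon>)\<bar> < 1" by (intro \<epsilon>(2) comp_G inv_G k that)
    moreover have "\<bar>s ((inv k \<circ> g) \<epsilon>)\<bar> > 0"
      using s_nonzero[OF U_G[OF \<epsilon>(1) comp_G[OF inv_G[OF k(1)] that(1)]]] by simp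
    ultimately show ?thesis by (simp add: l_def)
  qed
  have "(\<Sum>g\<in>G. l (inv k (g \<epsilon>))) = 0"
    using sum.reindex_bij_betw[OF bij_comp_left[OF inv_G[OF k(1)]], of "\<lambda>g. l (g \<epsilon>)"]
      sum_l_eq_0[OF \<epsilon>(1)] by simp
  then have "(\<Sum>g\<in>G. of_rat (c k - c g) * (- l (inv k (g \<epsilon>)))) = 0"
    using zero[OF inv_G[OF k(1)]]
    by (simp add: of_rat_diff left_diff_distrib sum_subtractf sum_negf flip: sum_distrib_left)
  then have "\<forall>g\<in>G. of_rat (c k - c g) * (- l (inv k (g \<epsilon>))) = 0"
  proof (subst (asm) sum_nonneg_eq_0_iff[OF finite_G])
    fix g assume g: "g \<in> G"
    show "0 \<le> real_of_rat (c k - c g) * (- l (inv k (g \<epsilon>)))"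
    proof (cases "g = k")
      case False
      have "0 \<le> real_of_rat (c k - c g)" using k(2)[OF g] by (simp only: zero_le_of_rat_iff diff_ge_0_iff_ge)
      moreover have "0 \<le> - l (inv k (g \<epsilon>))" using neg[OF g False] by simp
      ultimately show ?thesis by (rule mult_nonneg_nonneg)
    qed simp
  qed
  then have eq: "c g = c k" if "g \<in> G" for g
    using that neg[OF that] by (cases "g = k") auto
  show ?thesis using eq[OF h(1)] eq[OF h(2)] by simp
qed

lemma span_l_unit:
  assumes "x \<in> rat_vs.span (l ` U)"
  obtains m :: nat and u where "m > 0" "u \<in> U" "real m * x = l u"
proof -
  have "\<exists>m>0. \<exists>u\<in>U. real m * x = l u"
    using assms
  proof (induction rule: rat_vs.span_induct_alt)
    case base
    show ?case by (intro exI[of _ 1] conjI bexI[of _ 1]) (auto simp: integer_units_1 l_1)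
  next
    case (step q y x)
    then obtain v m u where v: "v \<in> U" "y = l v" and u: "m > 0" "u \<in> U" "real m * x = l u" by auto
    \<comment> \<open>With these weights, division by k m afterwards returns q y + x.\<close>
    define c where "c i = (if i = 0 then of_nat m * q else 1)" for i :: nat
    have uv: "(if i = 0 then v else u) \<in> U" for i :: nat using u v by simp
    have fin: "finite {0, 1 :: nat}" by simp
    obtain k :: nat and w where w: "k > 0" "w \<in> U" "\<And>g. g \<in> G \<Longrightarrow>
      l (g w) = real k * (\<Sum>i\<in>{0, 1 :: nat}. of_rat (c i) * l (g (if i = 0 then v else u)))"
      by (rule rat_combination_unit[of "{0, 1}" "\<lambda>i. if i = 0 then v else u" c, OF fin uv]) blast
    have "real (k * m) * (rat_scale q y + x) = l w"
      using w(3)[OF id_G] u(3) by (simp add: c_def v rat_scale_def of_rat_mult algebra_simps)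
    then show ?case using w u by (intro exI[of _ "k * m"]) auto
  qed
  then show thesis using that by blast
qed

text \<open>A polynomial of degree below |G| that vanishes at \<theta> vanishes at its |G| distinct
  conjugates, so it is zero. Hence the powers are independent, and their number is the degree of the
  field.\<close>

lemma powers_span:
  assumes inj: "inj_on (\<lambda>g. g \<theta>) G"
  shows "rat_vs.span ((\<lambda>i. \<theta> ^ i) ` {..<card G}) = UNIV"
proof -
  let ?n = "card G"
  have indep: "\<forall>i<?n. c i = 0" if c: "(\<Sum>i<?n. of_rat (c i) * \<theta> ^ i) = 0" for c :: "nat \<Rightarrow> rat"
  proof -
    define p :: "'k poly" where "p = (\<Sum>i<?n. monom (of_rat (c i)) i)"
    have roots: "(\<lambda>g. g \<theta>) ` G \<subseteq> {x. poly p x = 0}"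
    proof (clarify)
      fix g assume g: "g \<in> G"
      have "poly p (g \<theta>) = g (\<Sum>i<?n. of_rat (c i) * \<theta> ^ i)"
        using G_hom[OF g]
        by (simp add: p_def poly_sum poly_monom field_hom_sum field_hom_mult field_hom_power field_hom_of_rat)
      then show "poly p (g \<theta>) = 0" by (simp add: c field_hom_0[OF G_hom[OF g]])
    qed
    have "p = 0"
    proof (rule ccontr)
      assume p: "p \<noteq> 0"
      have "?n = card ((\<lambda>g. g \<theta>) ` G)" using card_image[OF inj] by simp
      also have "\<dots> \<le> card {x. poly p x = 0}" by (rule card_mono[OF poly_roots_finite[OF p] roots])
      also have "\<dots> \<le> degree p" by (rule card_poly_roots_bound[OF p])
      also have "\<dots> < ?n"
      proof -
        have "degree p \<le> ?n - 1" unfolding p_def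
          by (rule degree_sum_le) (auto intro: order.trans[OF degree_monom_le])
        moreover have "?n > 0" using finite_G id_G by (auto simp: card_gt_0_iff)
        ultimately show ?thesis by linarith
      qed
      finally show False by simp
    qed
    show ?thesis
    proof (intro allI impI)
      fix i assume "i < ?n"
      then have "coeff p i = of_rat (c i)" by (simp add: p_def coeff_sum)
      with \<open>p = 0\<close> show "c i = 0" by simp
    qed
  qed
  have inj_pow: "inj_on (\<lambda>i. \<theta> ^ i) {..<?n}"
  proof (rule inj_onI, rule ccontr)
    fix i j assume ij: "i \<in> {..<?n}" "j \<in> {..<?n}" "\<theta> ^ i = \<theta> ^ j" "i \<noteq> j"
    define c :: "nat \<Rightarrow> rat" where "c k = (if k = i then 1 else 0) - (if k = j then 1 else 0)" for k
    have "(\<Sum>k<?n. of_rat (c k) * \<theta> ^ k) =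
      (\<Sum>k<?n. if k = i then \<theta> ^ k else 0) - (\<Sum>k<?n. if k = j then \<theta> ^ k else 0)"
      unfolding sum_subtractf[symmetric] by (rule sum.cong) (auto simp: c_def of_rat_diff)
    also have "\<dots> = 0" using ij by simp
    finally have "c i = 0" using indep ij(1) by blast
    then show False using ij(4) by (simp add: c_def)
  qed
  let ?P = "(\<lambda>i. \<theta> ^ i) ` {..<?n}"
  have ind: "rat_vs.independent ?P"
  proof (rule rat_vs.independent_if_scalars_zero)
    fix f x assume f: "(\<Sum>x\<in>?P. rat_scale (f x) x) = 0" and x: "x \<in> ?P"
    have "(\<Sum>i<?n. of_rat (f (\<theta> ^ i)) * \<theta> ^ i) = 0"
      using f by (simp add: sum.reindex[OF inj_pow] rat_scale_def)
    then show "f x = 0" using indep[of "\<lambda>i. f (\<theta> ^ i)"] x by auto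
  qed simp
  obtain B :: "'k set" where B: "finite B" "rat_vs.independent B" "rat_vs.span B = UNIV"
    "card B = field_degree TYPE('k)"
    by (rule number_field_basis[OF nf])
  show ?thesis
  proof (rule ccontr)
    assume "rat_vs.span ?P \<noteq> UNIV"
    then obtain x where x: "x \<notin> rat_vs.span ?P" by auto
    then have "rat_vs.independent (insert x ?P)" using ind by (rule rat_vs.independent_insertI)
    then have "card (insert x ?P) \<le> card B"
      using rat_vs.independent_span_bound[OF B(1), of "insert x ?P"] B(3) by simp
    moreover have "x \<notin> ?P" using x rat_vs.span_base[of x ?P] by (rule contrapos_nn)
    ultimately show False using B(4) card_G card_image[OF inj_pow] by simp
  qed
qed

end

text \<open>Normality of the second field: \<open>conj_poly v\<close> has rational coefficients, so
  it also kills u, which has the same real image as v, and then g u; over the reals it splits with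
  roots s2 (h v).\<close>

lemma conjugates_in_common_range:
  assumes "real_galois (s1 :: 'k1::field_char_0 \<Rightarrow> real)" "real_galois (s2 :: 'k2::field_char_0 \<Rightarrow> real)"
    and uv: "s1 u = s2 v" and g: "g \<in> field_auts"
  obtains h where "h \<in> field_auts" "s1 (g u) = s2 (h v)"
proof -
  interpret K1: real_galois s1 by fact
  interpret K2: real_galois s2 by fact
  obtain q where q: "K2.conj_poly v = map_poly of_rat q"
    using Rats_poly_obtain[OF K2.coeff_conj_poly_Rats] by metis
  have "s2 (poly (map_poly of_rat q) v) = 0"
    using K2.poly_conj_poly_self[of v] by (simp add: q field_hom_0[OF K2.hom_s])
  then have "s1 (poly (map_poly of_rat q) u) = 0"
    by (simp add: field_hom_poly_of_rat[OF K1.hom_s] field_hom_poly_of_rat[OF K2.hom_s] uv)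
  then have "poly (map_poly of_rat q) u = 0" by (simp add: field_hom_eq_0_iff[OF K1.hom_s])
  then have "s1 (g (poly (map_poly of_rat q) u)) = 0"
    by (simp add: field_hom_0[OF K1.G_hom[OF g]] field_hom_0[OF K1.hom_s])
  then have "poly (map_poly of_rat q) (s1 (g u)) = 0"
    by (simp add: field_hom_poly_of_rat[OF K1.hom_s] field_hom_poly_of_rat[OF K1.G_hom[OF g]])
  moreover have "poly (map_poly of_rat q) (s1 (g u)) = (\<Prod>h\<in>field_auts. s1 (g u) - s2 (h v))"
  proof -
    have "map_poly of_rat q = map_poly s2 (map_poly of_rat q)"
      by (rule poly_eqI) (simp add: coeff_map_poly field_hom_0[OF K2.hom_s] field_hom_of_rat[OF K2.hom_s])
    also have "\<dots> = (\<Prod>h\<in>field_auts. [:- s2 (h v), 1:])"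
      by (simp add: K2.conj_poly_def field_hom_map_poly_prod[OF K2.hom_s]
          field_hom_map_poly_linear[OF K2.hom_s] flip: q)
    finally show ?thesis by (simp add: poly_prod)
  qed
  ultimately obtain h where "h \<in> (field_auts :: ('k2 \<Rightarrow> 'k2) set)" "s1 (g u) - s2 (h v) = 0"
    using prod_zero_iff[OF K2.finite_G, of "\<lambda>h. s1 (g u) - s2 (h v)"] by auto
  then show thesis using that by simp
qed

section \<open>Polynomial relations between logarithms\<close>

definition monomial_eval :: "(nat \<Rightarrow>\<^sub>0 nat) \<Rightarrow> (nat \<Rightarrow> complex) \<Rightarrow> complex"
  where "monomial_eval \<alpha> x = (\<Prod>i\<in>Poly_Mapping.keys \<alpha>. x i ^ Poly_Mapping.lookup \<alpha> i)"

lemma monomial_eval_superset: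
  assumes "finite S" "Poly_Mapping.keys \<alpha> \<subseteq> S"
  shows "monomial_eval \<alpha> x = (\<Prod>i\<in>S. x i ^ Poly_Mapping.lookup \<alpha> i)"
  unfolding monomial_eval_def using assms
  by (intro prod.mono_neutral_left) (auto simp: in_keys_iff)

lemma monomial_eval_add: "monomial_eval (\<alpha> + \<beta>) x = monomial_eval \<alpha> x * monomial_eval \<beta> x"
proof -
  let ?S = "Poly_Mapping.keys \<alpha> \<union> Poly_Mapping.keys \<beta>"
  have "monomial_eval (\<alpha> + \<beta>) x = (\<Prod>i\<in>?S. x i ^ Poly_Mapping.lookup (\<alpha> + \<beta>) i)"
    by (rule monomial_eval_superset) (auto dest: subsetD[OF Poly_Mapping.keys_add])
  also have "\<dots> = (\<Prod>i\<in>?S. x i ^ Poly_Mapping.lookup \<alpha> i) * (\<Prod>i\<in>?S. x i ^ Poly_Mapping.lookup \<beta> i)"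
    by (simp add: lookup_add power_add prod.distrib)
  also have "\<dots> = monomial_eval \<alpha> x * monomial_eval \<beta> x"
    using monomial_eval_superset[of ?S \<alpha>] monomial_eval_superset[of ?S \<beta>] by simp
  finally show ?thesis .
qed

lemma mpoly_eval_superset:
  assumes "finite S" "Poly_Mapping.keys p \<subseteq> S"
  shows "mpoly_eval p x = (\<Sum>\<alpha>\<in>S. of_rat (Poly_Mapping.lookup p \<alpha>) * monomial_eval \<alpha> x)"
  unfolding mpoly_eval_def monomial_eval_def using assms
  by (intro sum.mono_neutral_left) (auto simp: in_keys_iff)

lemma mpoly_eval_add: "mpoly_eval (p + q) x = mpoly_eval p x + mpoly_eval q x"
proof -
  let ?S = "Poly_Mapping.keys p \<union> Poly_Mapping.keys q"
  have "mpoly_eval (p + q) x = (\<Sum>\<alpha>\<in>?S. of_rat (Poly_Mapping.lookup (p + q) \<alpha>) * monomial_eval \<alpha> x)"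
    by (rule mpoly_eval_superset) (auto dest: subsetD[OF Poly_Mapping.keys_add])
  also have "\<dots> = mpoly_eval p x + mpoly_eval q x"
    using mpoly_eval_superset[of ?S p x] mpoly_eval_superset[of ?S q x]
    by (simp add: lookup_add of_rat_add distrib_right sum.distrib)
  finally show ?thesis .
qed

text \<open>Polynomials are handled through their functions, so that products of linear forms need
  not be expanded as explicit finite maps; \<open>polyfun_eq_0\<close> returns to the
  coefficients.\<close>

definition polyfun :: "nat \<Rightarrow> ((nat \<Rightarrow> complex) \<Rightarrow> complex) \<Rightarrow> bool"
  where "polyfun m F \<longleftrightarrow> (\<exists>p. mpoly_vars p \<subseteq> {..<m} \<and> (\<forall>x. F x = mpoly_eval p x))"

lemma polyfun_monomial:
  assumes "Poly_Mapping.keys \<alpha> \<subseteq> {..<m}"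
  shows "polyfun m (\<lambda>x. of_rat c * monomial_eval \<alpha> x)"
proof -
  have "of_rat c * monomial_eval \<alpha> x = mpoly_eval (Poly_Mapping.single \<alpha> c) x" for x
    using mpoly_eval_superset[of "{\<alpha>}" "Poly_Mapping.single \<alpha> c" x] by simp
  moreover have "mpoly_vars (Poly_Mapping.single \<alpha> c) \<subseteq> {..<m}"
    using assms by (auto simp: mpoly_vars_def split: if_splits)
  ultimately show ?thesis unfolding polyfun_def by blast
qed

lemma polyfun_add: assumes "polyfun m F" "polyfun m H" shows "polyfun m (\<lambda>x. F x + H x)"
proof -
  obtain p q where pq: "mpoly_vars p \<subseteq> {..<m}" "\<And>x. F x = mpoly_eval p x"
    "mpoly_vars q \<subseteq> {..<m}" "\<And>x. H x = mpoly_eval q x"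
    using assms unfolding polyfun_def by blast
  have "mpoly_vars (p + q) \<subseteq> mpoly_vars p \<union> mpoly_vars q"
    unfolding mpoly_vars_def using Poly_Mapping.keys_add[of p q] by blast
  then show ?thesis unfolding polyfun_def using pq
    by (intro exI[of _ "p + q"]) (auto simp: mpoly_eval_add)
qed

lemma polyfun_0: "polyfun m (\<lambda>x. 0)"
  unfolding polyfun_def by (rule exI[of _ 0]) (simp add: mpoly_vars_def mpoly_eval_def)

lemma polyfun_1: "polyfun m (\<lambda>x. 1)"
  using polyfun_monomial[of 0 m 1] by (simp add: monomial_eval_def)

lemma polyfun_sum: "(\<And>j. j \<in> J \<Longrightarrow> polyfun m (F j)) \<Longrightarrow> polyfun m (\<lambda>x. \<Sum>j\<in>J. F j x)"
  by (induction J rule: infinite_finite_induct) (auto intro: polyfun_0 polyfun_add)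

lemma polyfun_mult_monomial:
  assumes F: "polyfun m F" and \<beta>: "Poly_Mapping.keys \<beta> \<subseteq> {..<m}"
  shows "polyfun m (\<lambda>x. of_rat c * monomial_eval \<beta> x * F x)"
proof -
  obtain p where p: "mpoly_vars p \<subseteq> {..<m}" "\<And>x. F x = mpoly_eval p x"
    using F unfolding polyfun_def by blast
  have "polyfun m (\<lambda>x. \<Sum>\<alpha>\<in>Poly_Mapping.keys p.
    of_rat (c * Poly_Mapping.lookup p \<alpha>) * monomial_eval (\<beta> + \<alpha>) x)"
  proof (intro polyfun_sum polyfun_monomial)
    fix \<alpha> assume "\<alpha> \<in> Poly_Mapping.keys p"
    then have "Poly_Mapping.keys \<alpha> \<subseteq> {..<m}" using p(1) by (auto simp: mpoly_vars_def)
    then show "Poly_Mapping.keys (\<beta> + \<alpha>) \<subseteq> {..<m}" using \<beta> Poly_Mapping.keys_add[of \<beta> \<alpha>] by blast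
  qed
  moreover have "of_rat c * monomial_eval \<beta> x * F x = (\<Sum>\<alpha>\<in>Poly_Mapping.keys p.
    of_rat (c * Poly_Mapping.lookup p \<alpha>) * monomial_eval (\<beta> + \<alpha>) x)" for x
    using mpoly_eval_superset[of "Poly_Mapping.keys p" p x]
    by (simp add: p(2) sum_distrib_left monomial_eval_add of_rat_mult mult_ac)
  ultimately show ?thesis by simp
qed

lemma polyfun_scale: "polyfun m F \<Longrightarrow> polyfun m (\<lambda>x. of_rat c * F x)"
  using polyfun_mult_monomial[of m F 0 c] by (simp add: monomial_eval_def)

lemma polyfun_mult_var: "polyfun m F \<Longrightarrow> k < m \<Longrightarrow> polyfun m (\<lambda>x. x k * F x)"
  using polyfun_mult_monomial[of m F "Poly_Mapping.single k 1" 1] by (simp add: monomial_eval_def)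

lemma polyfun_mult_linear:
  assumes "polyfun m F"
  shows "polyfun m (\<lambda>x. (\<Sum>k<m. of_rat (a k) * x k) * F x)"
proof -
  have "polyfun m (\<lambda>x. \<Sum>k<m. of_rat (a k) * (x k * F x))"
    using assms by (intro polyfun_sum polyfun_scale polyfun_mult_var) auto
  then show ?thesis by (simp add: sum_distrib_right mult.assoc)
qed

lemma polyfun_prod_linear: "polyfun m (\<lambda>x. \<Prod>i<(d::nat). \<Sum>k<m. of_rat (a i k) * x k)"
proof (induction d)
  case (Suc d)
  then show ?case using polyfun_mult_linear[OF Suc, of "a d"] by (simp add: mult.commute)
qed (simp add: polyfun_1)

text \<open>Independence of \<open>y\<close> kills the underlying polynomial, so vanishing at this
  one point gives vanishing everywhere. This is what legitimates substitution.\<close>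

lemma polyfun_eq_0:
  assumes "algebraically_independent m y" "polyfun m F" "F y = 0"
  shows "F x = 0"
proof -
  obtain p where p: "mpoly_vars p \<subseteq> {..<m}" "\<And>x. F x = mpoly_eval p x"
    using assms(2) unfolding polyfun_def by blast
  then have "p = 0" using assms unfolding algebraically_independent_def by metis
  then show ?thesis by (simp add: p(2) mpoly_eval_def)
qed

text \<open>By the conjecture, the numbers of a rational basis of the span of finitely many logarithms
  behave like indeterminates, so every rational linear map is a substitution that preserves
  homogeneous polynomial relations between these logarithms.\<close>

lemma weak_schanuel_transfer:
  fixes w :: "'j \<Rightarrow> nat \<Rightarrow> real" and a :: "'j \<Rightarrow> rat"
  assumes wsc: weak_schanuel_conjecture and J: "finite J"
    and alg: "\<And>j i. j \<in> J \<Longrightarrow> i < d \<Longrightarrow> algebraic (exp (w j i))"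
    and lin: "Vector_Spaces.linear rat_scale rat_scale \<psi>"
    and rel: "(\<Sum>j\<in>J. of_rat (a j) * (\<Prod>i<d. w j i)) = 0"
  shows "(\<Sum>j\<in>J. of_rat (a j) * (\<Prod>i<d. \<psi> (w j i))) = (0 :: real)"
proof -
  interpret \<psi>: Vector_Spaces.linear rat_scale rat_scale \<psi> by (rule lin)
  define V where "V = (\<lambda>(j, i). w j i) ` (J \<times> {..<d})"
  have finV: "finite V" using J by (simp add: V_def)
  obtain B where B: "B \<subseteq> V" "rat_vs.independent B" "V \<subseteq> rat_vs.span B"
    by (rule rat_vs.maximal_independent_subset[of V])
  have finB: "finite B" using B(1) finV by (rule finite_subset)
  define m where "m = card B"
  obtain e where e: "bij_betw e {..<m} B"
    using ex_bij_betw_nat_finite[OF finB] by (auto simp: m_def lessThan_atLeast0)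
  have "\<exists>r. v = (\<Sum>k<m. of_rat (r k) * e k)" if "v \<in> V" for v
  proof -
    have "v \<in> rat_vs.span B" using that B(3) by blast
    then obtain u where "v = (\<Sum>b\<in>B. rat_scale (u b) b)" using rat_vs.span_finite[OF finB] by auto
    then have "v = (\<Sum>k<m. of_rat (u (e k)) * e k)"
      using sum.reindex_bij_betw[OF e, of "\<lambda>b. rat_scale (u b) b"] by (simp add: rat_scale_def)
    then show ?thesis by (intro exI[of _ "\<lambda>k. u (e k)"])
  qed
  then obtain r where r: "\<And>v. v \<in> V \<Longrightarrow> v = (\<Sum>k<m. of_rat (r v k) * e k)" by metis
  have \<psi>r: "\<psi> v = (\<Sum>k<m. of_rat (r v k) * \<psi> (e k))" if "v \<in> V" for v
  proof -
    have "\<psi> v = \<psi> (\<Sum>k<m. rat_scale (r v k) (e k))" using r[OF that] by (simp add: rat_scale_def)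
    also have "\<dots> = (\<Sum>k<m. of_rat (r v k) * \<psi> (e k))"
      by (simp only: \<psi>.sum \<psi>.scale) (simp add: rat_scale_def)
    finally show ?thesis .
  qed
  have indep: "rat_linearly_independent m (\<lambda>k. complex_of_real (e k))"
    unfolding rat_linearly_independent_def
  proof (intro allI impI)
    fix c :: "nat \<Rightarrow> rat" and k
    assume c: "(\<Sum>k<m. of_rat (c k) * complex_of_real (e k)) = 0" and k: "k < m"
    define f where "f b = c (inv_into {..<m} e b)" for b
    have f: "f (e i) = c i" if "i < m" for i
      using that e by (simp add: f_def bij_betw_def inv_into_f_f)
    have "of_rat q = complex_of_real (of_rat q)" for q
      by (cases q) (simp add: of_rat_rat)
    then have "complex_of_real (\<Sum>k<m. of_rat (c k) * e k) = 0" using c by simp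
    then have "(\<Sum>k<m. of_rat (c k) * e k) = 0" by (simp only: of_real_eq_0_iff)
    then have "(\<Sum>b\<in>B. rat_scale (f b) b) = 0"
      using sum.reindex_bij_betw[OF e, of "\<lambda>b. rat_scale (f b) b"] f by (simp add: rat_scale_def)
    then have "f (e k) = 0"
      using rat_vs.independentD[OF B(2) finB subset_refl, of f "e k"] e k by (auto simp: bij_betw_def)
    then show "c k = 0" using f[OF k] by simp
  qed
  have "algebraic (exp (complex_of_real (e k)))" if "k < m" for k
  proof -
    have "e k \<in> V" using e B(1) that by (auto simp: bij_betw_def)
    then obtain j i where "j \<in> J" "i < d" "e k = w j i" by (auto simp: V_def)
    then have "algebraic (exp (e k))" using alg by simp
    then show ?thesis by (simp add: exp_of_real)
  qed
  then have ai: "algebraically_independent m (\<lambda>k. complex_of_real (e k))"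
    by (rule wsc[unfolded weak_schanuel_conjecture_def, rule_format, OF _ indep])
  \<comment> \<open>The relation with every logarithm expanded in the basis and the basis replaced
    by variables. Its values at \<open>e\<close> and at the images \<psi> (e k) are the two sums to
    be compared.\<close>
  define F where "F x = (\<Sum>j\<in>J. of_rat (a j) * (\<Prod>i<d. \<Sum>k<m. of_rat (r (w j i) k) * x k))"
    for x :: "nat \<Rightarrow> complex"
  have poly: "polyfun m F" unfolding F_def
    by (intro polyfun_sum polyfun_scale polyfun_prod_linear)
  have of_rat_complex: "(of_rat q :: complex) = complex_of_real (of_rat q)" for q
    by (cases q) (simp add: of_rat_rat)
  have wV: "w j i \<in> V" if "j \<in> J" "i < d" for j i using that by (auto simp: V_def)
  have eval: "F (\<lambda>k. complex_of_real (y k)) =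
    complex_of_real (\<Sum>j\<in>J. of_rat (a j) * (\<Prod>i<d. \<Sum>k<m. of_rat (r (w j i) k) * y k))" for y
    by (simp add: F_def of_rat_complex)
  have "(\<Sum>j\<in>J. of_rat (a j) * (\<Prod>i<d. \<Sum>k<m. of_rat (r (w j i) k) * e k)) =
    (\<Sum>j\<in>J. of_rat (a j) * (\<Prod>i<d. w j i))"
    by (intro sum.cong arg_cong2[of _ _ _ _ "(*)"] prod.cong) (simp_all add: r[OF wV, symmetric])
  then have "F (\<lambda>k. complex_of_real (e k)) = 0" unfolding eval using rel by simp
  then have "F (\<lambda>k. complex_of_real (\<psi> (e k))) = 0" by (rule polyfun_eq_0[OF ai poly])
  then have "(\<Sum>j\<in>J. of_rat (a j) * (\<Prod>i<d. \<Sum>k<m. of_rat (r (w j i) k) * \<psi> (e k))) = 0"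
    unfolding eval by (simp only: of_real_eq_0_iff)
  also have "(\<Sum>j\<in>J. of_rat (a j) * (\<Prod>i<d. \<Sum>k<m. of_rat (r (w j i) k) * \<psi> (e k))) =
    (\<Sum>j\<in>J. of_rat (a j) * (\<Prod>i<d. \<psi> (w j i)))"
    by (intro sum.cong arg_cong2[of _ _ _ _ "(*)"] prod.cong) (simp_all add: \<psi>r[OF wV])
  finally show ?thesis .
qed

section \<open>Comparing two fields\<close>

interpretation rat_vs_pair: vector_space_pair
  "rat_scale :: rat \<Rightarrow> 'a::field_char_0 \<Rightarrow> 'a" "rat_scale :: rat \<Rightarrow> 'b::field_char_0 \<Rightarrow> 'b"
  by (intro vector_space_pair.intro vector_space_rat_scale)

lemma rat_independent_Un:
  fixes A B :: "'a::field_char_0 set"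
  assumes A: "rat_vs.independent A" and B: "rat_vs.independent B"
    and int: "\<And>z. z \<in> rat_vs.span A \<Longrightarrow> z \<in> rat_vs.span B \<Longrightarrow> z = 0"
  shows "rat_vs.independent (A \<union> B)"
proof -
  have half: False
    if A: "rat_vs.independent A" and a: "a \<in> A" "a \<in> rat_vs.span (A \<union> B - {a})"
      and int: "\<And>z. z \<in> rat_vs.span A \<Longrightarrow> z \<in> rat_vs.span B \<Longrightarrow> z = 0" for A B :: "'a set" and a
  proof -
    have "A \<union> B - {a} \<subseteq> (A - {a}) \<union> B" by auto
    then have "a \<in> rat_vs.span ((A - {a}) \<union> B)" using a(2) rat_vs.span_mono by blast
    then obtain x y where xy: "x \<in> rat_vs.span (A - {a})" "y \<in> rat_vs.span B" "a = x + y"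
      unfolding rat_vs.span_Un by blast
    have "x \<in> rat_vs.span A" using xy(1) rat_vs.span_mono[of "A - {a}" A] by blast
    then have "a - x \<in> rat_vs.span A" by (rule rat_vs.span_diff[OF rat_vs.span_base[OF a(1)]])
    then have "y = 0" using int[of y] xy by simp
    then have "a \<in> rat_vs.span (A - {a})" using xy by simp
    then show False using A a(1) by (auto simp: rat_vs.dependent_def)
  qed
  show ?thesis
  proof
    assume "rat_vs.dependent (A \<union> B)"
    then obtain a where a: "a \<in> A \<union> B" "a \<in> rat_vs.span (A \<union> B - {a})"
      by (auto simp: rat_vs.dependent_def)
    show False
    proof (cases "a \<in> A")
      case True
      then show False using half[OF A True a(2) int] by blast
    next
      case False
      then have "a \<in> B" using a(1) by simp
      then show False using half[OF B, of a A] a(2) int by (simp add: Un_commute)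
    qed
  qed
qed

context real_galois
begin

definition pairing :: "'k \<Rightarrow> 'k \<Rightarrow> real" where "pairing x y = (\<Sum>g\<in>G. l (g x) * l (g y))"

lemma pairing_pos: assumes "x \<in> U" "l x \<noteq> 0" shows "pairing x x > 0"
proof -
  have "0 < l (id x) * l (id x)" using assms by (auto simp: zero_less_mult_iff)
  also have "\<dots> \<le> pairing x x" unfolding pairing_def
    by (rule member_le_sum[OF id_G, of "\<lambda>g. l (g x) * l (g x)"]) (auto simp: finite_G)
  finally show ?thesis .
qed

lemma algebraic_exp_l: assumes "u \<in> U" shows "algebraic (exp (l u))"
proof -
  have "exp (l u) = \<bar>s u\<bar>" using s_nonzero[OF assms] by (simp add: l_def)
  moreover have "algebraic_int \<bar>s u\<bar>"
    using assms field_hom_algebraic_int[OF hom_s] by (simp add: integer_units_def)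
  ultimately show ?thesis using algebraic_int_imp_algebraic by simp
qed

lemma l_minkowski_inj:
  assumes \<epsilon>: "is_minkowski_unit \<epsilon>"
  shows "inj_on (\<lambda>g. l (g \<epsilon>)) G"
proof (rule inj_onI, rule ccontr)
  fix g h assume gh: "g \<in> G" "h \<in> G" "l (g \<epsilon>) = l (h \<epsilon>)" "g \<noteq> h"
  define c :: "('k \<Rightarrow> 'k) \<Rightarrow> rat" where "c k = (if k = g then 1 else 0) - (if k = h then 1 else 0)" for k
  have "(\<Sum>k\<in>G. of_rat (c k) * l (k \<epsilon>)) =
    (\<Sum>k\<in>G. if k = g then l (k \<epsilon>) else 0) - (\<Sum>k\<in>G. if k = h then l (k \<epsilon>) else 0)"
    unfolding sum_subtractf[symmetric] by (rule sum.cong) (auto simp: c_def of_rat_diff)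
  also have "\<dots> = 0" using gh finite_G by simp
  finally have "c g = c h" by (rule minkowski_unit_independent[OF \<epsilon> _ gh(1,2)])
  then show False using gh(4) by (simp add: c_def)
qed

text \<open>By \<open>minkowski_unit_independent\<close> the coefficients of a relation are constant
  on G; giving the omitted identity the coefficient 0 makes that constant 0.\<close>

lemma l_minkowski_independent:
  assumes \<epsilon>: "is_minkowski_unit \<epsilon>"
  shows "rat_vs.independent ((\<lambda>g. l (g \<epsilon>)) ` (G - {id}))"
proof (rule rat_vs.independent_if_scalars_zero)
  fix f x
  assume f: "(\<Sum>x\<in>(\<lambda>g. l (g \<epsilon>)) ` (G - {id}). rat_scale (f x) x) = 0"
    and x: "x \<in> (\<lambda>g. l (g \<epsilon>)) ` (G - {id})"
  have inj: "inj_on (\<lambda>g. l (g \<epsilon>)) (G - {id})"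
    using l_minkowski_inj[OF assms] by (rule inj_on_subset) auto
  define c where "c g = (if g = id then 0 else f (l (g \<epsilon>)))" for g
  have "(\<Sum>g\<in>G. of_rat (c g) * l (g \<epsilon>)) = (\<Sum>g\<in>G - {id}. of_rat (c g) * l (g \<epsilon>))"
    using finite_G id_G by (simp add: sum.remove[of G id] c_def)
  also have "\<dots> = (\<Sum>g\<in>G - {id}. rat_scale (f (l (g \<epsilon>))) (l (g \<epsilon>)))"
    by (rule sum.cong) (auto simp: c_def rat_scale_def)
  also have "\<dots> = 0" using f by (simp add: sum.reindex[OF inj])
  finally have const: "c g = c id" if "g \<in> G" for g
    by (rule minkowski_unit_independent[OF \<epsilon> _ that id_G])
  obtain g where "g \<in> G" "g \<noteq> id" "x = l (g \<epsilon>)" using x by auto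
  then show "f x = 0" using const[of g] by (simp add: c_def)
qed (use finite_G in simp)

end

section \<open>Two fields with similar log unit lattices\<close>

text \<open>\<open>\<phi>\<close> picks units that represent the images under a lattice map, and the
  last assumption is the similarity with its factor eliminated. The degree bound concerns only the
  first field, so that either field can take this place.\<close>

locale similar_fields =
  K1: real_galois s1 + K2: real_galois s2
  for s1 :: "'k1::field_char_0 \<Rightarrow> real" and s2 :: "'k2::field_char_0 \<Rightarrow> real" +
  fixes \<phi> :: "'k1 \<Rightarrow> 'k2"
  assumes wsc: weak_schanuel_conjecture
    and deg: "card K1.G > 3"
    and \<phi>_U: "u \<in> K1.U \<Longrightarrow> \<phi> u \<in> K2.U"
    and \<phi>_nonzero: "u \<in> K1.U \<Longrightarrow> K1.l u \<noteq> 0 \<Longrightarrow> K2.l (\<phi> u) \<noteq> 0"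
    and \<phi>_pairing: "\<lbrakk>x \<in> K1.U; y \<in> K1.U; z \<in> K1.U; w \<in> K1.U\<rbrakk> \<Longrightarrow>
      K1.pairing x y * K2.pairing (\<phi> z) (\<phi> w) = K1.pairing z w * K2.pairing (\<phi> x) (\<phi> y)"
begin

definition pairing1 :: "(real \<Rightarrow> real) \<Rightarrow> 'k1 \<Rightarrow> 'k1 \<Rightarrow> real"
  where "pairing1 \<psi> x y = (\<Sum>g\<in>K1.G. \<psi> (K1.l (g x)) * \<psi> (K1.l (g y)))"

definition pairing2 :: "(real \<Rightarrow> real) \<Rightarrow> 'k2 \<Rightarrow> 'k2 \<Rightarrow> real"
  where "pairing2 \<psi> x y = (\<Sum>g\<in>K2.G. \<psi> (K2.l (g x)) * \<psi> (K2.l (g y)))"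

lemma pairing_transfer:
  assumes lin: "Vector_Spaces.linear rat_scale rat_scale \<psi>"
    and U: "x \<in> K1.U" "y \<in> K1.U" "z \<in> K1.U" "w \<in> K1.U"
  shows "pairing1 \<psi> x y * pairing2 \<psi> (\<phi> z) (\<phi> w) = pairing1 \<psi> z w * pairing2 \<psi> (\<phi> x) (\<phi> y)"
proof -
  \<comment> \<open>Index set for the difference of the two sides as a sum of signed products of
    four logarithms: the truth value selects the side and its sign, the pair (g, h) the
    term.\<close>
  define J where "J = (UNIV :: bool set) \<times> K1.G \<times> K2.G"
  define a :: "bool \<times> ('k1 \<Rightarrow> 'k1) \<times> ('k2 \<Rightarrow> 'k2) \<Rightarrow> rat" where "a = (\<lambda>(b, g, h). if b then 1 else - 1)"
  define v where "v = (\<lambda>(b, g, h). if b then [K1.l (g x), K1.l (g y), K2.l (h (\<phi> z)), K2.l (h (\<phi> w))]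
    else [K1.l (g z), K1.l (g w), K2.l (h (\<phi> x)), K2.l (h (\<phi> y))])"
  have J: "finite J" using K1.finite_G K2.finite_G by (simp add: J_def)
  have expand: "(\<Sum>j\<in>J. of_rat (a j) * (\<Prod>i<4. f (v j ! i))) =
    pairing1 f x y * pairing2 f (\<phi> z) (\<phi> w) - pairing1 f z w * pairing2 f (\<phi> x) (\<phi> y)"
    for f :: "real \<Rightarrow> real"
  proof -
    have "(\<Sum>j\<in>J. of_rat (a j) * (\<Prod>i<4. f (v j ! i))) =
      (\<Sum>p\<in>K1.G \<times> K2.G. of_rat (a (True, p)) * (\<Prod>i<4. f (v (True, p) ! i))) +
      (\<Sum>p\<in>K1.G \<times> K2.G. of_rat (a (False, p)) * (\<Prod>i<4. f (v (False, p) ! i)))"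
      using sum.cartesian_product[of "\<lambda>b p. of_rat (a (b, p)) * (\<Prod>i<4. f (v (b, p) ! i))"
          "K1.G \<times> K2.G" "UNIV :: bool set"]
      by (simp add: J_def UNIV_bool)
    also have "(\<Sum>p\<in>K1.G \<times> K2.G. of_rat (a (True, p)) * (\<Prod>i<4. f (v (True, p) ! i))) =
      pairing1 f x y * pairing2 f (\<phi> z) (\<phi> w)"
      unfolding pairing1_def pairing2_def sum_product sum.cartesian_product
      by (rule sum.cong) (auto simp: a_def v_def eval_nat_numeral mult_ac)
    also have "(\<Sum>p\<in>K1.G \<times> K2.G. of_rat (a (False, p)) * (\<Prod>i<4. f (v (False, p) ! i))) =
      - (pairing1 f z w * pairing2 f (\<phi> x) (\<phi> y))"
      unfolding pairing1_def pairing2_def sum_product sum.cartesian_product sum_negf[symmetric]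
      by (rule sum.cong) (auto simp: a_def v_def eval_nat_numeral mult_ac)
    finally show ?thesis by simp
  qed
  have "(\<Sum>j\<in>J. of_rat (a j) * (\<Prod>i<4. \<psi> (v j ! i))) = (0 :: real)"
  proof (rule weak_schanuel_transfer[OF wsc J _ lin, of 4 "\<lambda>j i. v j ! i" a])
    fix j :: "bool \<times> ('k1 \<Rightarrow> 'k1) \<times> ('k2 \<Rightarrow> 'k2)" and i :: nat
    assume j: "j \<in> J" and i: "i < 4"
    then have "i = 0 \<or> i = 1 \<or> i = 2 \<or> i = 3" by linarith
    moreover obtain b g h where bgh: "j = (b, g, h)" "g \<in> K1.G" "h \<in> K2.G"
      using j by (auto simp: J_def)
    moreover have "algebraic (exp (K1.l (g t)))" "algebraic (exp (K2.l (h (\<phi> t))))" if "t \<in> K1.U" for t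
      by (rule K1.algebraic_exp_l[OF K1.U_G[OF that bgh(2)]],
          rule K2.algebraic_exp_l[OF K2.U_G[OF \<phi>_U[OF that] bgh(3)]])
    ultimately show "algebraic (exp (v j ! i))" using U by (cases b) (auto simp: v_def)
  next
    show "(\<Sum>j\<in>J. of_rat (a j) * (\<Prod>i<4. v j ! i)) = (0 :: real)"
      using expand[of "\<lambda>x. x"] \<phi>_pairing[OF U]
      by (simp add: pairing1_def pairing2_def K1.pairing_def K2.pairing_def)
  qed
  then show ?thesis using expand[of \<psi>] by simp
qed

abbreviation V2 :: "real set" where "V2 \<equiv> rat_vs.span (K2.l ` K2.U)"

lemma pairing2_eq: "(\<And>v. v \<in> V2 \<Longrightarrow> \<psi> v = v) \<Longrightarrow> x \<in> K2.U \<Longrightarrow> y \<in> K2.U \<Longrightarrow> pairing2 \<psi> x y = K2.pairing x y"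
  unfolding pairing2_def K2.pairing_def
  by (rule sum.cong) (simp_all add: rat_vs.span_base K2.U_G)

text \<open>Membership in \<open>V2\<close> says that a power of x and a unit of the second field
  have the same absolute value in the reals; the remaining sign is absorbed into the unit.\<close>

lemma common_power:
  assumes "x \<in> K1.U" "K1.l x \<in> V2"
  obtains m :: nat and v where "m > 0" "v \<in> K2.U" "s1 (x ^ m) = s2 v"
proof -
  obtain m :: nat and v where m: "m > 0" "v \<in> K2.U" "real m * K1.l x = K2.l v"
    using K2.span_l_unit[OF assms(2)] by metis
  have "K1.l (x ^ m) = K2.l v" using m assms(1) by (simp add: K1.l_power)
  then have "\<bar>s1 (x ^ m)\<bar> = \<bar>s2 v\<bar>"
    using K1.s_nonzero[OF integer_units_power[OF assms(1), of m]] K2.s_nonzero[OF m(2)]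
    unfolding K1.l_def K2.l_def by simp
  then have "s1 (x ^ m) = s2 v \<or> s1 (x ^ m) = s2 (- v)"
    by (auto simp: field_hom_minus[OF K2.hom_s] abs_eq_iff)
  then show thesis using m that integer_units_minus[OF m(2)] by blast
qed

text \<open>Normality of both fields makes the intersection of the two spaces of logarithms Galois
  stable.\<close>

lemma conjugates_in_V2:
  assumes x: "x \<in> K1.U" "K1.l x \<in> V2" and g: "g \<in> K1.G"
  shows "K1.l (g x) \<in> V2"
proof -
  obtain m :: nat and v where m: "m > 0" "v \<in> K2.U" "s1 (x ^ m) = s2 v"
    by (rule common_power[OF x])
  obtain h where h: "h \<in> K2.G" "s1 (g (x ^ m)) = s2 (h v)"
    by (rule conjugates_in_common_range[OF K1.real_galois_axioms K2.real_galois_axioms m(3) g])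
  have "real m * K1.l (g x) = K1.l (g (x ^ m))"
    using K1.l_power[OF K1.U_G[OF x(1) g]] by (simp add: field_hom_power[OF K1.G_hom[OF g]])
  also have "\<dots> = K2.l (h v)" using h(2) by (simp add: K1.l_def K2.l_def)
  finally have "K1.l (g x) = rat_scale (1 / of_nat m) (K2.l (h v))"
    using m(1) by (simp add: rat_scale_def of_rat_divide field_simps)
  then show ?thesis
    using K2.U_G[OF m(2) h(1)] by (auto intro: rat_vs.span_scale rat_vs.span_base)
qed

lemma proper_intersection_impossible:
  assumes x: "x \<in> K1.U" "K1.l x \<noteq> 0" "K1.l x \<in> V2" and z: "z \<in> K1.U" "K1.l z \<notin> V2"
  shows False
proof -
  obtain B where B: "B \<subseteq> V2" "rat_vs.independent B" "V2 \<subseteq> rat_vs.span B"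
    by (rule rat_vs.maximal_independent_subset[of V2])
  then have spanB: "rat_vs.span B = V2"
    using rat_vs.span_minimal[OF B(1) rat_vs.subspace_span] by blast
  have ind: "rat_vs.independent (insert (K1.l z) B)"
    using z B(2) by (intro rat_vs.independent_insertI) (simp_all add: spanB)
  define p where "p = K1.pairing x x * K2.pairing (\<phi> z) (\<phi> z)"
  define r where "r = K2.pairing (\<phi> x) (\<phi> x)"
  have r: "r > 0" unfolding r_def by (rule K2.pairing_pos[OF \<phi>_U[OF x(1)] \<phi>_nonzero[OF x(1,2)]])
  \<comment> \<open>Chosen so that t >= 1 and t r = r + |p|, hence t^2 r > p. The transferred
    relation will give p >= t^2 r.\<close>
  define t where "t = 1 + \<bar>p\<bar> / r"
  obtain \<psi> where lin: "Vector_Spaces.linear rat_scale rat_scale \<psi>"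
    and \<psi>: "\<forall>b\<in>insert (K1.l z) B. \<psi> b = (if b = K1.l z then t else b)"
    using rat_vs_pair.linear_independent_extend[OF ind, of "\<lambda>b. if b = K1.l z then t else b"] by blast
  interpret \<psi>: Vector_Spaces.linear rat_scale rat_scale \<psi> by (rule lin)
  have \<psi>_V2: "\<psi> v = v" if "v \<in> V2" for v
  proof -
    have "v \<in> rat_vs.span B" using that spanB by simp
    then show ?thesis
    proof (induction rule: rat_vs.span_induct_alt)
      case base
      show ?case by (rule \<psi>.zero)
    next
      case (step c b y)
      have "b \<noteq> K1.l z" using step B(1) z(2) by blast
      then have "\<psi> b = b" using \<psi> step by simp
      then show ?case using step by (simp add: \<psi>.add \<psi>.scale)
    qed
  qed
  \<comment> \<open>This pairing involves all conjugates of x, so it stays constant only because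
    each of them, not just x, has its logarithm in \<open>V2\<close>.\<close>
  have "pairing1 \<psi> x x = K1.pairing x x"
    unfolding pairing1_def K1.pairing_def
    by (rule sum.cong) (simp_all add: \<psi>_V2 conjugates_in_V2[OF x(1,3)])
  then have "p = pairing1 \<psi> z z * r"
    using pairing_transfer[OF lin x(1) x(1) z(1) z(1)] \<phi>_U x(1) z(1)
    by (simp add: p_def r_def pairing2_eq[OF \<psi>_V2])
  moreover have "t * t \<le> pairing1 \<psi> z z"
  proof -
    have "t * t = \<psi> (K1.l (id z)) * \<psi> (K1.l (id z))" using \<psi> by simp
    also have "\<dots> \<le> pairing1 \<psi> z z" unfolding pairing1_def
      by (rule member_le_sum[OF K1.id_G, of "\<lambda>g. \<psi> (K1.l (g z)) * \<psi> (K1.l (g z))"])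
        (auto simp: K1.finite_G)
    finally show ?thesis .
  qed
  moreover have "t * r = r + \<bar>p\<bar>" using r by (simp add: t_def field_simps)
  moreover have "t \<ge> 1" using r by (simp add: t_def)
  then have "t * r \<le> t * t * r" using r by simp
  ultimately have "r + \<bar>p\<bar> \<le> p" using r mult_right_mono[of "t * t" "pairing1 \<psi> z z" r] by linarith
  then show False using r by linarith
qed

lemma trivial_intersection_impossible:
  assumes triv: "\<And>x. x \<in> K1.U \<Longrightarrow> K1.l x \<in> V2 \<Longrightarrow> K1.l x = 0"
  shows False
proof -
  obtain \<epsilon> where mink: "K1.is_minkowski_unit \<epsilon>"
    by (rule K1.ex_minkowski_unit)
  note \<epsilon> = K1.is_minkowski_unit_U[OF mink]
  define A where "A = (\<lambda>g. K1.l (g \<epsilon>)) ` (K1.G - {id})"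
  have inj: "inj_on (\<lambda>g. K1.l (g \<epsilon>)) K1.G" by (rule K1.l_minkowski_inj[OF mink])
  have A: "rat_vs.independent A" unfolding A_def by (rule K1.l_minkowski_independent[OF mink])
  obtain B where B: "B \<subseteq> V2" "rat_vs.independent B" "V2 \<subseteq> rat_vs.span B"
    by (rule rat_vs.maximal_independent_subset[of V2])
  then have spanB: "rat_vs.span B = V2"
    using rat_vs.span_minimal[OF B(1) rat_vs.subspace_span] by blast
  \<comment> \<open>An element of both spans becomes, after multiplication by a positive integer,
    the logarithm of a unit, to which \<open>triv\<close> applies.\<close>
  have AB: "z = 0" if "z \<in> rat_vs.span A" "z \<in> rat_vs.span B" for z
  proof -
    have "A \<subseteq> K1.l ` K1.U" using \<epsilon> K1.U_G by (auto simp: A_def)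
    then have "z \<in> rat_vs.span (K1.l ` K1.U)" using that(1) rat_vs.span_mono by blast
    then obtain m :: nat and u where m: "m > 0" "u \<in> K1.U" "real m * z = K1.l u"
      using K1.span_l_unit by metis
    have "rat_scale (of_nat m) z \<in> V2" using that(2) unfolding spanB by (rule rat_vs.span_scale)
    then have "K1.l u \<in> V2" using m(3) by (simp add: rat_scale_def)
    then show ?thesis using triv[OF m(2)] m by simp
  qed
  have ind: "rat_vs.independent (A \<union> B)" by (rule rat_independent_Un[OF A B(2) AB])
  have disj: "A \<inter> B = {}"
  proof -
    have "0 \<notin> A" using A rat_vs.dependent_zero by blast
    then show ?thesis using AB rat_vs.span_base by blast
  qed
  define q where "q = K2.pairing (\<phi> \<epsilon>) (\<phi> \<epsilon>)"
  define r where "r h = K2.pairing (\<phi> \<epsilon>) (\<phi> (h \<epsilon>))" for h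
  have q: "q > 0"
  proof -
    \<comment> \<open>Otherwise all conjugate logarithms vanish, although there are several and they
      are distinct.\<close>
    have "K1.l \<epsilon> \<noteq> 0"
    proof
      assume 0: "K1.l \<epsilon> = 0"
      have "card (K1.G - {id}) > 0" using deg K1.id_G K1.finite_G by (simp add: card_Diff_singleton)
      then obtain g where g: "g \<in> K1.G" "g \<noteq> id" by (metis DiffE card_gt_0_iff ex_in_conv singletonI)
      have "K1.l (g \<epsilon>) = K1.l (id \<epsilon>)" using K1.l_eq_0_conj[OF \<epsilon> 0 g(1)] 0 by simp
      then show False using inj_onD[OF inj _ g(1) K1.id_G] g(2) by simp
    qed
    then show ?thesis unfolding q_def by (intro K2.pairing_pos \<phi>_U \<phi>_nonzero \<epsilon>)
  qed
  \<comment> \<open>The constants q and r h do not depend on \<xi>; this is the proportionality that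
    the test vectors below refute.\<close>
  have main: "(\<Sum>g\<in>K1.G. \<xi> g * \<xi> (g \<circ> h)) * q = (\<Sum>g\<in>K1.G. \<xi> g * \<xi> g) * r h"
    if h: "h \<in> K1.G" and \<xi>: "(\<Sum>g\<in>K1.G. \<xi> g) = 0" for \<xi> :: "('k1 \<Rightarrow> 'k1) \<Rightarrow> real" and h
  proof -
    define f where "f b = (if b \<in> A then \<xi> (inv_into K1.G (\<lambda>g. K1.l (g \<epsilon>)) b) else b)" for b
    obtain \<psi> where lin: "Vector_Spaces.linear rat_scale rat_scale \<psi>" and \<psi>: "\<forall>b\<in>A \<union> B. \<psi> b = f b"
      using rat_vs_pair.linear_independent_extend[OF ind, of f] by blast
    interpret \<psi>: Vector_Spaces.linear rat_scale rat_scale \<psi> by (rule lin)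
    have \<psi>_V2: "\<psi> v = v" if "v \<in> V2" for v
    proof -
      have "v \<in> rat_vs.span B" using that spanB by simp
      then show ?thesis
      proof (induction rule: rat_vs.span_induct_alt)
        case base
        show ?case by (rule \<psi>.zero)
      next
        case (step c b y)
        have "b \<notin> A" using step disj by blast
        then have "\<psi> b = b" using \<psi> step by (simp add: f_def)
        then show ?case using step by (simp add: \<psi>.add \<psi>.scale)
      qed
    qed
    have \<psi>1: "\<psi> (K1.l (g \<epsilon>)) = \<xi> g" if "g \<in> K1.G - {id}" for g
    proof -
      have "K1.l (g \<epsilon>) \<in> A" using that by (auto simp: A_def)
      then show ?thesis using \<psi> that by (simp add: f_def inv_into_f_f[OF inj])
    qed
    have \<psi>_\<xi>: "\<psi> (K1.l (g \<epsilon>)) = \<xi> g" if g: "g \<in> K1.G" for g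
    proof (cases "g = id")
      case True
      \<comment> \<open>The identity conjugate was left out of \<open>A\<close>. Its image is forced
        by the relation that all conjugate logarithms sum to zero, which is why \<xi> must have sum
        zero.\<close>
      have "\<psi> (\<Sum>g\<in>K1.G. K1.l (g \<epsilon>)) = 0" by (simp add: K1.sum_l_eq_0[OF \<epsilon>] \<psi>.zero)
      then have "\<psi> (K1.l (id \<epsilon>)) + (\<Sum>g\<in>K1.G - {id}. \<psi> (K1.l (g \<epsilon>))) = 0"
        by (simp only: \<psi>.add \<psi>.sum sum.remove[OF K1.finite_G K1.id_G])
      moreover have "\<xi> id + (\<Sum>g\<in>K1.G - {id}. \<xi> g) = 0"
        using \<xi> by (simp only: sum.remove[OF K1.finite_G K1.id_G])
      moreover have "(\<Sum>g\<in>K1.G - {id}. \<psi> (K1.l (g \<epsilon>))) = (\<Sum>g\<in>K1.G - {id}. \<xi> g)"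
        by (rule sum.cong) (simp_all only: \<psi>1)
      ultimately show ?thesis using True by simp
    qed (use \<psi>1 g in simp)
    have h\<epsilon>: "h \<epsilon> \<in> K1.U" by (rule K1.U_G[OF \<epsilon> h])
    have "pairing1 \<psi> \<epsilon> (h \<epsilon>) * q = pairing1 \<psi> \<epsilon> \<epsilon> * r h"
      using pairing_transfer[OF lin \<epsilon> h\<epsilon> \<epsilon> \<epsilon>] \<phi>_U[OF \<epsilon>] \<phi>_U[OF h\<epsilon>]
      by (simp add: q_def r_def pairing2_eq[OF \<psi>_V2])
    moreover have "pairing1 \<psi> \<epsilon> \<epsilon> = (\<Sum>g\<in>K1.G. \<xi> g * \<xi> g)"
      unfolding pairing1_def by (rule sum.cong) (simp_all add: \<psi>_\<xi>)
    moreover have "pairing1 \<psi> \<epsilon> (h \<epsilon>) = (\<Sum>g\<in>K1.G. \<xi> g * \<xi> (g \<circ> h))"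
      unfolding pairing1_def
    proof (rule sum.cong)
      fix g assume g: "g \<in> K1.G"
      show "\<psi> (K1.l (g \<epsilon>)) * \<psi> (K1.l (g (h \<epsilon>))) = \<xi> g * \<xi> (g \<circ> h)"
        using \<psi>_\<xi>[OF g] \<psi>_\<xi>[OF K1.comp_G[OF g h]] by simp
    qed simp
    ultimately show ?thesis by simp
  qed
  \<comment> \<open>Test vectors with 1 at the identity and -1 at k: the sum of squares is 2, and
    the correlation at h reduces to a difference of two values.\<close>
  define \<xi> :: "('k1 \<Rightarrow> 'k1) \<Rightarrow> ('k1 \<Rightarrow> 'k1) \<Rightarrow> real"
    where "\<xi> k g = (if g = id then 1 else if g = k then - 1 else 0)" for k g
  have two: "(\<Sum>g\<in>K1.G. \<xi> k g * F g) = F id - F k" if k: "k \<in> K1.G" "k \<noteq> id" for k F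
  proof -
    have "(\<Sum>g\<in>K1.G. \<xi> k g * F g) = (\<Sum>g\<in>{id, k}. \<xi> k g * F g)"
      using k K1.finite_G K1.id_G by (intro sum.mono_neutral_right) (auto simp: \<xi>_def)
    then show ?thesis using k by (simp add: \<xi>_def)
  qed
  have val: "(\<xi> k h - \<xi> k (k \<circ> h)) * q = 2 * r h" if k: "k \<in> K1.G" "k \<noteq> id" and h: "h \<in> K1.G" for k h
  proof -
    have "(\<Sum>g\<in>K1.G. \<xi> k g) = 0" using two[OF k, of "\<lambda>_. 1"] by simp
    from main[OF h this] show ?thesis using k by (simp add: two[OF k]) (simp add: \<xi>_def)
  qed
  have "card (K1.G - {id}) > 0" using deg K1.id_G K1.finite_G by (simp add: card_Diff_singleton)
  then obtain h where h: "h \<in> K1.G" "h \<noteq> id" by (metis DiffE card_gt_0_iff ex_in_conv singletonI)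
  \<comment> \<open>The degree bound enters here. For k outside this set, neither h nor k h lies in
    {id, k}, so the correlation vanishes and r h = 0.\<close>
  have "\<not> K1.G \<subseteq> {id, h, inv h}"
  proof
    assume "K1.G \<subseteq> {id, h, inv h}"
    then have "card K1.G \<le> card {id, h, inv h}" by (rule card_mono[rotated]) simp
    also have "\<dots> \<le> 3" by (simp add: card_insert_if)
    finally show False using deg by simp
  qed
  then obtain k where k: "k \<in> K1.G" "k \<noteq> id" "k \<noteq> h" "k \<noteq> inv h" by blast
  have cancel: "k \<circ> h \<noteq> k" if "k \<in> K1.G" for k
  proof
    assume "k \<circ> h = k"
    then have "(inv k \<circ> k) \<circ> h = inv k \<circ> k" by (simp add: comp_assoc)
    then show False using K1.inv_comp_G(1)[OF that] h(2) by simp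
  qed
  have "k \<circ> h \<noteq> id"
  proof
    assume "k \<circ> h = id"
    then have "k \<circ> (h \<circ> inv h) = inv h" by (simp flip: comp_assoc)
    then show False using K1.inv_comp_G(2)[OF h(1)] k(4) by simp
  qed
  then have "\<xi> k h - \<xi> k (k \<circ> h) = 0" using k h cancel[OF k(1)] by (simp add: \<xi>_def)
  then have "r h = 0" using val[OF k(1,2) h(1)] by simp
  \<comment> \<open>Taking k = h instead, the difference is -1 minus a value that is 1 or 0, which
    is never zero.\<close>
  then have "\<xi> h h - \<xi> h (h \<circ> h) = 0" using val[OF h h(1)] q by simp
  then show False using h cancel[OF h(1)] by (simp add: \<xi>_def split: if_splits)
qed

lemma range_subset: "range s1 \<subseteq> range s2"
proof -
  have V: "K1.l u \<in> V2" if u: "u \<in> K1.U" for u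
  proof (rule ccontr)
    assume "K1.l u \<notin> V2"
    then have "K1.l x = 0" if "x \<in> K1.U" "K1.l x \<in> V2" for x
      using proper_intersection_impossible[OF that(1) _ that(2) u] by blast
    then show False by (rule trivial_intersection_impossible)
  qed
  obtain \<epsilon> where mink: "K1.is_minkowski_unit \<epsilon>"
    by (rule K1.ex_minkowski_unit)
  note \<epsilon> = K1.is_minkowski_unit_U[OF mink]
  obtain m :: nat and v where m: "m > 0" "v \<in> K2.U" "s1 (\<epsilon> ^ m) = s2 v"
    by (rule common_power[OF \<epsilon> V[OF \<epsilon>]])
  \<comment> \<open>Passing to a power only multiplies the distinct logarithms of the conjugates by
    m, so the power is still a primitive element.\<close>
  have "inj_on (\<lambda>g. g (\<epsilon> ^ m)) K1.G"
  proof (rule inj_onI)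
    fix g h assume gh: "g \<in> K1.G" "h \<in> K1.G" "g (\<epsilon> ^ m) = h (\<epsilon> ^ m)"
    then have "K1.l ((g \<epsilon>) ^ m) = K1.l ((h \<epsilon>) ^ m)"
      by (simp add: field_hom_power[OF K1.G_hom])
    then have "K1.l (g \<epsilon>) = K1.l (h \<epsilon>)" using m(1) gh \<epsilon> by (simp add: K1.l_power K1.U_G)
    moreover have "inj_on (\<lambda>g. K1.l (g \<epsilon>)) K1.G"
      by (rule K1.l_minkowski_inj[OF mink])
    ultimately show "g = h" using gh by (auto dest: inj_onD)
  qed
  note span = K1.powers_span[OF this]
  have "s1 x \<in> range s2" for x
  proof -
    have "x \<in> rat_vs.span ((\<lambda>i. (\<epsilon> ^ m) ^ i) ` {..<card K1.G})" by (simp only: span UNIV_I)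
    then show ?thesis
    proof (induction rule: rat_vs.span_induct_alt)
      case base
      show ?case using field_hom_0[OF K1.hom_s] field_hom_0[OF K2.hom_s] by (metis rangeI)
    next
      case (step c b y)
      then obtain i y' where i: "b = (\<epsilon> ^ m) ^ i" and y': "s1 y = s2 y'" by auto
      have "s1 (rat_scale c b + y) = s2 (of_rat c * v ^ i + y')"
        by (simp only: rat_scale_def field_hom_add[OF K1.hom_s] field_hom_add[OF K2.hom_s]
            field_hom_mult[OF K1.hom_s] field_hom_mult[OF K2.hom_s] field_hom_of_rat[OF K1.hom_s]
            field_hom_of_rat[OF K2.hom_s] i field_hom_power[OF K1.hom_s, of "\<epsilon> ^ m"] m(3)
            field_hom_power[OF K2.hom_s] y')
      then show ?case by blast
    qed
  qed
  then show ?thesis by blast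
qed

end

section \<open>Discrete subgroups\<close>

text \<open>The new vector z has the least positive coordinate along x modulo span S. The minimum
  exists because subtracting integer combinations of S moves representatives into a fixed ball,
  where \<open>L\<close> is finite.\<close>

lemma int_span_extend:
  fixes L :: "'v::real_normed_vector set"
  assumes zero: "0 \<in> L" and diff: "\<And>x y. x \<in> L \<Longrightarrow> y \<in> L \<Longrightarrow> x - y \<in> L"
    and fin: "\<And>R. finite (L \<inter> cball 0 R)"
    and S: "finite S" "L \<inter> span S = {\<Sum>v\<in>S. of_int (c v) *\<^sub>R v | c. True}"
    and x: "x \<in> L" "x \<notin> span S"
  obtains z where "z \<notin> span S" "L \<inter> span (insert z S) = {\<Sum>v\<in>insert z S. of_int (c v) *\<^sub>R v | c. True}"
proof -
  have neg: "- a \<in> L" if "a \<in> L" for a using diff[OF zero that] by simp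
  have add: "a + b \<in> L" if "a \<in> L" "b \<in> L" for a b using diff[OF that(1) neg[OF that(2)]] by simp
  have nat_scale: "real n *\<^sub>R a \<in> L" if "a \<in> L" for n a
    using that zero by (induction n) (auto simp: scaleR_add_left add)
  have int_scale: "of_int k *\<^sub>R a \<in> L" if a: "a \<in> L" for k a
  proof (cases k rule: int_cases2)
    case (nonneg n)
    then show ?thesis using nat_scale[OF a] by simp
  next
    case (nonpos n)
    then show ?thesis using neg[OF nat_scale[OF a, of n]] by simp
  qed
  define T where "T = {t. \<exists>y\<in>L. y - t *\<^sub>R x \<in> span S}"
  \<comment> \<open>Bounds t x plus a combination of S with fractional parts as coefficients, for t
    between 0 and 1.\<close>
  define R where "R = norm x + (\<Sum>v\<in>S. norm v)"
  have unique: "t = t'" if "y - t *\<^sub>R x \<in> span S" "y - t' *\<^sub>R x \<in> span S" for y t t'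
  proof (rule ccontr)
    assume "t \<noteq> t'"
    have "(y - t' *\<^sub>R x) - (y - t *\<^sub>R x) \<in> span S" by (rule span_diff[OF that(2,1)])
    then have "(t - t') *\<^sub>R x \<in> span S" by (simp add: algebra_simps)
    then have "(1 / (t - t')) *\<^sub>R ((t - t') *\<^sub>R x) \<in> span S" by (rule span_scale)
    then show False using x(2) \<open>t \<noteq> t'\<close> by simp
  qed
  have bounded_rep: "\<exists>y\<in>L \<inter> cball 0 R. y - t *\<^sub>R x \<in> span S" if t: "t \<in> T" "0 \<le> t" "t \<le> 1" for t
  proof -
    obtain y where y: "y \<in> L" "y - t *\<^sub>R x \<in> span S" using t by (auto simp: T_def)
    then obtain r where r: "y - t *\<^sub>R x = (\<Sum>v\<in>S. r v *\<^sub>R v)"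
      using span_finite[OF S(1)] by auto
    define w where "w = (\<Sum>v\<in>S. of_int \<lfloor>r v\<rfloor> *\<^sub>R v)"
    have w: "w \<in> L \<inter> span S" unfolding S(2) w_def by (rule CollectI, rule exI[of _ "\<lambda>v. \<lfloor>r v\<rfloor>"]) simp
    have eq: "(y - w) = t *\<^sub>R x + (\<Sum>v\<in>S. frac (r v) *\<^sub>R v)"
    proof -
      have "(\<Sum>v\<in>S. frac (r v) *\<^sub>R v) = (\<Sum>v\<in>S. r v *\<^sub>R v) - w"
        by (simp add: w_def frac_def scaleR_diff_left sum_subtractf)
      then show ?thesis using r by (simp add: algebra_simps)
    qed
    have "norm (y - w) \<le> norm (t *\<^sub>R x) + norm (\<Sum>v\<in>S. frac (r v) *\<^sub>R v)"
      unfolding eq by (rule norm_triangle_ineq)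
    also have "norm (t *\<^sub>R x) \<le> norm x" using t by (simp add: mult_left_le_one_le)
    also have "norm (\<Sum>v\<in>S. frac (r v) *\<^sub>R v) \<le> (\<Sum>v\<in>S. norm v)"
    proof (rule sum_norm_le)
      fix v
      show "norm (frac (r v) *\<^sub>R v) \<le> norm v"
        using frac_ge_0[of "r v"] frac_lt_1[of "r v"] by (simp add: mult_left_le_one_le less_imp_le)
    qed
    finally have "norm (y - w) \<le> R" by (simp add: R_def)
    moreover have "y - w \<in> L" using diff y w by blast
    moreover have "(y - w) - t *\<^sub>R x \<in> span S"
      using span_diff[OF y(2), of w] w by (simp add: algebra_simps)
    ultimately show ?thesis by auto
  qed
  define T' where "T' = {t \<in> T. 0 < t \<and> t \<le> 1}"
  have "finite T'"
  proof -
    define f where "f y = (THE t. y - t *\<^sub>R x \<in> span S)" for y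
    have "T' \<subseteq> f ` (L \<inter> cball 0 R)"
    proof
      fix t assume "t \<in> T'"
      then obtain y where y: "y \<in> L \<inter> cball 0 R" "y - t *\<^sub>R x \<in> span S"
        using bounded_rep[of t] by (auto simp: T'_def)
      then have "f y = t" unfolding f_def using unique by blast
      then show "t \<in> f ` (L \<inter> cball 0 R)" using y by blast
    qed
    then show ?thesis by (rule finite_surj[OF fin])
  qed
  moreover have "1 \<in> T'"
    using x(1) span_0 by (auto simp: T'_def T_def intro!: bexI[of _ x])
  ultimately have "Min T' \<in> T'" "\<And>t. t \<in> T' \<Longrightarrow> Min T' \<le> t" by (auto intro: Min_in)
  then obtain t0 where t0: "t0 \<in> T" "0 < t0" "t0 \<le> 1" "\<And>t. t \<in> T \<Longrightarrow> 0 < t \<Longrightarrow> t \<le> 1 \<Longrightarrow> t0 \<le> t"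
    unfolding T'_def by blast
  obtain z where z: "z \<in> L" "z - t0 *\<^sub>R x \<in> span S" using t0(1) by (auto simp: T_def)
  have z_notin: "z \<notin> span S"
  proof
    assume "z \<in> span S"
    then have "z - 0 *\<^sub>R x \<in> span S" by simp
    then show False using unique[OF z(2)] t0(2) by fastforce
  qed
  then have zS: "z \<notin> S" using span_base by blast
  have "L \<inter> span (insert z S) = {\<Sum>v\<in>insert z S. of_int (c v) *\<^sub>R v | c. True}"
  proof (intro equalityI subsetI)
    fix y assume "y \<in> L \<inter> span (insert z S)"
    then obtain k where y: "y \<in> L" "y - k *\<^sub>R z \<in> span S" by (auto simp: span_breakdown_eq)
    define y' where "y' = y - of_int \<lfloor>k\<rfloor> *\<^sub>R z"
    have y': "y' \<in> L" unfolding y'_def by (rule diff[OF y(1) int_scale[OF z(1)]])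
    have yf: "y' - frac k *\<^sub>R z \<in> span S" using y(2) by (simp add: y'_def frac_def algebra_simps)
    \<comment> \<open>After removing floor k copies of z, the remainder has coordinate frac k times
      t0, which is below t0; minimality forces it to be zero.\<close>
    have "(y' - frac k *\<^sub>R z) + frac k *\<^sub>R (z - t0 *\<^sub>R x) \<in> span S"
      using yf z(2) by (intro span_add span_scale)
    then have "y' - (frac k * t0) *\<^sub>R x \<in> span S" by (simp add: algebra_simps)
    then have "frac k * t0 \<in> T" using y' by (auto simp: T_def)
    moreover have "frac k * t0 < t0" using t0(2) frac_lt_1[of k] by simp
    ultimately have "\<not> 0 < frac k * t0" using t0(3,4) by fastforce
    then have "frac k = 0" using t0(2) frac_ge_0[of k] by (auto simp: zero_less_mult_iff)
    then have "y' - 0 *\<^sub>R z \<in> span S" using yf by (simp only:)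
    then have "y' \<in> L \<inter> span S" using y' by simp
    then obtain c where c: "y' = (\<Sum>v\<in>S. of_int (c v) *\<^sub>R v)" unfolding S(2) by blast
    have "y = (\<Sum>v\<in>insert z S. of_int ((c(z := \<lfloor>k\<rfloor>)) v) *\<^sub>R v)"
    proof -
      have "(\<Sum>v\<in>S. of_int ((c(z := \<lfloor>k\<rfloor>)) v) *\<^sub>R v) = y'"
        unfolding c using zS by (intro sum.cong) auto
      then show ?thesis using S(1) zS by (simp add: y'_def)
    qed
    then show "y \<in> {\<Sum>v\<in>insert z S. of_int (c v) *\<^sub>R v | c. True}" by blast
  next
    fix y assume "y \<in> {\<Sum>v\<in>insert z S. of_int (c v) *\<^sub>R v | c. True}"
    then obtain c where y: "y = (\<Sum>v\<in>insert z S. of_int (c v) *\<^sub>R v)" by blast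
    have "(\<Sum>v\<in>S. of_int (c v) *\<^sub>R v) \<in> L \<inter> span S" unfolding S(2) by blast
    then have "(\<Sum>v\<in>S. of_int (c v) *\<^sub>R v) \<in> L" by blast
    then have "y \<in> L" using S(1) zS y by (simp add: add int_scale z(1))
    moreover have "y \<in> span (insert z S)" unfolding y by (intro span_sum span_scale span_base)
    ultimately show "y \<in> L \<inter> span (insert z S)" by simp
  qed
  with z_notin show thesis by (rule that)
qed

text \<open>Among independent sets that generate the part of \<open>L\<close> in their span, take
  one of maximal size, which the dimension bounds. If \<open>L\<close> left its span,
  \<open>int_span_extend\<close> would enlarge it.\<close>

lemma discrete_subgroup_lattice_basis:
  fixes L :: "'v::euclidean_space set"
  assumes zero: "0 \<in> L" and diff: "\<And>x y. x \<in> L \<Longrightarrow> y \<in> L \<Longrightarrow> x - y \<in> L"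
    and fin: "\<And>R. finite (L \<inter> cball 0 R)"
  obtains B where "lattice_basis B L"
proof -
  define P where "P S \<longleftrightarrow> finite S \<and> independent S \<and>
    L \<inter> span S = {\<Sum>v\<in>S. of_int (c v) *\<^sub>R v | c. True}" for S
  have P0: "P {}" using zero by (auto simp: P_def independent_empty)
  have bound: "\<forall>S. P S \<longrightarrow> card S < Suc (DIM('v))" using independent_bound by (auto simp: P_def less_Suc_eq_le)
  obtain S where S: "P S" "\<And>S'. P S' \<Longrightarrow> card S' \<le> card S"
    using ex_has_greatest_nat[of P "{}" card, OF P0 bound] by blast
  then have S': "finite S" "independent S" "L \<inter> span S = {\<Sum>v\<in>S. of_int (c v) *\<^sub>R v | c. True}"
    by (auto simp: P_def)
  have "L \<subseteq> span S"
  proof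
    fix x assume x: "x \<in> L"
    show "x \<in> span S"
    proof (rule ccontr)
      assume x': "x \<notin> span S"
      obtain z where z: "z \<notin> span S"
        "L \<inter> span (insert z S) = {\<Sum>v\<in>insert z S. of_int (c v) *\<^sub>R v | c. True}"
        by (rule int_span_extend[OF zero diff fin S'(1,3) x x'])
      have "P (insert z S)" unfolding P_def using z S' by (intro conjI independent_insertI) auto
      moreover have "z \<notin> S" using z(1) span_base by blast
      ultimately show False using S(2)[of "insert z S"] S'(1) by simp
    qed
  qed
  then have L: "L = {\<Sum>v\<in>S. of_int (c v) *\<^sub>R v | c. True}" using S'(3) by blast
  obtain B where B: "set B = S" "distinct B" using finite_distinct_list[OF S'(1)] by blast
  have bij: "bij_betw (\<lambda>i. B ! i) {..<length B} S"
    using bij_betw_nth[OF B(2) refl B(1)[symmetric]] .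
  have "L = {(\<Sum>i<length B. real_of_int (c i) *\<^sub>R B ! i) | c :: nat \<Rightarrow> int. True}"
  proof (intro equalityI subsetI)
    fix y assume "y \<in> L"
    then obtain c where "y = (\<Sum>v\<in>S. of_int (c v) *\<^sub>R v)" unfolding L by blast
    then have "y = (\<Sum>i<length B. real_of_int (c (B ! i)) *\<^sub>R B ! i)"
      using sum.reindex_bij_betw[OF bij, of "\<lambda>v. of_int (c v) *\<^sub>R v"] by simp
    then show "y \<in> {(\<Sum>i<length B. real_of_int (c i) *\<^sub>R B ! i) | c :: nat \<Rightarrow> int. True}"
      by (intro CollectI exI[of _ "\<lambda>i. c (B ! i)"]) simp
  next
    fix y assume "y \<in> {(\<Sum>i<length B. real_of_int (c i) *\<^sub>R B ! i) | c :: nat \<Rightarrow> int. True}"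
    then obtain c :: "nat \<Rightarrow> int" where y: "y = (\<Sum>i<length B. real_of_int (c i) *\<^sub>R B ! i)" by blast
    define d where "d v = c (inv_into {..<length B} (\<lambda>i. B ! i) v)" for v
    have "d (B ! i) = c i" if "i < length B" for i
      using that bij by (simp add: d_def bij_betw_def inv_into_f_f)
    then have "y = (\<Sum>v\<in>S. of_int (d v) *\<^sub>R v)"
      using sum.reindex_bij_betw[OF bij, of "\<lambda>v. of_int (d v) *\<^sub>R v"] by (simp add: y)
    then show "y \<in> L" unfolding L by blast
  qed
  then have "lattice_basis B L" using B S'(2) by (simp add: lattice_basis_def)
  then show thesis by (rule that)
qed

section \<open>The log unit lattice\<close>

text \<open>Multiplication by X - a raises a common bound on the coefficients by a factor of at most
  1 + |a|.\<close>

lemma coeff_prod_linear_bound: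
  fixes a :: "'i \<Rightarrow> real"
  shows "\<bar>coeff (\<Prod>i\<in>I. [:- a i, 1:]) k\<bar> \<le> (\<Prod>i\<in>I. 1 + \<bar>a i\<bar>)"
proof (induction I arbitrary: k rule: infinite_finite_induct)
  case (insert i I)
  let ?q = "\<Prod>i\<in>I. [:- a i, 1:]" and ?M = "\<Prod>i\<in>I. 1 + \<bar>a i\<bar>"
  have "coeff (\<Prod>i\<in>insert i I. [:- a i, 1:]) k =
    - a i * coeff ?q k + (case k of 0 \<Rightarrow> 0 | Suc j \<Rightarrow> coeff ?q j)"
    using insert.hyps by (simp add: coeff_pCons split: nat.split)
  also have "\<bar>\<dots>\<bar> \<le> \<bar>a i\<bar> * \<bar>coeff ?q k\<bar> + \<bar>case k of 0 \<Rightarrow> 0 | Suc j \<Rightarrow> coeff ?q j\<bar>"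
    by (rule order.trans[OF abs_triangle_ineq]) (simp add: abs_mult)
  also have "\<dots> \<le> \<bar>a i\<bar> * ?M + ?M"
  proof (intro add_mono mult_left_mono insert.IH)
    show "\<bar>case k of 0 \<Rightarrow> 0 | Suc j \<Rightarrow> coeff ?q j\<bar> \<le> ?M"
      using insert.IH by (auto split: nat.split intro: prod_nonneg)
  qed simp
  also have "\<dots> = (\<Prod>i\<in>insert i I. 1 + \<bar>a i\<bar>)" using insert.hyps by (simp add: algebra_simps)
  finally show ?case .
qed (auto simp: coeff_1)

lemma finite_int_polys_bounded: "finite {q :: int poly. degree q \<le> n \<and> (\<forall>i. \<bar>coeff q i\<bar> \<le> M)}"
  (is "finite ?P")
proof (rule finite_imageD)
  let ?f = "\<lambda>q. restrict (coeff q) {..n}"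
  have "?f ` ?P \<subseteq> ({..n} \<rightarrow>\<^sub>E {-M..M})"
  proof (rule image_subsetI)
    fix q assume "q \<in> ?P"
    then have "coeff q i \<in> {-M..M}" for i by (auto simp: abs_le_iff minus_le_iff)
    then show "?f q \<in> ({..n} \<rightarrow>\<^sub>E {-M..M})" by simp
  qed
  then show "finite (?f ` ?P)" by (rule finite_subset) (auto intro: finite_PiE)
  show "inj_on ?f ?P"
  proof (rule inj_onI)
    fix p q assume p: "p \<in> ?P" and q: "q \<in> ?P" and eq: "?f p = ?f q"
    show "p = q"
    proof (rule poly_eqI)
      fix i
      show "coeff p i = coeff q i"
      proof (cases "i \<le> n")
        case True
        then show ?thesis using fun_cong[OF eq, of i] by simp
      next
        case False
        then show ?thesis using p q by (simp add: coeff_eq_0)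
      qed
    qed
  qed
qed

text \<open>Upper bounds on the logarithms bound all conjugates and hence the integer coefficients
  of \<open>conj_poly u\<close>, leaving finitely many polynomials, each with finitely many
  roots.\<close>

lemma (in real_galois) finite_bounded_units: "finite {u \<in> U. \<forall>g\<in>G. l (g u) \<le> R}"
proof -
  define M where "M = \<lfloor>\<Prod>g\<in>G. 1 + exp R\<rfloor>"
  define P where "P = {q :: int poly. degree q \<le> card G \<and> (\<forall>i. \<bar>coeff q i\<bar> \<le> M)}"
  have "{u \<in> U. \<forall>g\<in>G. l (g u) \<le> R} \<subseteq> (\<Union>q\<in>P - {0}. {u. poly (map_poly of_int q) u = 0})"
  proof
    fix u assume u: "u \<in> {u \<in> U. \<forall>g\<in>G. l (g u) \<le> R}"
    then have int: "algebraic_int u" by (auto simp: integer_units_def)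
    \<comment> \<open>The coefficients are integers inside the field; \<open>s\<close> followed by
      the floor reads them off exactly.\<close>
    define q where "q = map_poly (\<lambda>x. \<lfloor>s x\<rfloor>) (conj_poly u)"
    have coeff_q: "of_int (coeff q i) = coeff (conj_poly u) i" for i
    proof -
      obtain z where "coeff (conj_poly u) i = of_int z"
        using coeff_conj_poly_Ints[OF int, of i] by (auto elim: Ints_cases)
      then show ?thesis by (simp add: q_def coeff_map_poly field_hom_0[OF hom_s] field_hom_of_int[OF hom_s])
    qed
    then have q: "map_poly of_int q = conj_poly u" by (intro poly_eqI) (simp add: coeff_map_poly)
    have "degree q \<le> card G"
    proof (rule degree_le, intro allI impI)
      fix i assume i: "card G < i"
      have "degree (conj_poly u) \<le> (\<Sum>g\<in>G. degree [:- g u, 1:])"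
        unfolding conj_poly_def using degree_prod_sum_le[OF finite_G, of "\<lambda>g. [:- g u, 1:]"]
        by (simp add: o_def)
      then have "degree (conj_poly u) \<le> card G" by simp
      then have "(of_int (coeff q i) :: 'k) = 0" using i unfolding coeff_q by (intro coeff_eq_0) simp
      then show "coeff q i = 0" by simp
    qed
    moreover have "\<bar>coeff q i\<bar> \<le> M" for i
    proof -
      have "real_of_int (coeff q i) = s (coeff (conj_poly u) i)"
        by (simp add: field_hom_of_int[OF hom_s] flip: coeff_q)
      also have "\<dots> = coeff (map_poly s (conj_poly u)) i"
        by (simp add: coeff_map_poly field_hom_0[OF hom_s])
      also have "map_poly s (conj_poly u) = (\<Prod>g\<in>G. [:- s (g u), 1:])"
        by (simp add: conj_poly_def field_hom_map_poly_prod[OF hom_s] field_hom_map_poly_linear[OF hom_s])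
      finally have "\<bar>real_of_int (coeff q i)\<bar> \<le> (\<Prod>g\<in>G. 1 + \<bar>s (g u)\<bar>)"
        using coeff_prod_linear_bound[of "\<lambda>g. s (g u)" G i] by simp
      also have "\<dots> \<le> (\<Prod>g\<in>G. 1 + exp R)"
      proof (rule prod_mono)
        fix g assume g: "g \<in> G"
        have pos: "\<bar>s (g u)\<bar> > 0" using s_nonzero[OF U_G[of u g]] u g by simp
        have "l (g u) \<le> R" using u g by simp
        then have "exp (l (g u)) \<le> exp R" by simp
        then have "\<bar>s (g u)\<bar> \<le> exp R" using pos by (simp add: l_def)
        then show "0 \<le> 1 + \<bar>s (g u)\<bar> \<and> 1 + \<bar>s (g u)\<bar> \<le> 1 + exp R" by simp
      qed
      finally show ?thesis unfolding M_def by (simp add: le_floor_iff)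
    qed
    moreover have "q \<noteq> 0" using q conj_poly_neq_0[of u] by auto
    moreover have "poly (map_poly of_int q) u = 0" by (simp add: q poly_conj_poly_self)
    ultimately show "u \<in> (\<Union>q\<in>P - {0}. {u. poly (map_poly of_int q) u = 0})" by (auto simp: P_def)
  qed
  moreover have "finite (\<Union>q\<in>P - {0}. {u :: 'k. poly (map_poly of_int q) u = 0})"
  proof (rule finite_UN_I)
    show "finite (P - {0})" using finite_int_polys_bounded[of "card G" M] by (simp add: P_def)
    fix q assume "q \<in> P - {0}"
    then have "(map_poly of_int q :: 'k poly) \<noteq> 0" by (auto simp: poly_eq_iff coeff_map_poly)
    then show "finite {u :: 'k. poly (map_poly of_int q) u = 0}" by (rule poly_roots_finite)
  qed
  ultimately show ?thesis by (rule finite_subset)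
qed

section \<open>Log vectors and the discreteness of the lattice\<close>

definition log_vector :: "('n::finite \<Rightarrow> 'k::field_char_0 \<Rightarrow> complex) \<Rightarrow> 'k \<Rightarrow> real ^ 'n"
  where "log_vector \<sigma> u = (\<chi> i. ln (cmod (\<sigma> i u)))"

lemma log_unit_lattice_eq: "log_unit_lattice \<sigma> = log_vector \<sigma> ` integer_units"
  by (auto simp: log_unit_lattice_def log_vector_def)

text \<open>\<open>\<pi>\<close> matches the given enumeration of the embeddings with the Galois
  group, turning sums over coordinates into sums over G.\<close>

locale enumerated_embeddings = real_galois s
  for s :: "'k::field_char_0 \<Rightarrow> real" +
  fixes \<sigma> :: "'n::finite \<Rightarrow> 'k \<Rightarrow> complex" and \<pi> :: "'n \<Rightarrow> 'k \<Rightarrow> 'k"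
  assumes \<pi>: "bij_betw \<pi> UNIV field_auts" and \<sigma>_\<pi>: "\<sigma> i u = complex_of_real (s (\<pi> i u))"
begin

lemma \<pi>_G: "\<pi> i \<in> G"
  using \<pi> by (auto simp: bij_betw_def)

lemma log_vector_nth: "vec_nth (log_vector \<sigma> u) i = l (\<pi> i u)"
  by (simp add: log_vector_def \<sigma>_\<pi> l_def)

lemma inner_log_vector: "inner (log_vector \<sigma> u) (log_vector \<sigma> v) = pairing u v"
  using sum.reindex_bij_betw[OF \<pi>, of "\<lambda>g. l (g u) * l (g v)"]
  by (simp add: inner_vec_def log_vector_nth pairing_def)

lemma log_vector_eq_0_iff: assumes "u \<in> U" shows "log_vector \<sigma> u = 0 \<longleftrightarrow> l u = 0"
proof
  assume "log_vector \<sigma> u = 0"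
  then have "inner (log_vector \<sigma> u) (log_vector \<sigma> u) = 0" by simp
  then show "l u = 0" using pairing_pos[OF assms] by (auto simp: inner_log_vector)
next
  assume "l u = 0"
  then show "log_vector \<sigma> u = 0"
    using l_eq_0_conj[OF assms _ \<pi>_G] by (simp add: Finite_Cartesian_Product.vec_eq_iff log_vector_nth)
qed

lemma log_unit_lattice_basis:
  obtains B where "lattice_basis B (log_unit_lattice \<sigma>)"
proof -
  have "log_vector \<sigma> 1 = 0" using log_vector_eq_0_iff[OF integer_units_1] l_1 by simp
  then have zero: "0 \<in> log_unit_lattice \<sigma>"
    unfolding log_unit_lattice_eq using integer_units_1 by (metis imageI)
  have diff: "x - y \<in> log_unit_lattice \<sigma>" if xy: "x \<in> log_unit_lattice \<sigma>" "y \<in> log_unit_lattice \<sigma>" for x y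
  proof -
    obtain u v where uv: "u \<in> U" "v \<in> U" "x = log_vector \<sigma> u" "y = log_vector \<sigma> v"
      using xy by (auto simp: log_unit_lattice_eq)
    have "x - y = log_vector \<sigma> (u * inverse v)"
      using uv by (simp add: Finite_Cartesian_Product.vec_eq_iff log_vector_nth field_hom_mult[OF G_hom[OF \<pi>_G]]
          field_hom_inverse[OF G_hom[OF \<pi>_G]] l_mult l_inverse integer_units_inverse U_G[OF _ \<pi>_G])
    then show ?thesis
      unfolding log_unit_lattice_eq using uv integer_units_mult integer_units_inverse by blast
  qed
  have fin: "finite (log_unit_lattice \<sigma> \<inter> cball 0 R)" for R
  proof (rule finite_subset)
    show "log_unit_lattice \<sigma> \<inter> cball 0 R \<subseteq> log_vector \<sigma> ` {u \<in> U. \<forall>g\<in>G. l (g u) \<le> R}"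
    proof
      fix x assume x: "x \<in> log_unit_lattice \<sigma> \<inter> cball 0 R"
      then obtain u where u: "u \<in> U" "x = log_vector \<sigma> u" by (auto simp: log_unit_lattice_eq)
      have "l (g u) \<le> R" if g: "g \<in> G" for g
      proof -
        have "g \<in> range \<pi>" using \<pi> g by (simp add: bij_betw_def)
        then obtain i where "g = \<pi> i" by blast
        then have "l (g u) \<le> norm x"
          using component_le_norm_cart[of x i] by (simp add: u(2) log_vector_nth)
        then show ?thesis using x by simp
      qed
      then show "x \<in> log_vector \<sigma> ` {u \<in> U. \<forall>g\<in>G. l (g u) \<le> R}" using u by blast
    qed
    show "finite (log_vector \<sigma> ` {u \<in> U. \<forall>g\<in>G. l (g u) \<le> R})"
      by (intro finite_imageI finite_bounded_units)
  qed
  show thesis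
    by (rule discrete_subgroup_lattice_basis[of "log_unit_lattice \<sigma>"])
      (fact zero, erule (1) diff, rule fin, rule that)
qed

end

text \<open>Composing a base embedding with automorphisms gives |G| distinct embeddings; |G| is the
  degree, and there are at most that many embeddings, so all are reached.\<close>

lemma ex_enumerated_embeddings:
  fixes \<sigma> :: "'n::finite \<Rightarrow> 'k::field_char_0 \<Rightarrow> complex"
  assumes gal: "galois_number_field TYPE('k)" and real: "totally_real TYPE('k)"
    and bij: "bij_betw \<sigma> UNIV embeddings"
  obtains s \<pi> where "enumerated_embeddings s \<sigma> \<pi>"
proof -
  \<comment> \<open>Any embedding can be the base point, here the one at an unspecified index; its
    values are real, so taking real parts changes nothing.\<close>
  define s where "s x = Re (\<sigma> undefined x)" for x
  have emb: "\<sigma> undefined \<in> embeddings" using bij by (auto simp: bij_betw_def)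
  have s: "complex_of_real (s x) = \<sigma> undefined x" for x
  proof -
    have "\<sigma> undefined x \<in> \<real>" using real emb unfolding totally_real_def by blast
    then show ?thesis by (simp add: s_def)
  qed
  have hom0: "is_field_hom (\<sigma> undefined)" using emb by (simp add: embeddings_def)
  have "is_field_hom s" unfolding is_field_hom_def
  proof (intro conjI allI)
    show "s 1 = 1" by (simp add: s_def field_hom_1[OF hom0])
    show "s (x + y) = s x + s y" for x y by (simp add: s_def field_hom_add[OF hom0])
    show "s (x * y) = s x * s y" for x y
    proof -
      have "complex_of_real (s (x * y)) = complex_of_real (s x * s y)"
        by (simp add: s field_hom_mult[OF hom0])
      then show ?thesis by (simp only: of_real_eq_iff)
    qed
  qed
  then interpret real_galois s using gal by unfold_locales
  define E :: "('k \<Rightarrow> 'k) \<Rightarrow> 'k \<Rightarrow> complex" where "E g x = complex_of_real (s (g x))" for g x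
  have inj: "inj_on E G"
  proof (rule inj_onI, rule ext)
    fix g h x assume "E g = E h"
    then have "s (g x) = s (h x)" unfolding E_def by (metis of_real_eq_iff)
    then show "g x = h x" using field_hom_inj[OF hom_s] by (auto dest: injD)
  qed
  have fin: "finite (embeddings :: ('k \<Rightarrow> complex) set)" 
    using bij_betw_finite[OF bij] by simp
  have "E ` G = embeddings"
  proof (rule card_seteq[OF fin])
    show "E ` G \<subseteq> embeddings"
      using field_hom_comp[OF G_hom hom0]
      by (auto simp: embeddings_def E_def[abs_def] s o_def)
    have "card (embeddings :: ('k \<Rightarrow> complex) set) \<le> field_degree TYPE('k)"
      by (rule card_field_homs_le_degree[OF nf fin]) (simp add: embeddings_def)
    then show "card (embeddings :: ('k \<Rightarrow> complex) set) \<le> card (E ` G)"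
      by (simp add: card_image[OF inj] card_G)
  qed
  then have E: "bij_betw E G embeddings" using inj by (simp add: bij_betw_def)
  define \<pi> where "\<pi> = inv_into G E \<circ> \<sigma>"
  have "bij_betw \<pi> UNIV G"
    unfolding \<pi>_def by (rule bij_betw_trans[OF bij bij_betw_inv_into[OF E]])
  moreover have "\<sigma> i u = complex_of_real (s (\<pi> i u))" for i u
  proof -
    have "\<sigma> i \<in> embeddings" using bij by (auto simp: bij_betw_def)
    then have "E (\<pi> i) = \<sigma> i" unfolding \<pi>_def o_def by (rule bij_betw_inv_into_right[OF E])
    then show ?thesis by (metis E_def)
  qed
  ultimately have "enumerated_embeddings s \<sigma> \<pi>" by unfold_locales
  then show thesis by (rule that)
qed

section \<open>From a lattice similarity to an inclusion of fields\<close>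

lemma lattice_basis_combination_eq_0:
  assumes "lattice_basis B L" "(\<Sum>i<length B. c i *\<^sub>R B ! i) = 0" "i < length B"
  shows "c i = 0"
proof -
  have dist: "distinct B" and ind: "independent (set B)" using assms(1) by (auto simp: lattice_basis_def)
  have bij: "bij_betw (\<lambda>i. B ! i) {..<length B} (set B)" by (rule bij_betw_nth[OF dist refl refl])
  define f where "f v = c (inv_into {..<length B} (\<lambda>i. B ! i) v)" for v
  have f: "f (B ! j) = c j" if "j < length B" for j
    using that bij by (simp add: f_def bij_betw_def inv_into_f_f)
  have "(\<Sum>v\<in>set B. f v *\<^sub>R v) = 0"
    using sum.reindex_bij_betw[OF bij, of "\<lambda>v. f v *\<^sub>R v"] assms(2) f by simp
  then have "f (B ! i) = 0"
    using independentD[OF ind _ subset_refl, of f "B ! i"] assms(3) by simp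
  then show ?thesis using f[OF assms(3)] by simp
qed

lemma inner_combinations:
  "inner (\<Sum>i<length B. c i *\<^sub>R B ! i) (\<Sum>j<length B. d j *\<^sub>R B ! j) =
    (\<Sum>i<length B. \<Sum>j<length B. c i * d j * gram B i j)"
  by (simp add: inner_sum_left inner_sum_right gram_def sum_distrib_left mult_ac)
    (rule sum.swap)

text \<open>The map copies integer coordinates from one basis to the other. Factors on both sides
  allow the use with (1, r) and with (r, 1), so the similarity factor is never inverted.\<close>

lemma lattice_basis_map:
  assumes B1: "lattice_basis B1 L1" and B2: "lattice_basis B2 L2" and len: "length B1 = length B2"
    and gram: "\<And>i j. i < length B1 \<Longrightarrow> j < length B1 \<Longrightarrow> a * gram B1 i j = b * gram B2 i j"
  shows "\<exists>\<Phi>. (\<forall>x\<in>L1. \<Phi> x \<in> L2) \<and> (\<forall>x\<in>L1. \<Phi> x = 0 \<longrightarrow> x = 0) \<and>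
    (\<forall>x\<in>L1. \<forall>y\<in>L1. a * inner x y = b * inner (\<Phi> x) (\<Phi> y))"
proof -
  have "\<exists>c :: nat \<Rightarrow> int. x = (\<Sum>i<length B1. real_of_int (c i) *\<^sub>R B1 ! i)" if "x \<in> L1" for x
    using B1 that unfolding lattice_basis_def by blast
  then obtain C :: "_ \<Rightarrow> nat \<Rightarrow> int"
    where C: "\<And>x. x \<in> L1 \<Longrightarrow> x = (\<Sum>i<length B1. real_of_int (C x i) *\<^sub>R B1 ! i)"
    by metis
  define \<Phi> where "\<Phi> x = (\<Sum>i<length B2. real_of_int (C x i) *\<^sub>R B2 ! i)" for x
  show ?thesis
  proof (intro exI[of _ \<Phi>] conjI ballI impI)
    show "\<Phi> x \<in> L2" for x using B2 unfolding lattice_basis_def \<Phi>_def by blast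
    show "x = 0" if x: "x \<in> L1" and 0: "\<Phi> x = 0" for x
    proof -
      have "real_of_int (C x i) = 0" if "i < length B2" for i
        using lattice_basis_combination_eq_0[OF B2 0[unfolded \<Phi>_def] that] .
      then show ?thesis using C[OF x] by (simp add: len)
    qed
    show "a * inner x y = b * inner (\<Phi> x) (\<Phi> y)" if "x \<in> L1" "y \<in> L1" for x y
    proof -
      have "a * inner x y = a * inner (\<Sum>i<length B1. real_of_int (C x i) *\<^sub>R B1 ! i)
        (\<Sum>i<length B1. real_of_int (C y i) *\<^sub>R B1 ! i)"
        using C that by simp
      also have "\<dots> = (\<Sum>i<length B1. \<Sum>j<length B1. of_int (C x i) * of_int (C y j) * (a * gram B1 i j))"
        by (simp add: inner_combinations sum_distrib_left mult_ac)
      also have "\<dots> = (\<Sum>i<length B1. \<Sum>j<length B1. of_int (C x i) * of_int (C y j) * (b * gram B2 i j))"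
        using gram by (intro sum.cong) auto
      also have "\<dots> = b * inner (\<Phi> x) (\<Phi> y)"
        by (simp add: \<Phi>_def len inner_combinations sum_distrib_left mult_ac)
      finally show ?thesis .
    qed
  qed
qed

text \<open>A lattice vector determines a unit only up to sign; \<phi> chooses a representative of
  each image, and every choice has the same logarithms.\<close>

lemma range_subset_of_lattice_map:
  assumes wsc: weak_schanuel_conjecture
    and E1: "enumerated_embeddings (s1 :: 'k1::field_char_0 \<Rightarrow> real) \<sigma>1 \<pi>1"
    and E2: "enumerated_embeddings (s2 :: 'k2::field_char_0 \<Rightarrow> real) \<sigma>2 \<pi>2"
    and deg: "field_degree TYPE('k1) > 3"
    and \<Phi>: "\<And>x. x \<in> log_unit_lattice \<sigma>1 \<Longrightarrow> \<Phi> x \<in> log_unit_lattice \<sigma>2"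
      "\<And>x. x \<in> log_unit_lattice \<sigma>1 \<Longrightarrow> \<Phi> x = 0 \<Longrightarrow> x = 0"
      "\<And>x y z w. \<lbrakk>x \<in> log_unit_lattice \<sigma>1; y \<in> log_unit_lattice \<sigma>1; z \<in> log_unit_lattice \<sigma>1;
        w \<in> log_unit_lattice \<sigma>1\<rbrakk> \<Longrightarrow> inner x y * inner (\<Phi> z) (\<Phi> w) = inner z w * inner (\<Phi> x) (\<Phi> y)"
  shows "range s1 \<subseteq> range s2"
proof -
  interpret K1: enumerated_embeddings s1 \<sigma>1 \<pi>1 by (rule E1)
  interpret K2: enumerated_embeddings s2 \<sigma>2 \<pi>2 by (rule E2)
  have L1: "log_vector \<sigma>1 u \<in> log_unit_lattice \<sigma>1" if "u \<in> K1.U" for u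
    using that by (simp add: log_unit_lattice_eq)
  have "\<exists>v\<in>K2.U. log_vector \<sigma>2 v = \<Phi> (log_vector \<sigma>1 u)" if "u \<in> K1.U" for u
    using \<Phi>(1)[OF L1[OF that]] by (auto simp: log_unit_lattice_eq)
  then obtain \<phi> where \<phi>: "\<And>u. u \<in> K1.U \<Longrightarrow> \<phi> u \<in> K2.U"
    "\<And>u. u \<in> K1.U \<Longrightarrow> log_vector \<sigma>2 (\<phi> u) = \<Phi> (log_vector \<sigma>1 u)"
    by metis
  interpret similar_fields s1 s2 \<phi>
  proof
    show weak_schanuel_conjecture by (rule wsc)
    show "card K1.G > 3" using deg K1.card_G by simp
    show "\<phi> u \<in> K2.U" if "u \<in> K1.U" for u by (rule \<phi>(1)[OF that])
    show "K2.l (\<phi> u) \<noteq> 0" if u: "u \<in> K1.U" "K1.l u \<noteq> 0" for u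
      using K2.log_vector_eq_0_iff[OF \<phi>(1)[OF u(1)]] K1.log_vector_eq_0_iff[OF u(1)]
        \<Phi>(2)[OF L1[OF u(1)]] u(2) by (auto simp: \<phi>(2)[OF u(1)])
    show "K1.pairing x y * K2.pairing (\<phi> z) (\<phi> w) = K1.pairing z w * K2.pairing (\<phi> x) (\<phi> y)"
      if "x \<in> K1.U" "y \<in> K1.U" "z \<in> K1.U" "w \<in> K1.U" for x y z w
      using \<Phi>(3)[OF L1 L1 L1 L1, OF that] that
      by (simp add: \<phi>(2) flip: K1.inner_log_vector K2.inner_log_vector)
  qed
  show ?thesis by (rule range_subset)
qed

lemma fields_isomorphic_of_range_eq:
  assumes "is_field_hom (s1 :: 'k1::field_char_0 \<Rightarrow> real)" "is_field_hom (s2 :: 'k2::field_char_0 \<Rightarrow> real)"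
    and range: "range s1 = range s2"
  shows "fields_isomorphic TYPE('k1) TYPE('k2)"
proof -
  note inj1 = field_hom_inj[OF assms(1)] and inj2 = field_hom_inj[OF assms(2)]
  define f where "f x = inv s2 (s1 x)" for x
  have f: "s2 (f x) = s1 x" for x unfolding f_def using range by (metis f_inv_into_f rangeI)
  have "is_field_hom f" unfolding is_field_hom_def
  proof (intro conjI allI)
    show "f 1 = 1"
      by (rule injD[OF inj2]) (simp add: f field_hom_1[OF assms(1)] field_hom_1[OF assms(2)])
    show "f (x + y) = f x + f y" for x y
      by (rule injD[OF inj2]) (simp add: f field_hom_add[OF assms(1)] field_hom_add[OF assms(2)])
    show "f (x * y) = f x * f y" for x y
      by (rule injD[OF inj2]) (simp add: f field_hom_mult[OF assms(1)] field_hom_mult[OF assms(2)])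
  qed
  moreover have "bij f"
  proof (rule bijI)
    show "inj f" by (rule injI) (metis f injD[OF inj1])
    show "surj f"
    proof (rule surjI[of f "\<lambda>y. inv s1 (s2 y)"])
      fix y
      have "s1 (inv s1 (s2 y)) = s2 y" using range by (metis f_inv_into_f rangeI)
      then show "f (inv s1 (s2 y)) = y" using f injD[OF inj2] by metis
    qed
  qed
  ultimately show ?thesis unfolding fields_isomorphic_def is_field_iso_def by blast
qed

section \<open>From a field isomorphism to a lattice similarity\<close>

text \<open>Composition with the isomorphism matches the embeddings of the two fields, so the
  lattices differ by a relabelling of coordinates, which is an isometry; the similarity factor is
  1.\<close>

lemma lattice_similar_of_iso:
  fixes \<sigma>1 :: "'n1::finite \<Rightarrow> 'k1::field_char_0 \<Rightarrow> complex"
    and \<sigma>2 :: "'n2::finite \<Rightarrow> 'k2::field_char_0 \<Rightarrow> complex"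
  assumes bij1: "bij_betw \<sigma>1 UNIV embeddings" and bij2: "bij_betw \<sigma>2 UNIV embeddings"
    and basis: "lattice_basis B (log_unit_lattice \<sigma>1)" and f: "is_field_iso (f :: 'k1 \<Rightarrow> 'k2)"
  shows "lattice_similar (log_unit_lattice \<sigma>1) (log_unit_lattice \<sigma>2)"
proof -
  have hom: "is_field_hom f" and bijf: "bij f" using f by (auto simp: is_field_iso_def)
  have f_inv: "f (inv f y) = y" for y using bijf by (simp add: bij_is_surj surj_f_inv_f)
  have inv_f: "inv f (f x) = x" for x using bijf by (simp add: bij_is_inj)
  have hom_inv: "is_field_hom (inv f)" unfolding is_field_hom_def
  proof (intro conjI allI)
    show "inv f 1 = 1" using field_hom_1[OF hom] inv_f by metis
    show "inv f (x + y) = inv f x + inv f y" for x y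
      using field_hom_add[OF hom, of "inv f x" "inv f y"] by (metis f_inv inv_f)
    show "inv f (x * y) = inv f x * inv f y" for x y
      using field_hom_mult[OF hom, of "inv f x" "inv f y"] by (metis f_inv inv_f)
  qed
  define \<rho> where "\<rho> j = inv_into UNIV \<sigma>1 (\<sigma>2 j \<circ> f)" for j
  have \<sigma>_\<rho>: "\<sigma>1 (\<rho> j) u = \<sigma>2 j (f u)" for j u
  proof -
    have "\<sigma>2 j \<in> embeddings" using bij2 by (auto simp: bij_betw_def)
    then have "\<sigma>2 j \<circ> f \<in> embeddings" using field_hom_comp[OF hom] by (simp add: embeddings_def)
    then have "\<sigma>1 (\<rho> j) = \<sigma>2 j \<circ> f" unfolding \<rho>_def by (rule bij_betw_inv_into_right[OF bij1])
    then show ?thesis by simp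
  qed
  have bij\<rho>: "bij \<rho>"
  proof (rule bijI)
    show "inj \<rho>"
    proof (rule injI)
      fix i j assume "\<rho> i = \<rho> j"
      then have "\<sigma>2 i (f u) = \<sigma>2 j (f u)" for u by (simp flip: \<sigma>_\<rho>)
      then have "\<sigma>2 i = \<sigma>2 j" by (metis f_inv ext)
      then show "i = j" using bij2 by (auto simp: bij_betw_def dest: injD)
    qed
    show "surj \<rho>"
    proof (rule surjI)
      fix i
      have "\<sigma>1 i \<in> embeddings" using bij1 by (auto simp: bij_betw_def)
      then have "\<sigma>1 i \<circ> inv f \<in> embeddings" using field_hom_comp[OF hom_inv] by (simp add: embeddings_def)
      then have "\<sigma>2 (inv_into UNIV \<sigma>2 (\<sigma>1 i \<circ> inv f)) = \<sigma>1 i \<circ> inv f"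
        by (rule bij_betw_inv_into_right[OF bij2])
      then have "\<sigma>1 (\<rho> (inv_into UNIV \<sigma>2 (\<sigma>1 i \<circ> inv f))) = \<sigma>1 i"
        by (intro ext) (simp add: \<sigma>_\<rho> inv_f)
      then show "\<rho> (inv_into UNIV \<sigma>2 (\<sigma>1 i \<circ> inv f)) = i"
        using bij1 by (auto simp: bij_betw_def dest: injD)
    qed
  qed
  define T :: "real ^ 'n1 \<Rightarrow> real ^ 'n2" where "T x = (\<chi> j. vec_nth x (\<rho> j))" for x
  have linT: "linear T" by (rule linearI) (simp_all add: T_def Finite_Cartesian_Product.vec_eq_iff)
  have innerT: "inner (T x) (T y) = inner x y" for x y
    using sum.reindex_bij_betw[OF bij\<rho>, of "\<lambda>i. vec_nth x i * vec_nth y i"]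
    by (simp add: T_def inner_vec_def)
  have injT: "inj T"
    by (rule linear_injective_0[OF linT, THEN iffD2]) (metis innerT inner_eq_zero_iff)
  have T_log: "T (log_vector \<sigma>1 u) = log_vector \<sigma>2 (f u)" for u
    by (simp add: T_def log_vector_def Finite_Cartesian_Product.vec_eq_iff \<sigma>_\<rho>)
  have units: "f ` integer_units = integer_units"
  proof (intro equalityI subsetI)
    fix v :: 'k2 assume "v \<in> integer_units"
    then have "f (inv f v) \<in> f ` integer_units" by (intro imageI integer_units_hom[OF hom_inv])
    then show "v \<in> f ` integer_units" by (simp only: f_inv)
  qed (auto intro: integer_units_hom[OF hom])
  have lattice2: "log_unit_lattice \<sigma>2 = T ` log_unit_lattice \<sigma>1"
    unfolding log_unit_lattice_eq units[symmetric] image_image T_log ..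
  have B: "distinct B" "independent (set B)"
    "log_unit_lattice \<sigma>1 = {(\<Sum>i<length B. real_of_int (c i) *\<^sub>R B ! i) | c :: nat \<Rightarrow> int. True}"
    using basis by (simp_all add: lattice_basis_def)
  have T_comb: "T (\<Sum>i<length B. real_of_int (c i) *\<^sub>R B ! i) =
    (\<Sum>i<length (map T B). real_of_int (c i) *\<^sub>R map T B ! i)" for c
    by (simp add: linear_sum[OF linT] linear_scale[OF linT])
  have "lattice_basis (map T B) (log_unit_lattice \<sigma>2)"
    unfolding lattice_basis_def
  proof (intro conjI)
    show "distinct (map T B)" 
      using B(1) inj_on_subset[OF injT subset_UNIV] by (simp add: distinct_map)
    show "independent (set (map T B))"
      using linear_independent_injective_image[OF linT B(2) inj_on_subset[OF injT subset_UNIV]] by simp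
    show "log_unit_lattice \<sigma>2 =
      {(\<Sum>i<length (map T B). real_of_int (c i) *\<^sub>R map T B ! i) | c :: nat \<Rightarrow> int. True}"
      unfolding lattice2 B(3) T_comb[symmetric] by blast
  qed
  moreover have "gram B i j = 1 * gram (map T B) i j" if "i < length B" "j < length B" for i j
    using that by (simp add: gram_def innerT)
  ultimately show ?thesis
    unfolding lattice_similar_def using basis
    by (intro exI[of _ B] exI[of _ "map T B"] exI[of _ 1]) simp
qed

theorem theorem6p4:
  fixes \<sigma>1 :: "'n1::finite \<Rightarrow> 'k1::field_char_0 \<Rightarrow> complex"
    and \<sigma>2 :: "'n2::finite \<Rightarrow> 'k2::field_char_0 \<Rightarrow> complex"
  assumes "weak_schanuel_conjecture"
    and "galois_number_field TYPE('k1)" and "totally_real TYPE('k1)"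
    and "galois_number_field TYPE('k2)" and "totally_real TYPE('k2)"
    and "bij_betw \<sigma>1 UNIV embeddings"
    and "bij_betw \<sigma>2 UNIV embeddings"
    and "field_degree TYPE('k1) > 3"
    and "field_degree TYPE('k2) > 3"
  shows "lattice_similar (log_unit_lattice \<sigma>1) (log_unit_lattice \<sigma>2) \<longleftrightarrow>
    fields_isomorphic TYPE('k1) TYPE('k2)"
proof -
  obtain s1 \<pi>1 where E1: "enumerated_embeddings s1 \<sigma>1 \<pi>1"
    by (rule ex_enumerated_embeddings[OF assms(2,3,6)])
  obtain s2 \<pi>2 where E2: "enumerated_embeddings s2 \<sigma>2 \<pi>2"
    by (rule ex_enumerated_embeddings[OF assms(4,5,7)])
  interpret K1: enumerated_embeddings s1 \<sigma>1 \<pi>1 by (rule E1)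
  interpret K2: enumerated_embeddings s2 \<sigma>2 \<pi>2 by (rule E2)
  show ?thesis
  proof
    assume "lattice_similar (log_unit_lattice \<sigma>1) (log_unit_lattice \<sigma>2)"
    then obtain B1 B2 r where B: "lattice_basis B1 (log_unit_lattice \<sigma>1)"
      "lattice_basis B2 (log_unit_lattice \<sigma>2)" "length B1 = length B2"
      "\<And>i j. i < length B1 \<Longrightarrow> j < length B1 \<Longrightarrow> gram B1 i j = r * gram B2 i j"
      unfolding lattice_similar_def by blast
    have g12: "1 * gram B1 i j = r * gram B2 i j" if "i < length B1" "j < length B1" for i j
      using B(4)[OF that] by simp
    have g21: "r * gram B2 i j = 1 * gram B1 i j" if "i < length B2" "j < length B2" for i j
      using B(4)[of i j] that B(3) by simp
    obtain \<Phi> where \<Phi>: "\<forall>x\<in>log_unit_lattice \<sigma>1. \<Phi> x \<in> log_unit_lattice \<sigma>2"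
      "\<forall>x\<in>log_unit_lattice \<sigma>1. \<Phi> x = 0 \<longrightarrow> x = 0"
      "\<forall>x\<in>log_unit_lattice \<sigma>1. \<forall>y\<in>log_unit_lattice \<sigma>1. 1 * inner x y = r * inner (\<Phi> x) (\<Phi> y)"
      using lattice_basis_map[OF B(1-3) g12] by blast
    obtain \<Psi> where \<Psi>: "\<forall>x\<in>log_unit_lattice \<sigma>2. \<Psi> x \<in> log_unit_lattice \<sigma>1"
      "\<forall>x\<in>log_unit_lattice \<sigma>2. \<Psi> x = 0 \<longrightarrow> x = 0"
      "\<forall>x\<in>log_unit_lattice \<sigma>2. \<forall>y\<in>log_unit_lattice \<sigma>2. r * inner x y = 1 * inner (\<Psi> x) (\<Psi> y)"
      using lattice_basis_map[OF B(2,1) B(3)[symmetric] g21] by blast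
    have "range s1 \<subseteq> range s2"
    proof (rule range_subset_of_lattice_map[OF assms(1) E1 E2 assms(8), of \<Phi>])
      fix x y z w assume "x \<in> log_unit_lattice \<sigma>1" "y \<in> log_unit_lattice \<sigma>1"
        "z \<in> log_unit_lattice \<sigma>1" "w \<in> log_unit_lattice \<sigma>1"
      then have "inner x y = r * inner (\<Phi> x) (\<Phi> y)" "inner z w = r * inner (\<Phi> z) (\<Phi> w)"
        using \<Phi>(3) by simp_all
      \<comment> \<open>Both sides are r times the product of the two inner products of images, so
        the factor drops out.\<close>
      then show "inner x y * inner (\<Phi> z) (\<Phi> w) = inner z w * inner (\<Phi> x) (\<Phi> y)" by simp
    qed (use \<Phi> in auto)
    moreover have "range s2 \<subseteq> range s1"
    proof (rule range_subset_of_lattice_map[OF assms(1) E2 E1 assms(9), of \<Psi>])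
      fix x y z w assume "x \<in> log_unit_lattice \<sigma>2" "y \<in> log_unit_lattice \<sigma>2"
        "z \<in> log_unit_lattice \<sigma>2" "w \<in> log_unit_lattice \<sigma>2"
      then have "inner (\<Psi> x) (\<Psi> y) = r * inner x y" "inner (\<Psi> z) (\<Psi> w) = r * inner z w"
        using \<Psi>(3) by simp_all
      then show "inner x y * inner (\<Psi> z) (\<Psi> w) = inner z w * inner (\<Psi> x) (\<Psi> y)" by simp
    qed (use \<Psi> in auto)
    ultimately have "range s1 = range s2" by (rule subset_antisym)
    then show "fields_isomorphic TYPE('k1) TYPE('k2)"
      by (rule fields_isomorphic_of_range_eq[OF K1.hom_s K2.hom_s])
  next
    assume "fields_isomorphic TYPE('k1) TYPE('k2)"
    then obtain f :: "'k1 \<Rightarrow> 'k2" where f: "is_field_iso f" by (auto simp: fields_isomorphic_def)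
    obtain B where "lattice_basis B (log_unit_lattice \<sigma>1)" by (rule K1.log_unit_lattice_basis)
    then show "lattice_similar (log_unit_lattice \<sigma>1) (log_unit_lattice \<sigma>2)"
      using f by (rule lattice_similar_of_iso[OF assms(6,7)])
  qed
qed

end
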